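(* Let $n>2$ and let $f$ satisfy conditions (F0), (Fu), (Fs) of the context. Let $0\le\nu<m(l_u)$ and let $w$ and $X$ be the associated weight and weighted space. For $\phi\in X$ consider the operator $$F_\phi(u)(x,t)=\Big(e^{t\Delta}\phi+\int_0^te^{(t-s)\Delta}f(u(\cdot,s),|\cdot|)\,ds\Big)(x).$$ If the initial datum $\phi\in X$, there is $T_\phi>0$ such that (for a properly chosen radius $\rho>0$) $F_\phi$ has a unique fixed point $u$ in $B_\rho^T(\phi)$ for any $0<T<T_\phi$, and if $T_\phi<+\infty$, then $\lim_{t\to T_\phi^-}\|u(\cdot,t)\|_X=+\infty$.
   Context: Constants: $2_*=\frac{2(n-1)}{n-2}$, $2^*=\frac{2n}{n-2}$, $m(l)=\frac{2}{l-2}$ for $l>2$. (F0): $f(u,r)$ is locally Lipschitz in $u$ and $r$ for $u\ge0$, $r>0$; $f(0,r)\equiv0$; $f(u,r)>0$ and $f(u,r)$ is increasing in $u$ for all $u>0$, $r>0$; there is a constant $C(u)>0$ such that $f(u,r)r^2\le C(u)$ for $0<r\le1$. Set $g(y,s;l)=f(ye^{-m(l)s},e^s)e^{(m(l)+2)s}$. (G0) for a function $h$: $h'(y)$ is strictly increasing for $y>0$, $h(y)/y\to0$ as $y\to0$ and $h(y)/y\to+\infty$ as $y\to+\infty$. (Gu): there is $l_u>2_*$ such that for any $y>0$ $g(y,s;l_u)$ converges as $s\to-\infty$, uniformly on compact intervals, to an $s$-independent locally Lipschitz function $g^{-\infty}(y)\not\equiv0$ satisfying (G0); there is $\varpi>0$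 with $\lim_{s\to-\infty}e^{-\varpi s}\frac{\partial}{\partial s}g(y,s;l_u)=0$; if $l_u=2^*$, there is also $M>0$ such that $g(y,s;2^* )$ is monotone in $s$ for any $y>0$ and $s<-M$. (Fu): (Gu) holds and there is $D>0$ such that $\frac{\partial}{\partial y}g(y,s;l_u)\le D|y|^\delta$ for $0\le y\le1$ and $s\le0$. (Fs): there are $\ell\ge0$, $\bar C>0$, $\delta>0$, $\varepsilon>0$ such that $|f(u,r)-f(u+h,r)|\le\bar C\,h\,(u+h)^\delta r^\ell$ whenever $r\ge1$, $0\le u\le1$, $0\le h\le\varepsilon$. The same $\delta$ is used in (Fu), (Fs) and $w$. Weight and space: $w(x)=|x|^\nu$ for $|x|\le1$, $w(x)=|x|^{\ell/\delta}$ for $|x|\ge1$; $\|\phi\|_X=\|\phi w\|_{L^\infty(\mathbb R^n)}$, $X=\{\phi:\|\phi\|_X<+\infty\}$. $B_\rho^T(\phi)$ is the ball of centre $\phi$ (regarded as constant in time) and radius $\rho$ in $L^\infty([0,T];X)$. Heat semigroup: $e^{t\Delta}\phi(x)=(4\pi t)^{-n/2}\int_{\mathbb R^n}\exp\big(-\frac{|x-y|^2}{4t}\big)\phi(y)\,dy$.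
   Formalization: For ℓ=0 it is additionally assumed that f is Lipschitz in u on each [0,K] uniformly in r≥1 (otherwise existence can fail, e.g. for constant data); f is continued by 0 to u<0, and the radius ρ may depend on T. *)

theory Defs
  imports "HOL-Analysis.Analysis" "HOL-Probability.Essential_Supremum"
begin

text \<open>
  Throughout, \<open>n\<close> is the space dimension. The nonlinearity \<open>f u r\<close> is only meaningful for
  \<open>u \<ge> 0\<close> and \<open>r > 0\<close>; no hypothesis below looks at any other value.
\<close>

definition two_lower_star :: "nat \<Rightarrow> real" where
  "two_lower_star n = 2 * (real n - 1) / (real n - 2)"

definition two_upper_star :: "nat \<Rightarrow> real" where
  "two_upper_star n = 2 * real n / (real n - 2)"

definition m_exp :: "real \<Rightarrow> real" where
  "m_exp l = 2 / (l - 2)"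

definition loc_lipschitz :: "'a::metric_space set \<Rightarrow> ('a \<Rightarrow> real) \<Rightarrow> bool" where
  "loc_lipschitz S F \<longleftrightarrow> (\<forall>p\<in>S. \<exists>e>0. \<exists>L. L-lipschitz_on (cball p e \<inter> S) F)"

definition cond_F0 :: "(real \<Rightarrow> real \<Rightarrow> real) \<Rightarrow> bool" where
  "cond_F0 f \<longleftrightarrow>
     loc_lipschitz ({0..} \<times> {0<..}) (\<lambda>(u, r). f u r) \<and>
     (\<forall>r>0. f 0 r = 0) \<and>
     (\<forall>u>0. \<forall>r>0. f u r > 0) \<and>
     (\<forall>r>0. mono_on {0<..} (\<lambda>u. f u r)) \<and>
     (\<exists>C. \<forall>u>0. C u > 0 \<and> (\<forall>r. 0 < r \<and> r \<le> 1 \<longrightarrow> f u r * r\<^sup>2 \<le> C u))"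

definition g_fun :: "(real \<Rightarrow> real \<Rightarrow> real) \<Rightarrow> real \<Rightarrow> real \<Rightarrow> real \<Rightarrow> real" where
  "g_fun f l y s = f (y * exp (- m_exp l * s)) (exp s) * exp ((m_exp l + 2) * s)"

definition cond_G0 :: "(real \<Rightarrow> real) \<Rightarrow> bool" where
  "cond_G0 h \<longleftrightarrow>
     (\<forall>y>0. h differentiable (at y)) \<and> strict_mono_on {0<..} (deriv h) \<and>
     ((\<lambda>y. h y / y) \<longlongrightarrow> 0) (at_right 0) \<and>
     filterlim (\<lambda>y. h y / y) at_top at_top"

text \<open>
  The exponent \<open>lu\<close> is a parameter, since the range of \<open>\<nu>\<close> refers to it. Compact intervals
  are those of \<open>y > 0\<close>. The \<open>s\<close>-derivative is only required to exist near \<open>-\<infinity>\<close>, where its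
  limit is taken, and the direction of monotonicity in \<open>s\<close> may depend on \<open>y\<close>.
\<close>

definition cond_Gu :: "nat \<Rightarrow> (real \<Rightarrow> real \<Rightarrow> real) \<Rightarrow> real \<Rightarrow> bool" where
  "cond_Gu n f lu \<longleftrightarrow>
     lu > two_lower_star n \<and>
     (\<exists>ginf. (\<forall>a b. 0 < a \<and> a \<le> b \<longrightarrow>
                 uniform_limit {a..b} (\<lambda>s y. g_fun f lu y s) ginf at_bot) \<and>
             loc_lipschitz {0<..} ginf \<and> (\<exists>y>0. ginf y \<noteq> 0) \<and> cond_G0 ginf) \<and>
     (\<exists>\<omega>>0. \<forall>y>0. (\<forall>\<^sub>F s in at_bot. (\<lambda>s. g_fun f lu y s) differentiable (at s)) \<and>
        ((\<lambda>s. exp (- \<omega> * s) * deriv (\<lambda>s. g_fun f lu y s) s) \<longlongrightarrow> 0) at_bot) \<and>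
     (lu = two_upper_star n \<longrightarrow>
        (\<exists>M>0. \<forall>y>0. mono_on {..< -M} (g_fun f lu y) \<or> antimono_on {..< -M} (g_fun f lu y)))"

text \<open>The derivative at \<open>y = 0\<close> is one-sided, since \<open>f\<close> is not given for \<open>u < 0\<close>.\<close>

definition cond_Fu :: "nat \<Rightarrow> (real \<Rightarrow> real \<Rightarrow> real) \<Rightarrow> real \<Rightarrow> real \<Rightarrow> bool" where
  "cond_Fu n f lu \<delta> \<longleftrightarrow>
     cond_Gu n f lu \<and>
     (\<exists>D>0. \<forall>y\<in>{0..1}. \<forall>s\<le>0. \<exists>d.
        ((\<lambda>y. g_fun f lu y s) has_real_derivative d) (at y within {0..}) \<and>
        d \<le> D * \<bar>y\<bar> powr \<delta>)"

definition cond_Fs :: "(real \<Rightarrow> real \<Rightarrow> real) \<Rightarrow> real \<Rightarrow> real \<Rightarrow> bool" where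
  "cond_Fs f l \<delta> \<longleftrightarrow>
     l \<ge> 0 \<and> \<delta> > 0 \<and>
     (\<exists>C>0. \<exists>\<epsilon>>0. \<forall>r\<ge>1. \<forall>u\<in>{0..1}. \<forall>h\<in>{0..\<epsilon>}.
        \<bar>f u r - f (u + h) r\<bar> \<le> C * h * (u + h) powr \<delta> * r powr l)"

text \<open>
  For \<open>l = 0\<close> the elements of the weighted space need not decay, so their values for large
  \<open>\<bar>x\<bar>\<close> may leave the range of \<open>u\<close> controlled by \<open>cond_Fs\<close>. Without a bound there, existence
  fails: with \<open>\<delta> = p - 1\<close> and
  \<open>f u r = u powr p + max 0 (u - 2) * max 0 (r - 1) * exp (exp r)\<close>, all conditions
  above hold for suitable \<open>p\<close>, but the heat integrals of \<open>f (u, \<bar>x\<bar>)\<close> diverge for the datum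
  \<open>\<phi> = 3\<close>. The next condition is imposed only when \<open>l = 0\<close>; it holds, for instance, if \<open>f\<close>
  is a pure power of \<open>u\<close> with exponent \<open>\<ge> 1\<close>.
\<close>

definition unif_lipschitz_far :: "(real \<Rightarrow> real \<Rightarrow> real) \<Rightarrow> bool" where
  "unif_lipschitz_far f \<longleftrightarrow> (\<forall>K>0. \<exists>L. \<forall>r\<ge>1. L-lipschitz_on {0..K} (\<lambda>u. f u r))"

definition weight :: "real \<Rightarrow> real \<Rightarrow> real \<Rightarrow> 'a::euclidean_space \<Rightarrow> real" where
  "weight \<nu> l \<delta> x = (if norm x \<le> 1 then norm x powr \<nu> else norm x powr (l / \<delta>))"

definition X_norm :: "real \<Rightarrow> real \<Rightarrow> real \<Rightarrow> ('a::euclidean_space \<Rightarrow> real) \<Rightarrow> ereal" where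
  "X_norm \<nu> l \<delta> \<phi> = esssup lebesgue (\<lambda>x. ereal \<bar>\<phi> x * weight \<nu> l \<delta> x\<bar>)"

definition X_space :: "real \<Rightarrow> real \<Rightarrow> real \<Rightarrow> ('a::euclidean_space \<Rightarrow> real) set" where
  "X_space \<nu> l \<delta> = {\<phi> \<in> borel_measurable lebesgue. X_norm \<nu> l \<delta> \<phi> < \<infinity>}"

text \<open>
  The closed ball of \<open>L\<^sup>\<infinity>([0,T]; X)\<close> about the time-independent function \<open>\<phi>\<close>. Elements are
  represented by functions that are jointly measurable in time and space.
\<close>

definition X_ball :: "real \<Rightarrow> real \<Rightarrow> real \<Rightarrow> real \<Rightarrow> real \<Rightarrow> ('a::euclidean_space \<Rightarrow> real)
    \<Rightarrow> (real \<Rightarrow> 'a \<Rightarrow> real) set" where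
  "X_ball \<nu> l \<delta> T \<rho> \<phi> =
     {u. (\<lambda>(t, x). u t x) \<in> borel_measurable (lebesgue_on ({0..T} \<times> UNIV)) \<and>
         (AE t in lebesgue_on {0..T}. X_norm \<nu> l \<delta> (\<lambda>x. u t x - \<phi> x) \<le> ereal \<rho>)}"

definition heat_kernel :: "real \<Rightarrow> 'a::euclidean_space \<Rightarrow> real" where
  "heat_kernel t x = (4 * pi * t) powr (- (real DIM('a) / 2)) * exp (- (norm x)\<^sup>2 / (4 * t))"

definition heat_semigroup :: "real \<Rightarrow> ('a::euclidean_space \<Rightarrow> real) \<Rightarrow> 'a \<Rightarrow> real" where
  "heat_semigroup t \<phi> x =
     (if t = 0 then \<phi> x else LINT y|lebesgue. heat_kernel t (x - y) * \<phi> y)"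

text \<open>
  Members of the weighted space may be negative, so \<open>f\<close> is continued by \<open>0 = f 0 r\<close> to
  \<open>u < 0\<close>. If \<open>\<phi> \<ge> 0\<close>, every fixed point of the operator below is nonnegative, because the
  integral term is, and the continuation plays no role.
\<close>

definition f_ext :: "(real \<Rightarrow> real \<Rightarrow> real) \<Rightarrow> real \<Rightarrow> real \<Rightarrow> real" where
  "f_ext f u r = f (max u 0) r"

definition F_op :: "(real \<Rightarrow> real \<Rightarrow> real) \<Rightarrow> ('a::euclidean_space \<Rightarrow> real)
    \<Rightarrow> (real \<Rightarrow> 'a \<Rightarrow> real) \<Rightarrow> real \<Rightarrow> 'a \<Rightarrow> real" where
  "F_op f \<phi> u t x = heat_semigroup t \<phi> x +
     (LINT s:{0..t}|lebesgue. heat_semigroup (t - s) (\<lambda>y. f_ext f (u s y) (norm y)) x)"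

text \<open>
  Non-integrable functions have integral \<open>0\<close>, so convergence of the integrals in \<open>F_op\<close> has to
  be demanded separately. (\<open>heat_kernel 0 = 0\<close>, so nothing is demanded at time \<open>0\<close>.)
\<close>

definition F_op_defined :: "(real \<Rightarrow> real \<Rightarrow> real) \<Rightarrow> ('a::euclidean_space \<Rightarrow> real)
    \<Rightarrow> (real \<Rightarrow> 'a \<Rightarrow> real) \<Rightarrow> real \<Rightarrow> 'a \<Rightarrow> bool" where
  "F_op_defined f \<phi> u t x \<longleftrightarrow>
     integrable lebesgue (\<lambda>y. heat_kernel t (x - y) * \<phi> y) \<and>
     set_integrable lebesgue ({0..t} \<times> UNIV)
       (\<lambda>(s, y). heat_kernel (t - s) (x - y) * f_ext f (u s y) (norm y))"

definition fixed_point :: "(real \<Rightarrow> real \<Rightarrow> real) \<Rightarrow> ('a::euclidean_space \<Rightarrow> real) \<Rightarrow> real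
    \<Rightarrow> (real \<Rightarrow> 'a \<Rightarrow> real) \<Rightarrow> bool" where
  "fixed_point f \<phi> T u \<longleftrightarrow>
     (AE (t, x) in lebesgue_on ({0..T} \<times> UNIV).
        F_op_defined f \<phi> u t x \<and> u t x = F_op f \<phi> u t x)"

text \<open>
  \<open>u\<close> is the solution on \<open>[0, Tmax)\<close>, with \<open>Tmax \<le> \<infinity>\<close>. For each \<open>T < Tmax\<close> its restriction to
  \<open>[0, T]\<close> is the unique fixed point in a ball; the radius depends on \<open>T\<close>, as blow-up at a
  finite \<open>Tmax\<close> forces. A fixed point is an almost-everywhere class in \<open>(t, x)\<close>; the second
  clause selects the representative given by the operator itself at every single time, so that
  \<open>X_norm (u t)\<close> is meaningful for each \<open>t\<close> in the blow-up clause.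
\<close>

definition maximal_solution :: "(real \<Rightarrow> real \<Rightarrow> real) \<Rightarrow> real \<Rightarrow> real \<Rightarrow> real
    \<Rightarrow> ('a::euclidean_space \<Rightarrow> real) \<Rightarrow> ereal \<Rightarrow> (real \<Rightarrow> 'a \<Rightarrow> real) \<Rightarrow> bool" where
  "maximal_solution f \<nu> l \<delta> \<phi> Tmax u \<longleftrightarrow>
     (\<forall>T>0. ereal T < Tmax \<longrightarrow>
        (\<exists>\<rho>>0. u \<in> X_ball \<nu> l \<delta> T \<rho> \<phi> \<and> fixed_point f \<phi> T u \<and>
           (\<forall>v \<in> X_ball \<nu> l \<delta> T \<rho> \<phi>. fixed_point f \<phi> T v \<longrightarrow>
              (AE (t, x) in lebesgue_on ({0..T} \<times> UNIV). v t x = u t x)))) \<and>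
     (\<forall>t\<ge>0. ereal t < Tmax \<longrightarrow>
        u t \<in> X_space \<nu> l \<delta> \<and>
        (AE x in lebesgue. F_op_defined f \<phi> u t x \<and> u t x = F_op f \<phi> u t x)) \<and>
     (Tmax < \<infinity> \<longrightarrow>
        ((\<lambda>t. X_norm \<nu> l \<delta> (u t)) \<longlongrightarrow> \<infinity>) (at_left (real_of_ereal Tmax)))"

end

theory Submission
  imports Defs "HOL-Probability.Probability"
begin

text \<open>
  Let \<open>r = norm x\<close> and \<open>m = m_exp lu\<close>. In the variable \<open>y = u * r powr
  m\<close> the nonlinearity becomes \<open>g_fun\<close>, whose derivative in \<open>y\<close> is at
  most of order \<open>y powr \<delta>\<close> near the origin. A function of finite weighted norm has
  \<open>y\<close> at most of order \<open>r powr (m - \<nu>)\<close> there, which tends to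
  \<open>0\<close>. So on every ball of the weighted space, \<open>f\<close> is Lipschitz in
  \<open>u\<close> with a constant of order \<open>r powr (\<gamma> - 2)\<close> for \<open>r \<le>
  1\<close>, with some \<open>\<gamma> > 0\<close>. For \<open>r \<ge> 1\<close> the constant is
  bounded: the decay built into the weight absorbs the growth of \<open>f\<close> in \<open>r\<close>,
  or, if \<open>l = 0\<close>, \<open>unif_lipschitz_far\<close> applies
  (\<open>nonlinearity_lipschitz_weighted\<close>). A potential of order below \<open>2\<close> is
  harmless for the heat semigroup: in the weighted norm it costs a factor \<open>t powr (\<gamma> / 2 -
  1)\<close>, which is integrable at \<open>t = 0\<close> (\<open>heat_integral_potential_le\<close>).
  The hypothesis on \<open>lu\<close> gives \<open>\<nu> < n - 2\<close>, which makes the singularities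
  that occur integrable.

  Existence comes from monotonicity. Since \<open>f\<close> is nonnegative and increasing in
  \<open>u\<close>, the Picard iterates of the integral term increase, and their limit, with values in
  \<open>[0, \<infinity>]\<close>, satisfies the equation as long as it is bounded in the weighted norm
  (\<open>source_part_eq_duhamel\<close>). So one function serves for all times, and the maximal time is
  the supremum of the times up to which it is bounded. If the limit has norm \<open>A\<close> at some
  time, it stays bounded for a further time that depends on \<open>A\<close>, but not on when this
  happens within a bounded interval (\<open>bounded_restart\<close>); applied at time \<open>0\<close>,
  this shows that the maximal time is positive, and applied just before a finite maximal time, that the
  norm tends to infinity there.

  Uniqueness holds among all solutions of bounded weighted norm on a given interval
  (\<open>solution_unique\<close>): with bounds that grow like \<open>exp (\<mu> * t)\<close>, the
  Duhamel operator is a contraction for large \<open>\<mu>\<close>. Hence any radius of the ball that is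
  large enough to contain the solution will do. Everything is carried out for Borel functions; the last
  part passes to Lebesgue measurable functions and equality almost everywhere.
\<close>

section \<open>The heat kernel\<close>

lemma heat_kernel_nonneg [simp]: "0 \<le> heat_kernel t x"
  by (simp add: heat_kernel_def)

lemma heat_kernel_zero [simp]: "heat_kernel 0 x = 0"
  by (simp add: heat_kernel_def)

lemma heat_kernel_measurable [measurable (raw)]:
  fixes g :: "'b \<Rightarrow> 'a::euclidean_space"
  assumes [measurable]: "f \<in> borel_measurable M" "g \<in> borel_measurable M"
  shows "(\<lambda>z. heat_kernel (f z) (g z)) \<in> borel_measurable M"
  unfolding heat_kernel_def by measurable

text \<open>
  The kernel is a product of one-dimensional normal densities of variance \<open>2 * t\<close>, which reduces its
  total mass to the one-dimensional case.
\<close>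

lemma heat_kernel_eq_prod:
  fixes x :: "'a::euclidean_space"
  assumes "t > 0"
  shows "heat_kernel t x = (\<Prod>b\<in>Basis. normal_density 0 (sqrt (2 * t)) (x \<bullet> b))"
proof -
  have "(\<Prod>b\<in>(Basis::'a set). normal_density 0 (sqrt (2 * t)) (x \<bullet> b))
      = (\<Prod>b\<in>(Basis::'a set). 1 / sqrt (4 * pi * t)) * (\<Prod>b\<in>(Basis::'a set). exp (- (x \<bullet> b)\<^sup>2 / (4 * t)))"
    using assms unfolding normal_density_def prod.distrib [symmetric]
    by (intro prod.cong) (auto simp: algebra_simps)
  also have "(\<Prod>b\<in>(Basis::'a set). 1 / sqrt (4 * pi * t)) = (4 * pi * t) powr (- (real DIM('a) / 2))"
  proof -
    have "1 / sqrt (4 * pi * t) = (4 * pi * t) powr (- (1 / 2))"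
      using assms by (simp add: powr_half_sqrt powr_minus_divide)
    moreover have "((4 * pi * t) powr (- (1 / 2))) ^ DIM('a) = (4 * pi * t) powr (- (real DIM('a) / 2))"
      using assms by (simp add: powr_realpow [symmetric] powr_powr)
    ultimately show ?thesis by simp
  qed
  also have "(\<Prod>b\<in>(Basis::'a set). exp (- (x \<bullet> b)\<^sup>2 / (4 * t))) = exp (- (norm x)\<^sup>2 / (4 * t))"
  proof -
    have "(\<Sum>b\<in>(Basis::'a set). (x \<bullet> b)\<^sup>2) = (norm x)\<^sup>2"
      unfolding power2_norm_eq_inner by (subst euclidean_inner) (simp add: power2_eq_square)
    then have "(\<Sum>b\<in>(Basis::'a set). - (x \<bullet> b)\<^sup>2 / (4 * t)) = - (norm x)\<^sup>2 / (4 * t)"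
      by (simp add: sum_divide_distrib [symmetric] sum_negf)
    then show ?thesis
      by (simp add: exp_sum [symmetric])
  qed
  finally show ?thesis
    by (simp add: heat_kernel_def)
qed

lemma nn_integral_heat_kernel:
  assumes "t > 0"
  shows "(\<integral>\<^sup>+ (x::'a::euclidean_space). ennreal (heat_kernel t x) \<partial>lborel) = 1"
proof -
  have "(\<integral>\<^sup>+ (x::'a). ennreal (heat_kernel t x) \<partial>lborel)
      = (\<integral>\<^sup>+ (x::'a). (\<Prod>b\<in>Basis. ennreal (normal_density 0 (sqrt (2 * t)) (x \<bullet> b))) \<partial>lborel)"
    using assms by (simp add: heat_kernel_eq_prod prod_ennreal)
  also have "\<dots> = (\<Prod>b\<in>(Basis::'a set). \<integral>\<^sup>+ x. ennreal (normal_density 0 (sqrt (2 * t)) x) \<partial>lborel)"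
    by (subst nn_integral_lborel_prod) auto
  also have "(\<integral>\<^sup>+ x. ennreal (normal_density 0 (sqrt (2 * t)) x) \<partial>lborel) = 1"
    using assms by (subst nn_integral_eq_integral) auto
  finally show ?thesis by simp
qed

lemma nn_integral_lborel_diff:
  fixes x :: "'a::euclidean_space"
  assumes [measurable]: "g \<in> borel_measurable borel"
  shows "(\<integral>\<^sup>+ y. g (x - y) \<partial>lborel) = (\<integral>\<^sup>+ y. g y \<partial>lborel)"
proof -
  have "(\<integral>\<^sup>+ y. g y \<partial>lborel)
      = (\<integral>\<^sup>+ y. g y \<partial>(density (distr lborel borel (\<lambda>y. x + (-1) *\<^sub>R y)) (\<lambda>_. \<bar>-1::real\<bar>^DIM('a))))"
    using lborel_affine[of "-1" x] by simp
  also have "\<dots> = (\<integral>\<^sup>+ y. g (x - y) \<partial>lborel)"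
    by (simp add: nn_integral_density nn_integral_distr)
  finally show ?thesis by simp
qed

lemma nn_integral_heat_kernel_diff:
  fixes x :: "'a::euclidean_space"
  assumes "t > 0"
  shows "(\<integral>\<^sup>+ y. ennreal (heat_kernel t (x - y)) \<partial>lborel) = 1"
  using nn_integral_lborel_diff[of "\<lambda>z. ennreal (heat_kernel t z)" x] nn_integral_heat_kernel[OF assms]
  by simp

lemma mult_swap_pairs: "(a * b) * (c * d) = (a * c) * (b * d)" for a b c d :: real
  by simp

text \<open>
  Completing the square in the exponent turns the product of two Gaussians with common variable
  \<open>y\<close> into a Gaussian in \<open>y\<close> times a factor free of \<open>y\<close>, and integrating out \<open>y\<close> gives
  the semigroup law.
\<close>

lemma heat_kernel_mult:
  fixes x y z :: "'a::euclidean_space"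
  assumes s: "s > 0" and t: "t > 0"
  shows "heat_kernel s (x - y) * heat_kernel t (y - z)
     = heat_kernel (s + t) (x - z) *
       heat_kernel (s * t / (s + t)) ((t / (s + t)) *\<^sub>R x + (s / (s + t)) *\<^sub>R z - y)"
proof -
  define a where "a = x - y"
  define b where "b = y - z"
  have m: "(t / (s + t)) *\<^sub>R x + (s / (s + t)) *\<^sub>R z - y = (1 / (s + t)) *\<^sub>R (t *\<^sub>R a - s *\<^sub>R b)"
  proof -
    have "(t / (s + t)) *\<^sub>R x + (s / (s + t)) *\<^sub>R z - y
        = (1 / (s + t)) *\<^sub>R (t *\<^sub>R x + s *\<^sub>R z - (s + t) *\<^sub>R y)"
      using s t by (simp add: scaleR_add_right scaleR_diff_right)
    also have "t *\<^sub>R x + s *\<^sub>R z - (s + t) *\<^sub>R y = t *\<^sub>R a - s *\<^sub>R b"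
      by (simp add: a_def b_def algebra_simps)
    finally show ?thesis .
  qed
  have xz: "x - z = a + b" by (simp add: a_def b_def)
  have n1: "(norm ((1 / (s + t)) *\<^sub>R (t *\<^sub>R a - s *\<^sub>R b)))\<^sup>2
      = (t\<^sup>2 * (norm a)\<^sup>2 - 2 * s * t * (a \<bullet> b) + s\<^sup>2 * (norm b)\<^sup>2) / (s + t)\<^sup>2"
  proof -
    have "(norm (t *\<^sub>R a - s *\<^sub>R b))\<^sup>2
        = t\<^sup>2 * (norm a)\<^sup>2 - 2 * s * t * (a \<bullet> b) + s\<^sup>2 * (norm b)\<^sup>2"
      by (simp only: power2_norm_eq_inner inner_diff_left inner_diff_right inner_scaleR_left
          inner_scaleR_right inner_commute[of b a]) (simp add: algebra_simps power2_eq_square)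
    then show ?thesis
      by (simp add: power_mult_distrib power_divide del: scaleR_diff_right)
  qed
  have n2: "(norm (a + b))\<^sup>2 = (norm a)\<^sup>2 + 2 * (a \<bullet> b) + (norm b)\<^sup>2"
    by (simp add: power2_norm_eq_inner inner_add_left inner_add_right inner_commute)
  have expo: "- A / (4 * s) + - B / (4 * t)
      = - (A + 2 * c + B) / (4 * (s + t))
        + - ((t\<^sup>2 * A - 2 * s * t * c + s\<^sup>2 * B) / (s + t)\<^sup>2) / (4 * (s * t / (s + t)))" for A B c
  proof -
    have "- ((t\<^sup>2 * A - 2 * s * t * c + s\<^sup>2 * B) / (s + t)\<^sup>2) / (4 * (s * t / (s + t)))
        = - (t\<^sup>2 * A - 2 * s * t * c + s\<^sup>2 * B) / (4 * s * t * (s + t))"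
      using s t by (simp add: divide_simps power2_eq_square) (simp add: algebra_simps)?
    moreover have "- (A + 2 * c + B) / (4 * (s + t)) = - (s * t * (A + 2 * c + B)) / (4 * s * t * (s + t))"
      using s t by (simp add: divide_simps)
    moreover have "- A / (4 * s) + - B / (4 * t) = - ((s + t) * (t * A + s * B)) / (4 * s * t * (s + t))"
      using s t by (simp add: divide_simps)
    ultimately show ?thesis
      by (simp only: add_divide_distrib [symmetric])
         (intro arg_cong2[where f = "(/)"], simp_all add: algebra_simps power2_eq_square)
  qed
  have pw: "(4 * pi * s) powr e * (4 * pi * t) powr e
      = (4 * pi * (s + t)) powr e * (4 * pi * (s * t / (s + t))) powr e" for e
  proof -
    have "(4 * pi * (s + t)) * (4 * pi * (s * t / (s + t))) = (4 * pi * s) * (4 * pi * t)"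
      using s t by simp
    then have "((4 * pi * (s + t)) * (4 * pi * (s * t / (s + t)))) powr e = ((4 * pi * s) * (4 * pi * t)) powr e"
      by simp
    then show ?thesis
      using s t by (simp only: powr_mult)
  qed
  show ?thesis
    unfolding heat_kernel_def m n1 xz n2 a_def [symmetric] b_def [symmetric]
    by (subst (1 2) mult_swap_pairs, subst (1 2) exp_add [symmetric], subst pw, subst expo, rule refl)
qed

lemma heat_kernel_chapman_kolmogorov:
  fixes x z :: "'a::euclidean_space"
  assumes "s > 0" "t > 0"
  shows "(\<integral>\<^sup>+ y. ennreal (heat_kernel s (x - y)) * ennreal (heat_kernel t (y - z)) \<partial>lborel)
      = ennreal (heat_kernel (s + t) (x - z))"
proof -
  have "(\<integral>\<^sup>+ y. ennreal (heat_kernel s (x - y)) * ennreal (heat_kernel t (y - z)) \<partial>lborel)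
      = (\<integral>\<^sup>+ y. ennreal (heat_kernel (s + t) (x - z)) *
          ennreal (heat_kernel (s * t / (s + t))
            ((t / (s + t)) *\<^sub>R x + (s / (s + t)) *\<^sub>R z - y)) \<partial>lborel)"
    using assms by (simp add: ennreal_mult [symmetric] heat_kernel_mult)
  also have "\<dots> = ennreal (heat_kernel (s + t) (x - z))"
    using assms by (subst nn_integral_cmult) (simp_all add: nn_integral_heat_kernel_diff)
  finally show ?thesis .
qed

section \<open>Heat integrals of powers and weights\<close>

text \<open>
  A polynomial factor is bounded by half of the Gaussian decay, uniformly for bounded times. The
  constant comes from maximizing \<open>b * r - r\<^sup>2 / (8 * T)\<close> over \<open>r\<close>, after \<open>1 + r \<le> exp r\<close>.
\<close>

lemma heat_kernel_times_powr_le: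
  fixes z :: "'a::euclidean_space"
  assumes t: "0 < t" "t \<le> T" and b: "0 \<le> b"
  shows "heat_kernel t z * (1 + norm z) powr b
     \<le> 2 powr (real DIM('a) / 2) * exp (2 * T * b\<^sup>2) * heat_kernel (2 * t) z"
proof -
  let ?n = "real DIM('a) / 2" and ?r = "norm z"
  have T: "T > 0" using t by simp
  have "(1 + ?r) powr b \<le> exp ?r powr b"
    using b by (intro powr_mono2) (auto simp: exp_ge_add_one_self)
  also have "\<dots> = exp (b * ?r)"
    by (simp add: powr_def)
  also have "\<dots> \<le> exp (2 * T * b\<^sup>2 + ?r\<^sup>2 / (8 * t))"
  proof -
    have "0 \<le> (?r - 4 * T * b)\<^sup>2 / (8 * T)" using T by simp
    also have "\<dots> = ?r\<^sup>2 / (8 * T) - b * ?r + 2 * T * b\<^sup>2"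
      using T by (simp add: field_simps power2_eq_square)
    also have "?r\<^sup>2 / (8 * T) \<le> ?r\<^sup>2 / (8 * t)"
      using t by (intro divide_left_mono) auto
    finally show ?thesis by simp
  qed
  finally have *: "(1 + ?r) powr b \<le> exp (2 * T * b\<^sup>2) * exp (?r\<^sup>2 / (8 * t))"
    by (simp add: exp_add)
  have h: "2 powr ?n * heat_kernel (2 * t) z = heat_kernel t z * exp (?r\<^sup>2 / (8 * t))"
  proof -
    have "(4 * pi * (2 * t)) powr - ?n = 2 powr (- ?n) * (4 * pi * t) powr - ?n"
      using t by (simp add: powr_mult [symmetric])
    moreover have "exp (- ?r\<^sup>2 / (4 * (2 * t))) = exp (- ?r\<^sup>2 / (4 * t)) * exp (?r\<^sup>2 / (8 * t))"
      using t by (simp add: exp_add [symmetric] field_simps)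
    moreover have "2 powr ?n * 2 powr (- ?n) = (1::real)"
      by (simp add: powr_add [symmetric])
    moreover have "c * (d * A * (B * E)) = (c * d) * (A * B * E)" for c d A B E :: real
      by simp
    ultimately show ?thesis
      unfolding heat_kernel_def by (simp only: mult_1)
  qed
  have "heat_kernel t z * (1 + ?r) powr b \<le> heat_kernel t z * (exp (2 * T * b\<^sup>2) * exp (?r\<^sup>2 / (8 * t)))"
    by (intro mult_left_mono * heat_kernel_nonneg)
  also have "\<dots> = exp (2 * T * b\<^sup>2) * (2 powr ?n * heat_kernel (2 * t) z)"
    unfolding h by simp
  finally show ?thesis by (simp add: mult.commute mult.left_commute)
qed

lemma powr_times_exp_minus_le:
  fixes q a :: real
  assumes "q \<ge> 0" "a > 0"
  shows "q powr a * exp (- q) \<le> a powr a"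
proof -
  have "q / a \<le> exp (q / a)"
    using exp_ge_add_one_self[of "q / a"] by linarith
  then have "(q / a) powr a \<le> exp (q / a) powr a"
    using assms by (intro powr_mono2) auto
  also have "\<dots> = exp q" using assms by (simp add: powr_def)
  finally have "q powr a \<le> a powr a * exp q"
    using assms by (simp add: powr_divide divide_simps mult.commute)
  then show ?thesis
    by (simp add: exp_minus divide_simps)
qed

text \<open>
  The two admissible radii are the diffusion length \<open>sqrt t\<close>, at which the maximum of the kernel
  has size \<open>R\<close> to the power minus the dimension, and any lower bound for \<open>norm z\<close>, for which the
  exponential factor supplies the missing power of \<open>R\<close>.
\<close>

lemma heat_kernel_le_powr:
  fixes z :: "'a::euclidean_space"
  assumes t: "t > 0" and R: "R > 0" and cases: "R = sqrt t \<or> R \<le> norm z"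
  shows "heat_kernel t z
     \<le> (1 + (real DIM('a) / 2) powr (real DIM('a) / 2)) * R powr (- real DIM('a))"
proof -
  let ?n = "real DIM('a) / 2"
  have n: "?n > 0" by simp
  have a1: "(4 * pi * t) powr (- ?n) \<le> (4 * t) powr (- ?n)"
    using t n pi_gt3 by (intro powr_mono2') auto
  have "heat_kernel t z \<le> R powr (- real DIM('a)) \<or> heat_kernel t z \<le> ?n powr ?n * R powr (- real DIM('a))"
    using cases
  proof
    assume Rt: "R = sqrt t"
    have "heat_kernel t z \<le> (4 * pi * t) powr (- ?n) * 1"
      unfolding heat_kernel_def using t by (intro mult_left_mono) auto
    also have "\<dots> \<le> t powr (- ?n)"
      using t n pi_gt3 by (simp, intro powr_mono2') auto
    also have "\<dots> = R powr (- real DIM('a))"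
      using t by (simp add: Rt powr_half_sqrt [symmetric] powr_powr)
    finally show ?thesis ..
  next
    assume Rz: "R \<le> norm z"
    define q where "q = R\<^sup>2 / (4 * t)"
    have q: "q \<ge> 0" using t by (simp add: q_def)
    have "q powr ?n * R powr (- real DIM('a)) = (4 * t) powr (- ?n)"
    proof -
      have "(R\<^sup>2) powr ?n = R powr real DIM('a)"
        using R by (subst powr_numeral [symmetric], simp, subst powr_powr, simp)
      then have "q powr ?n = R powr real DIM('a) * (4 * t) powr (- ?n)"
        using t R by (simp only: q_def, subst powr_divide) (auto simp: powr_minus_divide)
      then show ?thesis
        using R by (simp add: powr_minus)
    qed
    then have eq: "(4 * t) powr (- ?n) * exp (- q) = (q powr ?n * exp (- q)) * R powr (- real DIM('a))"
      by (simp add: mult.commute mult.left_commute)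
    have "heat_kernel t z \<le> (4 * t) powr (- ?n) * exp (- q)"
      unfolding heat_kernel_def
    proof (intro mult_mono a1)
      have "q \<le> (norm z)\<^sup>2 / (4 * t)"
        unfolding q_def using t R Rz by (intro divide_right_mono power_mono) auto
      then show "exp (- (norm z)\<^sup>2 / (4 * t)) \<le> exp (- q)" by simp
    qed auto
    also have "\<dots> \<le> ?n powr ?n * R powr (- real DIM('a))"
      unfolding eq using powr_times_exp_minus_le[OF q n] by (intro mult_right_mono) auto
    finally show ?thesis ..
  qed
  then show ?thesis
    by (rule disjE) (simp_all add: distrib_right add_increasing add_increasing2)
qed

lemma ball_measurable [measurable]: "ball c r \<in> sets borel"
  by simp

text \<open>
  Cutting the ball into dyadic shells replaces the singular integrand by a convergent geometric
  series, which is where \<open>p\<close> below the dimension enters.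
\<close>

lemma nn_integral_norm_powr_ball:
  assumes p: "0 \<le> p" "p < real DIM('a::euclidean_space)"
  obtains c where "c \<ge> 0"
    "\<And>R. R > 0 \<Longrightarrow>
      (\<integral>\<^sup>+ y. indicator (ball 0 R) y * ennreal (norm (y::'a) powr (- p)) \<partial>lborel)
        \<le> ennreal (c * R powr (real DIM('a) - p))"
proof
  let ?n = "real DIM('a)" and ?v = "unit_ball_vol (real DIM('a))"
  \<comment> \<open>the ratio of the integrals over consecutive shells\<close>
  define \<theta> where "\<theta> = (2::real) powr (- (?n - p))"
  have \<theta>: "0 < \<theta>" "\<theta> < 1"
    using p by (auto simp: \<theta>_def powr_less_one)
  show "0 \<le> ?v * 2 powr p * (1 / (1 - \<theta>))"
    using \<theta> by simp
  fix R :: real assume R: "R > 0"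
  have pt: "indicator (ball 0 R) y * ennreal (norm (y::'a) powr (- p))
      \<le> (\<Sum>k. indicator (ball 0 (R / 2 ^ k)) y * ennreal ((R / 2 ^ Suc k) powr (- p)))"
    if y: "y \<noteq> 0" for y
  proof (cases "y \<in> ball 0 R")
    case True
    define P where "P k \<longleftrightarrow> R / 2 ^ Suc k \<le> norm y" for k
    obtain k0 where "(1/2::real) ^ k0 < norm y / R"
      using real_arch_pow_inv[of "norm y / R" "1/2"] y R by auto
    then have "R / 2 ^ k0 < norm y"
      using R by (simp add: power_divide field_simps)
    moreover have "R / 2 ^ Suc k0 \<le> R / 2 ^ k0"
      using R by (intro divide_left_mono) auto
    ultimately have "P k0" by (simp add: P_def)
    define k where "k = (LEAST k. P k)"
    have Pk: "P k" unfolding k_def by (rule LeastI) fact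
    have "norm y < R / 2 ^ k"
    proof (cases k)
      case 0 then show ?thesis using True by simp
    next
      case (Suc j)
      then have "\<not> P j" using not_less_Least[of j P] by (simp add: k_def)
      then show ?thesis by (simp add: P_def Suc)
    qed
    then have "indicator (ball 0 R) y * ennreal (norm y powr (- p))
        \<le> indicator (ball 0 (R / 2 ^ k)) y * ennreal ((R / 2 ^ Suc k) powr (- p))"
      using True Pk p R unfolding P_def by (simp, intro ennreal_leI powr_mono2') auto
    also have "\<dots> \<le> (\<Sum>k. indicator (ball 0 (R / 2 ^ k)) y * ennreal ((R / 2 ^ Suc k) powr (- p)))"
    proof -
      have "f k \<le> suminf f" for f :: "nat \<Rightarrow> ennreal"
        using sum_le_suminf[of f "{k}"] by simp
      then show ?thesis .
    qed
    finally show ?thesis .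
  qed simp
  have shell: "(\<integral>\<^sup>+ y. indicator (ball 0 (R / 2 ^ k)) (y::'a) * ennreal ((R / 2 ^ Suc k) powr (- p)) \<partial>lborel)
      = ennreal (?v * 2 powr p * R powr (?n - p) * \<theta> ^ k)" for k
  proof -
    have "(\<integral>\<^sup>+ y. indicator (ball 0 (R / 2 ^ k)) (y::'a) * ennreal ((R / 2 ^ Suc k) powr (- p)) \<partial>lborel)
        = ennreal (?v * (R / 2 ^ k) ^ DIM('a)) * ennreal ((R / 2 ^ Suc k) powr (- p))"
      using R by (simp add: nn_integral_multc emeasure_ball)
    also have "\<dots> = ennreal (?v * ((R / 2 ^ k) ^ DIM('a) * (R / 2 ^ Suc k) powr (- p)))"
      using R by (simp add: ennreal_mult [symmetric] mult.assoc)
    also have "(R / 2 ^ k) ^ DIM('a) * (R / 2 ^ Suc k) powr (- p) = 2 powr p * R powr (?n - p) * \<theta> ^ k"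
    proof -
      have r: "0 < R / 2 ^ k" using R by simp
      have "(R / 2 ^ k) ^ DIM('a) * (R / 2 ^ Suc k) powr (- p)
          = (R / 2 ^ k) powr ?n * ((R / 2 ^ k) powr (- p) * 2 powr p)"
      proof -
        have "(R / 2 ^ Suc k) powr (- p) = ((R / 2 ^ k) / 2) powr (- p)"
          by (simp add: mult.commute)
        also have "\<dots> = (R / 2 ^ k) powr (- p) * 2 powr p"
          using r by (subst powr_divide) (simp_all add: powr_minus_divide)
        finally show ?thesis
          using r by (simp add: powr_realpow)
      qed
      also have "\<dots> = 2 powr p * (R / 2 ^ k) powr (?n - p)"
        by (simp add: powr_diff powr_minus_divide)
      also have "(R / 2 ^ k) powr (?n - p) = R powr (?n - p) * \<theta> ^ k"
      proof -
        have "\<theta> ^ k = 2 powr (- (real k * (?n - p)))"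
          using \<theta> by (subst powr_realpow [symmetric], simp, simp only: \<theta>_def powr_powr)
            (simp add: algebra_simps)
        moreover have "((2::real) ^ k) powr (?n - p) = 2 powr (real k * (?n - p))"
          by (subst powr_realpow [symmetric], simp, simp only: powr_powr)
        ultimately show ?thesis
          using R by (simp only: powr_minus_divide) (subst powr_divide, auto)
      qed
      finally show ?thesis by simp
    qed
    finally show ?thesis by (simp add: mult.assoc)
  qed
  have "(\<integral>\<^sup>+ y. indicator (ball 0 R) y * ennreal (norm (y::'a) powr (- p)) \<partial>lborel)
      \<le> (\<integral>\<^sup>+ y. (\<Sum>k. indicator (ball 0 (R / 2 ^ k)) (y::'a) * ennreal ((R / 2 ^ Suc k) powr (- p))) \<partial>lborel)"
    using AE_lborel_singleton[of "0::'a"] by (intro nn_integral_mono_AE) (rule eventually_mono, assumption, rule pt)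
  also have "\<dots> = (\<Sum>k. ennreal (?v * 2 powr p * R powr (?n - p) * \<theta> ^ k))"
    by (subst nn_integral_suminf) (simp_all only: shell, measurable)
  also have "\<dots> = ennreal (\<Sum>k. ?v * 2 powr p * R powr (?n - p) * \<theta> ^ k)"
    using \<theta> by (intro suminf_ennreal2) (auto intro!: summable_mult summable_geometric)
  also have "(\<Sum>k. ?v * 2 powr p * R powr (?n - p) * \<theta> ^ k) = ?v * 2 powr p * R powr (?n - p) * (1 / (1 - \<theta>))"
    using \<theta> by (subst suminf_mult) (auto simp: suminf_geometric)
  finally show "(\<integral>\<^sup>+ y. indicator (ball 0 R) y * ennreal (norm (y::'a) powr (- p)) \<partial>lborel)
        \<le> ennreal (?v * 2 powr p * (1 / (1 - \<theta>)) * R powr (?n - p))"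
    by (simp add: mult.commute mult.left_commute)
qed

text \<open>
  Outside the ball of radius \<open>R\<close> the integrand is at most \<open>R powr (- p)\<close> times the kernel, which has
  mass \<open>1\<close>; inside, the kernel is at most a multiple of \<open>R\<close> to the power minus the dimension. For
  \<open>2 * R = norm x\<close> the latter holds because the ball stays at distance \<open>R\<close> from \<open>x\<close>.
\<close>

lemma heat_integral_norm_powr_le:
  assumes p: "0 \<le> p" "p < real DIM('a::euclidean_space)"
  obtains C where "C > 0"
    "\<And>t R (x::'a). \<lbrakk>t > 0; R > 0; R = sqrt t \<or> 2 * R = norm x\<rbrakk> \<Longrightarrow>
      (\<integral>\<^sup>+ y. ennreal (heat_kernel t (x - y) * norm y powr (- p)) \<partial>lborel) \<le> ennreal (C * R powr (- p))"
proof -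
  let ?n = "real DIM('a)"
  define K where "K = 1 + (?n / 2) powr (?n / 2)"
  have K: "K \<ge> 0" by (simp add: K_def)
  obtain c where c: "c \<ge> 0"
    "\<And>R. R > 0 \<Longrightarrow> (\<integral>\<^sup>+ y. indicator (ball 0 R) y * ennreal (norm (y::'a) powr (- p)) \<partial>lborel)
        \<le> ennreal (c * R powr (?n - p))"
    using nn_integral_norm_powr_ball[OF p] by blast
  show thesis
  proof
    show "1 + K * c > 0" using K c by (simp add: add_pos_nonneg)
    fix t R :: real and x :: 'a
    assume t: "t > 0" and R: "R > 0" and cases: "R = sqrt t \<or> 2 * R = norm x"
    have pt: "ennreal (heat_kernel t (x - y) * norm y powr (- p))
        \<le> ennreal (heat_kernel t (x - y)) * ennreal (R powr (- p))
          + ennreal (K * R powr (- ?n)) * (indicator (ball 0 R) y * ennreal (norm y powr (- p)))" for y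
    proof (cases "y \<in> ball 0 R")
      case True
      have "R = sqrt t \<or> R \<le> norm (x - y)"
        using cases True norm_triangle_ineq2[of x y] by auto
      from heat_kernel_le_powr[OF t R this]
      have "heat_kernel t (x - y) * norm y powr (- p) \<le> K * R powr (- ?n) * norm y powr (- p)"
        by (intro mult_right_mono) (auto simp: K_def)
      then show ?thesis
        using True K by (intro add_increasing) (auto simp: ennreal_mult [symmetric] intro!: ennreal_leI)
    next
      case False
      then have "heat_kernel t (x - y) * norm y powr (- p) \<le> heat_kernel t (x - y) * R powr (- p)"
        using R p by (intro mult_left_mono powr_mono2') auto
      then show ?thesis
        using False by (auto simp: ennreal_mult [symmetric] intro!: ennreal_leI)
    qed
    have "(\<integral>\<^sup>+ y. ennreal (heat_kernel t (x - y) * norm y powr (- p)) \<partial>lborel)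
        \<le> (\<integral>\<^sup>+ y. ennreal (heat_kernel t (x - y)) * ennreal (R powr (- p))
          + ennreal (K * R powr (- ?n)) * (indicator (ball 0 R) y * ennreal (norm y powr (- p))) \<partial>lborel)"
      by (intro nn_integral_mono pt)
    also have "\<dots> = ennreal (R powr (- p)) + ennreal (K * R powr (- ?n)) *
        (\<integral>\<^sup>+ y. indicator (ball 0 R) y * ennreal (norm (y::'a) powr (- p)) \<partial>lborel)"
      using t by (simp add: nn_integral_add nn_integral_multc nn_integral_cmult nn_integral_heat_kernel_diff)
    also have "\<dots> \<le> ennreal (R powr (- p)) + ennreal (K * R powr (- ?n)) * ennreal (c * R powr (?n - p))"
      using c R by (intro add_left_mono mult_left_mono) auto
    also have "\<dots> = ennreal ((1 + K * c) * R powr (- p))"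
    proof -
      have "R powr (- ?n) * R powr (?n - p) = R powr (- p)"
        by (simp add: powr_add [symmetric])
      then have "(K * R powr (- ?n)) * (c * R powr (?n - p)) = K * c * R powr (- p)"
        by (metis mult_swap_pairs)
      then show ?thesis
        using K c by (simp add: ennreal_mult [symmetric] ennreal_plus [symmetric] distrib_right
            del: ennreal_plus)
    qed
    finally show "(\<integral>\<^sup>+ y. ennreal (heat_kernel t (x - y) * norm y powr (- p)) \<partial>lborel)
        \<le> ennreal ((1 + K * c) * R powr (- p))" .
  qed
qed

lemma powr_neg_max_le:
  fixes s d a p :: real
  assumes "s > 0" "d > 0" "0 \<le> a" "a \<le> p"
  shows "(max s d) powr (- p) \<le> s powr (- (p - a)) * d powr (- a)"
proof -
  have "(max s d) powr (- p) = (max s d) powr (- (p - a)) * (max s d) powr (- a)"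
    by (simp add: powr_add [symmetric])
  also have "\<dots> \<le> s powr (- (p - a)) * d powr (- a)"
    using assms by (intro mult_mono powr_mono2') auto
  finally show ?thesis .
qed

text \<open>
  Taking the larger of the two admissible radii trades part of the singularity of the integrand
  for a negative power of time: this is the smoothing effect that makes a potential
  of order slightly below \<open>2\<close> harmless.
\<close>

lemma heat_integral_norm_powr_smoothing:
  assumes p: "0 \<le> a" "a \<le> p" "p < real DIM('a::euclidean_space)"
  obtains C where "C > 0"
    "\<And>t (x::'a). \<lbrakk>t > 0; x \<noteq> 0\<rbrakk> \<Longrightarrow>
      (\<integral>\<^sup>+ y. ennreal (heat_kernel t (x - y) * norm y powr (- p)) \<partial>lborel)
        \<le> ennreal (C * t powr (- ((p - a) / 2)) * norm x powr (- a))"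
proof -
  obtain C where C: "C > 0"
    "\<And>t R (x::'a). \<lbrakk>t > 0; R > 0; R = sqrt t \<or> 2 * R = norm x\<rbrakk> \<Longrightarrow>
      (\<integral>\<^sup>+ y. ennreal (heat_kernel t (x - y) * norm y powr (- p)) \<partial>lborel) \<le> ennreal (C * R powr (- p))"
    using heat_integral_norm_powr_le[of p] p by auto
  show thesis
  proof
    show "C * 2 powr a > 0" using C by simp
    fix t :: real and x :: 'a assume t: "t > 0" and x: "x \<noteq> 0"
    define R where "R = max (sqrt t) (norm x / 2)"
    have "(\<integral>\<^sup>+ y. ennreal (heat_kernel t (x - y) * norm y powr (- p)) \<partial>lborel) \<le> ennreal (C * R powr (- p))"
      using t x by (intro C) (auto simp: R_def max_def)
    also have "\<dots> \<le> ennreal (C * ((sqrt t) powr (- (p - a)) * (norm x / 2) powr (- a)))"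
      unfolding R_def using t x p C by (intro ennreal_leI mult_left_mono powr_neg_max_le) auto
    also have "(sqrt t) powr (- (p - a)) = t powr (- ((p - a) / 2))"
      using t by (simp add: powr_half_sqrt [symmetric] powr_powr minus_divide_left)
    also have "(norm x / 2) powr (- a) = 2 powr a * norm x powr (- a)"
      by (simp add: powr_divide powr_minus_divide)
    finally show "(\<integral>\<^sup>+ y. ennreal (heat_kernel t (x - y) * norm y powr (- p)) \<partial>lborel)
        \<le> ennreal (C * 2 powr a * t powr (- ((p - a) / 2)) * norm x powr (- a))"
      by (simp only: mult_ac)
  qed
qed

text \<open>
  The factor \<open>(1 + norm x) powr (- b)\<close> passes through the heat integral, whatever the size of
  \<open>b\<close>: by \<open>1 + norm x \<le> (1 + norm y) * (1 + norm (x - y))\<close> it only costs a power of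
  \<open>1 + norm (x - y)\<close>, which the Gaussian absorbs when its time is doubled.
\<close>

lemma heat_integral_weight_le:
  assumes p: "0 \<le> a" "a \<le> p" "p < real DIM('a::euclidean_space)" and b: "0 \<le> b" and T: "T > 0"
  obtains C where "C > 0"
    "\<And>t (x::'a). \<lbrakk>0 < t; t \<le> T; x \<noteq> 0\<rbrakk> \<Longrightarrow>
      (\<integral>\<^sup>+ y. ennreal (heat_kernel t (x - y) * ((1 + norm y) powr (- b) * (1 + norm y powr (- p)))) \<partial>lborel)
        \<le> ennreal (C * t powr (- ((p - a) / 2)) * ((1 + norm x) powr (- b) * (1 + norm x powr (- a))))"
proof -
  define e where "e = (p - a) / 2"
  have e: "e \<ge> 0" using p by (simp add: e_def)
  obtain C2 where C2: "C2 > 0"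
    "\<And>t (x::'a). \<lbrakk>t > 0; x \<noteq> 0\<rbrakk> \<Longrightarrow>
      (\<integral>\<^sup>+ y. ennreal (heat_kernel t (x - y) * norm y powr (- p)) \<partial>lborel)
        \<le> ennreal (C2 * t powr (- e) * norm x powr (- a))"
    unfolding e_def using heat_integral_norm_powr_smoothing[OF p] by blast
  define C1 where "C1 = 2 powr (real DIM('a) / 2) * exp (2 * T * b\<^sup>2)"
  have C1: "C1 > 0" by (simp add: C1_def)
  show thesis
  proof
    show "C1 * (T powr e + C2) > 0" using C1 C2 T by (simp add: add_pos_pos)
    fix t :: real and x :: 'a assume t: "0 < t" "t \<le> T" and x: "x \<noteq> 0"
    define w where "w = (1 + norm x) powr (- b)"
    have w: "w \<ge> 0" by (simp add: w_def)
    have pt: "heat_kernel t (x - y) * ((1 + norm y) powr (- b) * (1 + norm y powr (- p)))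
        \<le> C1 * w * (heat_kernel (2 * t) (x - y) * (1 + norm y powr (- p)))" for y
    proof -
      have "(1 + norm x) powr b \<le> ((1 + norm y) * (1 + norm (x - y))) powr b"
      proof (intro powr_mono2 b)
        have "norm x \<le> norm y + norm (x - y)"
          using norm_triangle_ineq[of y "x - y"] by simp
        moreover have "0 \<le> norm y * norm (x - y)" by simp
        moreover have "(1 + norm y) * (1 + norm (x - y))
            = 1 + norm y + norm (x - y) + norm y * norm (x - y)"
          by (simp add: algebra_simps)
        ultimately show "1 + norm x \<le> (1 + norm y) * (1 + norm (x - y))"
          by linarith
      qed auto
      then have "(1 + norm x) powr b \<le> (1 + norm y) powr b * (1 + norm (x - y)) powr b"
        by (simp add: powr_mult)
      then have "(1 + norm y) powr (- b) \<le> w * (1 + norm (x - y)) powr b"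
      proof -
        have "1 / Y \<le> 1 / X * Z" if "X > 0" "Y > 0" "X \<le> Y * Z" for X Y Z :: real
          using that by (simp add: divide_simps mult.commute)
        moreover have "(1 + norm x) powr b > 0" "(1 + norm y) powr b > 0"
          by (simp_all add: add_nonneg_eq_0_iff)
        ultimately show ?thesis
          using \<open>(1 + norm x) powr b \<le> (1 + norm y) powr b * (1 + norm (x - y)) powr b\<close>
          by (simp add: w_def powr_minus_divide)
      qed
      then have "heat_kernel t (x - y) * (1 + norm y) powr (- b)
          \<le> heat_kernel t (x - y) * (w * (1 + norm (x - y)) powr b)"
        by (intro mult_left_mono) auto
      also have "\<dots> = w * (heat_kernel t (x - y) * (1 + norm (x - y)) powr b)"
        by simp
      also have "\<dots> \<le> w * (C1 * heat_kernel (2 * t) (x - y))"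
        unfolding C1_def using heat_kernel_times_powr_le[OF t b] w by (intro mult_left_mono) auto
      finally have "heat_kernel t (x - y) * (1 + norm y) powr (- b) * (1 + norm y powr (- p))
          \<le> w * (C1 * heat_kernel (2 * t) (x - y)) * (1 + norm y powr (- p))"
        by (intro mult_right_mono) auto
      then show ?thesis by (simp add: mult.commute mult.left_commute)
    qed
    have "(\<integral>\<^sup>+ y. ennreal (heat_kernel t (x - y) * ((1 + norm y) powr (- b) * (1 + norm y powr (- p)))) \<partial>lborel)
        \<le> (\<integral>\<^sup>+ y. ennreal (C1 * w) * (ennreal (heat_kernel (2 * t) (x - y))
            + ennreal (heat_kernel (2 * t) (x - y) * norm y powr (- p))) \<partial>lborel)"
      using C1 w pt
      by (intro nn_integral_mono)
         (simp add: ennreal_mult [symmetric] ennreal_plus [symmetric] distrib_left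
           ennreal_leI del: ennreal_plus)
    also have "\<dots> = ennreal (C1 * w) * (1 + (\<integral>\<^sup>+ y. ennreal (heat_kernel (2 * t) (x - y) * norm y powr (- p)) \<partial>lborel))"
      using t by (simp add: nn_integral_cmult nn_integral_add nn_integral_heat_kernel_diff)
    also have "\<dots> \<le> ennreal (C1 * w) * (1 + ennreal (C2 * (2 * t) powr (- e) * norm x powr (- a)))"
      using t x by (intro mult_left_mono add_left_mono C2) auto
    also have "\<dots> = ennreal (C1 * w * (1 + C2 * (2 * t) powr (- e) * norm x powr (- a)))"
      using C1 w C2
      by (simp add: ennreal_mult [symmetric] ennreal_plus [symmetric] flip: ennreal_1 del: ennreal_plus)
    also have "\<dots> \<le> ennreal (C1 * w * ((T powr e + C2) * t powr (- e) * (1 + norm x powr (- a))))"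
    proof (intro ennreal_leI mult_left_mono)
      define A B Z D where "A = T powr e" "B = t powr (- e)" "Z = norm x powr (- a)"
        and "D = C2 * (2 * t) powr (- e) * norm x powr (- a)"
      note defs = this
      have "1 \<le> A * B"
        using t e by (simp add: defs powr_minus_divide powr_mono2)
      moreover have "0 \<le> A * B * Z" "0 \<le> C2 * B"
        using C2 by (auto simp: defs)
      moreover have "D \<le> C2 * B * Z"
        unfolding defs using t e C2 by (intro mult_right_mono mult_left_mono powr_mono2') auto
      moreover have "(A + C2) * B * (1 + Z) = A * B + A * B * Z + C2 * B + C2 * B * Z"
        by (simp add: algebra_simps)
      ultimately have "1 + D \<le> (A + C2) * B * (1 + Z)"
        by linarith
      then show "1 + C2 * (2 * t) powr (- e) * norm x powr (- a)
          \<le> (T powr e + C2) * t powr (- e) * (1 + norm x powr (- a))"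
        by (simp only: defs)
    qed (use C1 w in auto)
    finally show "(\<integral>\<^sup>+ y. ennreal (heat_kernel t (x - y) * ((1 + norm y) powr (- b) * (1 + norm y powr (- p)))) \<partial>lborel)
        \<le> ennreal (C1 * (T powr e + C2) * t powr (- ((p - a) / 2)) * ((1 + norm x) powr (- b) * (1 + norm x powr (- a))))"
      by (simp only: w_def e_def mult_ac)
  qed
qed

section \<open>The Duhamel integral\<close>

lemma indicator_atLeastAtMost_measurable [measurable (raw)]:
  fixes f g h :: "'b \<Rightarrow> real"
  assumes [measurable]: "f \<in> borel_measurable M" "g \<in> borel_measurable M" "h \<in> borel_measurable M"
  shows "(\<lambda>z. indicator {f z..g z} (h z) :: ennreal) \<in> borel_measurable M"
  unfolding indicator_def by simp

text \<open>
  The integral term of the equation for a nonnegative source \<open>q\<close> acting from time \<open>a\<close> on. Values in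
  \<open>[0, \<infinity>]\<close> make it total and leave monotone limits and exchange of integrals free of
  integrability conditions.
\<close>

definition duhamel :: "real \<Rightarrow> (real \<Rightarrow> 'a::euclidean_space \<Rightarrow> ennreal) \<Rightarrow> real \<Rightarrow> 'a \<Rightarrow> ennreal" where
  "duhamel a q t x =
     (\<integral>\<^sup>+ s. \<integral>\<^sup>+ y. indicator {a..t} s * (ennreal (heat_kernel (t - s) (x - y)) * q s y) \<partial>lborel \<partial>lborel)"

lemma duhamel_measurable [measurable (raw)]:
  fixes q :: "real \<Rightarrow> 'a::euclidean_space \<Rightarrow> ennreal"
  assumes [measurable]: "case_prod q \<in> borel_measurable (borel \<Otimes>\<^sub>M borel)"
    "f \<in> borel_measurable M" "g \<in> borel_measurable M"
  shows "(\<lambda>z. duhamel a q (f z) (g z)) \<in> borel_measurable M"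
  unfolding duhamel_def by measurable

lemma duhamel_mono_AE:
  assumes "AE s in lborel. a \<le> s \<and> s < t \<longrightarrow> (AE y in lborel. q s y \<le> q' s y)"
  shows "duhamel a q t x \<le> duhamel a q' t x"
  unfolding duhamel_def
proof (rule nn_integral_mono_AE, rule eventually_mono[OF assms])
  fix s assume s: "a \<le> s \<and> s < t \<longrightarrow> (AE y in lborel. q s y \<le> q' s y)"
  show "(\<integral>\<^sup>+ y. indicator {a..t} s * (ennreal (heat_kernel (t - s) (x - y)) * q s y) \<partial>lborel)
     \<le> (\<integral>\<^sup>+ y. indicator {a..t} s * (ennreal (heat_kernel (t - s) (x - y)) * q' s y) \<partial>lborel)"
  proof (cases "a \<le> s \<and> s < t")
    case True
    then have "AE y in lborel. q s y \<le> q' s y" using s by blast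
    then show ?thesis
      by (intro nn_integral_mono_AE) (auto elim!: eventually_mono intro!: mult_left_mono)
  next
    case False
    then have "s < a \<or> s = t \<or> t < s" by auto
    then show ?thesis by auto
  qed
qed

lemma duhamel_mono:
  assumes "\<And>s y. \<lbrakk>a \<le> s; s < t; y \<noteq> 0\<rbrakk> \<Longrightarrow> q s y \<le> q' s (y::'a::euclidean_space)"
  shows "duhamel a q t x \<le> duhamel a q' t x"
proof (rule duhamel_mono_AE, rule AE_I2, rule impI)
  fix s assume "a \<le> s \<and> s < t"
  then show "AE y in lborel. q s y \<le> q' s y"
    using AE_lborel_singleton[of "0::'a"] by (auto elim!: eventually_mono intro: assms)
qed

lemma duhamel_add:
  assumes [measurable]: "case_prod q \<in> borel_measurable (borel \<Otimes>\<^sub>M borel)"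
    "case_prod q' \<in> borel_measurable (borel \<Otimes>\<^sub>M borel)"
  shows "duhamel a (\<lambda>s y. q s y + q' s y) t x = duhamel a q t x + duhamel a q' t x"
  unfolding duhamel_def by (simp add: distrib_left nn_integral_add)

lemma duhamel_SUP:
  assumes [measurable]: "\<And>k. case_prod (q k) \<in> borel_measurable (borel \<Otimes>\<^sub>M borel)"
    and inc: "\<And>j k s y. j \<le> k \<Longrightarrow> q j s y \<le> q k s y"
  shows "duhamel a (\<lambda>s y. SUP k::nat. q k s y) t x = (SUP k. duhamel a (q k) t x)"
proof -
  have 1: "(\<integral>\<^sup>+ y. indicator {a..t} s * (ennreal (heat_kernel (t - s) (x - y)) * (SUP k. q k s y)) \<partial>lborel)
      = (SUP k. \<integral>\<^sup>+ y. indicator {a..t} s * (ennreal (heat_kernel (t - s) (x - y)) * q k s y) \<partial>lborel)" for s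
    by (subst nn_integral_monotone_convergence_SUP [symmetric])
       (auto simp: SUP_mult_left_ennreal incseq_def le_fun_def intro!: mult_left_mono inc)
  show ?thesis
    unfolding duhamel_def 1
    by (subst nn_integral_monotone_convergence_SUP)
       (auto simp: incseq_def le_fun_def intro!: nn_integral_mono mult_left_mono inc)
qed

text \<open>
  By the semigroup law, what the source has produced before time \<open>b\<close> evolves afterwards like an
  initial datum given at time \<open>b\<close>.
\<close>

lemma duhamel_restart_le:
  fixes q :: "real \<Rightarrow> 'a::euclidean_space \<Rightarrow> ennreal"
  assumes [measurable]: "case_prod q \<in> borel_measurable (borel \<Otimes>\<^sub>M borel)"
    and ab: "a \<le> b" "b < t"
  shows "duhamel a q t x
    \<le> (\<integral>\<^sup>+ z. ennreal (heat_kernel (t - b) (x - z)) * duhamel a q b z \<partial>lborel) + duhamel b q t x"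
proof -
  let ?k = "\<lambda>t x. ennreal (heat_kernel t x)"
  have "duhamel a q t x \<le> (\<integral>\<^sup>+ s. (\<integral>\<^sup>+ y. indicator {a..b} s * (?k (t - s) (x - y) * q s y) \<partial>lborel)
      + (\<integral>\<^sup>+ y. indicator {b..t} s * (?k (t - s) (x - y) * q s y) \<partial>lborel) \<partial>lborel)"
    unfolding duhamel_def
  proof (rule nn_integral_mono)
    fix s
    show "(\<integral>\<^sup>+ y. indicator {a..t} s * (?k (t - s) (x - y) * q s y) \<partial>lborel)
      \<le> (\<integral>\<^sup>+ y. indicator {a..b} s * (?k (t - s) (x - y) * q s y) \<partial>lborel)
      + (\<integral>\<^sup>+ y. indicator {b..t} s * (?k (t - s) (x - y) * q s y) \<partial>lborel)"
      by (subst nn_integral_add [symmetric]) (auto intro!: nn_integral_mono simp: indicator_def)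
  qed
  also have "\<dots> = (\<integral>\<^sup>+ s. \<integral>\<^sup>+ y. indicator {a..b} s * (?k (t - s) (x - y) * q s y) \<partial>lborel \<partial>lborel) + duhamel b q t x"
    unfolding duhamel_def by (subst nn_integral_add) auto
  also have "(\<integral>\<^sup>+ s. \<integral>\<^sup>+ y. indicator {a..b} s * (?k (t - s) (x - y) * q s y) \<partial>lborel \<partial>lborel)
      = (\<integral>\<^sup>+ s. \<integral>\<^sup>+ y. \<integral>\<^sup>+ z. ?k (t - b) (x - z) * (indicator {a..b} s * (?k (b - s) (z - y) * q s y)) \<partial>lborel \<partial>lborel \<partial>lborel)"
  proof (rule nn_integral_cong_AE, rule eventually_mono[OF AE_lborel_singleton[of b]])
    fix s :: real assume sb: "s \<noteq> b"
    show "(\<integral>\<^sup>+ y. indicator {a..b} s * (?k (t - s) (x - y) * q s y) \<partial>lborel)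
      = (\<integral>\<^sup>+ y. \<integral>\<^sup>+ z. ?k (t - b) (x - z) * (indicator {a..b} s * (?k (b - s) (z - y) * q s y)) \<partial>lborel \<partial>lborel)"
    proof (rule nn_integral_cong)
      fix y
      show "indicator {a..b} s * (?k (t - s) (x - y) * q s y)
        = (\<integral>\<^sup>+ z. ?k (t - b) (x - z) * (indicator {a..b} s * (?k (b - s) (z - y) * q s y)) \<partial>lborel)"
      proof (cases "s \<in> {a..b}")
        case True
        have "(\<integral>\<^sup>+ z. ?k (t - b) (x - z) * (?k (b - s) (z - y) * q s y) \<partial>lborel)
            = (\<integral>\<^sup>+ z. (?k (t - b) (x - z) * ?k (b - s) (z - y)) * q s y \<partial>lborel)"
          by (simp add: mult.assoc)
        also have "\<dots> = ?k (t - s) (x - y) * q s y"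
          using True sb ab
          by (subst nn_integral_multc) (auto simp: heat_kernel_chapman_kolmogorov)
        finally show ?thesis using True by simp
      qed simp
    qed
  qed
  also have "\<dots> = (\<integral>\<^sup>+ s. \<integral>\<^sup>+ z. \<integral>\<^sup>+ y. ?k (t - b) (x - z) * (indicator {a..b} s * (?k (b - s) (z - y) * q s y)) \<partial>lborel \<partial>lborel \<partial>lborel)"
    by (intro nn_integral_cong lborel_pair.Fubini') measurable
  also have "\<dots> = (\<integral>\<^sup>+ z. \<integral>\<^sup>+ s. \<integral>\<^sup>+ y. ?k (t - b) (x - z) * (indicator {a..b} s * (?k (b - s) (z - y) * q s y)) \<partial>lborel \<partial>lborel \<partial>lborel)"
    by (intro lborel_pair.Fubini') measurable
  also have "\<dots> = (\<integral>\<^sup>+ z. ?k (t - b) (x - z) * duhamel a q b z \<partial>lborel)"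
    unfolding duhamel_def
    by (intro nn_integral_cong) (simp add: nn_integral_cmult)
  finally show ?thesis .
qed

lemma nn_integral_powr_time:
  assumes "\<beta> > 0" "a \<le> t"
  shows "(\<integral>\<^sup>+ s. indicator {a..t} s * ennreal ((t - s) powr (\<beta> - 1)) \<partial>lborel)
     = ennreal ((t - a) powr \<beta> / \<beta>)"
proof -
  let ?g = "\<lambda>r. indicator {0..t - a} r * ennreal (r powr (\<beta> - 1))"
  have "(\<integral>\<^sup>+ s. indicator {a..t} s * ennreal ((t - s) powr (\<beta> - 1)) \<partial>lborel)
      = (\<integral>\<^sup>+ s. ?g (t - s) \<partial>lborel)"
    by (intro nn_integral_cong) (auto simp: indicator_def)
  also have "\<dots> = (\<integral>\<^sup>+ r. ?g r \<partial>lborel)"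
    by (rule nn_integral_lborel_diff) measurable
  also have "\<dots> = (\<integral>\<^sup>+ r. ennreal (indicator {0..t - a} r * r powr (\<beta> - 1)) \<partial>lborel)"
    by (intro nn_integral_cong) (auto simp: indicator_def)
  also have "\<dots> = ennreal ((t - a) powr (\<beta> - 1 + 1) / (\<beta> - 1 + 1))"
    using assms by (intro nn_integral_has_integral_lebesgue has_integral_powr_from_0) auto
  finally show ?thesis by simp
qed

section \<open>Existence and restart\<close>

text \<open>
  The properties of the nonlinearity, the weight and the heat integrals that the evolution
  problem uses. On functions of size \<open>K\<close> in the weighted norm, the nonlinearity acts like
  a potential \<open>V\<close> up to a factor depending on \<open>K\<close>, and \<open>V\<close> costs the heat semigroup only an
  integrable power of time.
\<close>

locale weighted_heat_problem =
  fixes N :: "real \<Rightarrow> 'a::euclidean_space \<Rightarrow> real" and W V :: "'a \<Rightarrow> real" and \<beta> :: real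
    and \<phi> :: "'a \<Rightarrow> real" and A0 :: real
  assumes N_measurable [measurable]: "case_prod N \<in> borel_measurable (borel \<Otimes>\<^sub>M borel)"
    and N_mono: "\<And>u v y. u \<le> v \<Longrightarrow> N u y \<le> N v y"
    and N_nonpos: "\<And>u y. u \<le> 0 \<Longrightarrow> N u y = 0"
    and N_cont: "\<And>y. continuous_on UNIV (\<lambda>u. N u y)"
    and N_lipschitz: "\<And>K. \<exists>L\<ge>0. \<forall>y u v. y \<noteq> 0 \<and> \<bar>u\<bar> * W y \<le> K \<and> \<bar>v\<bar> * W y \<le> K \<longrightarrow>
        \<bar>N u y - N v y\<bar> \<le> L * V y * \<bar>u - v\<bar>"
    and W_measurable [measurable]: "W \<in> borel_measurable borel"
    and W_pos: "\<And>y. y \<noteq> 0 \<Longrightarrow> W y > 0"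
    and V_measurable [measurable]: "V \<in> borel_measurable borel"
    and V_nonneg: "\<And>y. V y \<ge> 0"
    and heat_W: "\<And>T. T > 0 \<Longrightarrow> \<exists>C\<ge>0. \<forall>t x. 0 < t \<and> t \<le> T \<and> x \<noteq> 0 \<longrightarrow>
        (\<integral>\<^sup>+ y. ennreal (heat_kernel t (x - y) * (1 / W y)) \<partial>lborel) \<le> ennreal (C / W x)"
    and heat_V: "\<And>T. T > 0 \<Longrightarrow> \<exists>C\<ge>0. \<forall>t x. 0 < t \<and> t \<le> T \<and> x \<noteq> 0 \<longrightarrow>
        (\<integral>\<^sup>+ y. ennreal (heat_kernel t (x - y) * (V y / W y)) \<partial>lborel)
          \<le> ennreal (C * t powr (\<beta> - 1) / W x)"
    and beta_pos: "\<beta> > 0"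
    and phi_measurable [measurable]: "\<phi> \<in> borel_measurable borel"
    and A0_nonneg: "A0 \<ge> 0"
    and phi_bound: "\<And>y. \<bar>\<phi> y\<bar> * W y \<le> A0"
begin

lemma N_nonneg [simp]: "N u y \<ge> 0"
  using N_mono[of "min u 0" u y] N_nonpos[of "min u 0" y] by simp

lemma heat_W_const:
  assumes "T > 0"
  obtains C where "C \<ge> 0" "\<And>t x. \<lbrakk>0 < t; t \<le> T; x \<noteq> 0\<rbrakk> \<Longrightarrow>
    (\<integral>\<^sup>+ y. ennreal (heat_kernel t (x - y) * (1 / W y)) \<partial>lborel) \<le> ennreal (C / W x)"
  using heat_W[OF assms] by blast

lemma heat_V_const:
  assumes "T > 0"
  obtains C where "C \<ge> 0" "\<And>t x. \<lbrakk>0 < t; t \<le> T; x \<noteq> 0\<rbrakk> \<Longrightarrow>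
    (\<integral>\<^sup>+ y. ennreal (heat_kernel t (x - y) * (V y / W y)) \<partial>lborel)
      \<le> ennreal (C * t powr (\<beta> - 1) / W x)"
  using heat_V[OF assms] by blast

lemma N_lipschitz_const:
  obtains L where "L \<ge> 0" "\<And>y u v. \<lbrakk>y \<noteq> 0; \<bar>u\<bar> * W y \<le> K; \<bar>v\<bar> * W y \<le> K\<rbrakk> \<Longrightarrow>
    \<bar>N u y - N v y\<bar> \<le> L * V y * \<bar>u - v\<bar>"
  using N_lipschitz[of K] by blast

text \<open>
  The comparison with the zero solution: \<open>N\<close> vanishes at \<open>0\<close>.
\<close>

lemma N_le_potential:
  assumes "\<And>y u v. \<lbrakk>y \<noteq> 0; \<bar>u\<bar> * W y \<le> K; \<bar>v\<bar> * W y \<le> K\<rbrakk> \<Longrightarrow> \<bar>N u y - N v y\<bar> \<le> L * V y * \<bar>u - v\<bar>"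
    and "L \<ge> 0" "y \<noteq> 0" "\<bar>u\<bar> * W y \<le> K"
  shows "N u y \<le> L * K * (V y / W y)"
proof -
  have K: "K \<ge> 0"
    using W_pos[OF assms(3)] assms(4) by (meson abs_ge_zero dual_order.trans less_imp_le mult_nonneg_nonneg)
  have "N u y \<le> L * V y * \<bar>u\<bar>"
    using assms(1)[OF assms(3,4), of 0] K N_nonpos[of 0 y] by simp
  also have "\<dots> \<le> L * V y * (K / W y)"
    using assms(2-4) V_nonneg[of y] W_pos[of y] by (intro mult_left_mono) (auto simp: pos_le_divide_eq)
  finally show ?thesis by (simp add: mult_ac)
qed

lemma weighted_integral_le:
  assumes C: "C \<ge> 0" "\<And>t x. \<lbrakk>0 < t; t \<le> T; x \<noteq> 0\<rbrakk> \<Longrightarrow>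
        (\<integral>\<^sup>+ y. ennreal (heat_kernel t (x - y) * (1 / W y)) \<partial>lborel) \<le> ennreal (C / W x)"
    and q: "AE y in lborel. y \<noteq> 0 \<longrightarrow> q y \<le> ennreal (A / W y)" and A: "A \<ge> 0"
    and t: "0 < t" "t \<le> T" and x: "x \<noteq> 0"
  shows "(\<integral>\<^sup>+ y. ennreal (heat_kernel t (x - y)) * q y \<partial>lborel) \<le> ennreal (C * A / W x)"
proof -
  have "(\<integral>\<^sup>+ y. ennreal (heat_kernel t (x - y)) * q y \<partial>lborel)
      \<le> (\<integral>\<^sup>+ y. ennreal A * ennreal (heat_kernel t (x - y) * (1 / W y)) \<partial>lborel)"
  proof (rule nn_integral_mono_AE)
    show "AE y in lborel. ennreal (heat_kernel t (x - y)) * q y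
        \<le> ennreal A * ennreal (heat_kernel t (x - y) * (1 / W y))"
      using q AE_lborel_singleton[of "0::'a"]
    proof eventually_elim
      fix y :: 'a assume "y \<noteq> 0 \<longrightarrow> q y \<le> ennreal (A / W y)" "y \<noteq> 0"
      then have "ennreal (heat_kernel t (x - y)) * q y \<le> ennreal (heat_kernel t (x - y)) * ennreal (A / W y)"
        by (intro mult_left_mono) auto
      also have "\<dots> = ennreal A * ennreal (heat_kernel t (x - y) * (1 / W y))"
        using A W_pos[OF \<open>y \<noteq> 0\<close>] by (simp add: ennreal_mult [symmetric])
      finally show "ennreal (heat_kernel t (x - y)) * q y
          \<le> ennreal A * ennreal (heat_kernel t (x - y) * (1 / W y))" .
    qed
  qed
  also have "\<dots> = ennreal A * (\<integral>\<^sup>+ y. ennreal (heat_kernel t (x - y) * (1 / W y)) \<partial>lborel)"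
    by (rule nn_integral_cmult) measurable
  also have "\<dots> \<le> ennreal A * ennreal (C / W x)"
    using t x by (intro mult_left_mono C) auto
  also have "\<dots> = ennreal (C * A / W x)"
    using A C W_pos[OF x] by (simp add: ennreal_mult [symmetric] mult.commute)
  finally show ?thesis .
qed

text \<open>
  The amplification factor \<open>k\<close> is a function of time, to allow for exponentially growing bounds
  in the uniqueness argument.
\<close>

lemma duhamel_potential_le:
  assumes C: "C \<ge> 0" "\<And>t x. \<lbrakk>0 < t; t \<le> T; x \<noteq> 0\<rbrakk> \<Longrightarrow>
        (\<integral>\<^sup>+ y. ennreal (heat_kernel t (x - y) * (V y / W y)) \<partial>lborel) \<le> ennreal (C * t powr (\<beta> - 1) / W x)"
    and q: "AE s in lborel. a \<le> s \<and> s < t \<longrightarrow> (AE y in lborel. y \<noteq> 0 \<longrightarrow> q s y \<le> ennreal (k s * (V y / W y)))"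
    and k: "\<And>s. k s \<ge> 0" and [measurable]: "k \<in> borel_measurable borel"
    and t: "a \<le> t" "t - a \<le> T" and x: "x \<noteq> 0"
  shows "duhamel a q t x
    \<le> ennreal (C / W x) * (\<integral>\<^sup>+ s. indicator {a..t} s * ennreal (k s * (t - s) powr (\<beta> - 1)) \<partial>lborel)"
proof -
  have "duhamel a q t x \<le> duhamel a (\<lambda>s y. ennreal (k s * (V y / W y))) t x"
  proof (rule duhamel_mono_AE, rule eventually_mono[OF q], rule impI)
    fix s
    assume "a \<le> s \<and> s < t \<longrightarrow> (AE y in lborel. y \<noteq> 0 \<longrightarrow> q s y \<le> ennreal (k s * (V y / W y)))" "a \<le> s \<and> s < t"
    then have "AE y in lborel. y \<noteq> 0 \<longrightarrow> q s y \<le> ennreal (k s * (V y / W y))" by blast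
    then show "AE y in lborel. q s y \<le> ennreal (k s * (V y / W y))"
      using AE_lborel_singleton[of "0::'a"] by eventually_elim auto
  qed
  also have "\<dots> \<le> (\<integral>\<^sup>+ s. ennreal (C / W x) * (indicator {a..t} s * ennreal (k s * (t - s) powr (\<beta> - 1))) \<partial>lborel)"
    unfolding duhamel_def
  proof (rule nn_integral_mono_AE, rule eventually_mono[OF AE_lborel_singleton[of t]])
    fix s assume "s \<noteq> t"
    show "(\<integral>\<^sup>+ y. indicator {a..t} s * (ennreal (heat_kernel (t - s) (x - y)) * ennreal (k s * (V y / W y))) \<partial>lborel)
        \<le> ennreal (C / W x) * (indicator {a..t} s * ennreal (k s * (t - s) powr (\<beta> - 1)))"
    proof (cases "s \<in> {a..t}")
      case True
      have "(\<integral>\<^sup>+ y. ennreal (heat_kernel (t - s) (x - y)) * ennreal (k s * (V y / W y)) \<partial>lborel)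
          = (\<integral>\<^sup>+ y. ennreal (k s) * ennreal (heat_kernel (t - s) (x - y) * (V y / W y)) \<partial>lborel)"
        using k by (intro nn_integral_cong) (simp add: ennreal_mult' [symmetric] mult_ac)
      also have "\<dots> = ennreal (k s) * (\<integral>\<^sup>+ y. ennreal (heat_kernel (t - s) (x - y) * (V y / W y)) \<partial>lborel)"
        by (rule nn_integral_cmult) measurable
      also have "\<dots> \<le> ennreal (k s) * ennreal (C * (t - s) powr (\<beta> - 1) / W x)"
        using True \<open>s \<noteq> t\<close> t x by (intro mult_left_mono C) auto
      also have "\<dots> = ennreal (C / W x) * ennreal (k s * (t - s) powr (\<beta> - 1))"
        using C k W_pos[OF x] by (simp add: ennreal_mult' [symmetric] mult.commute mult.left_commute)
      finally show ?thesis using True by simp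
    qed simp
  qed
  also have "\<dots> = ennreal (C / W x) * (\<integral>\<^sup>+ s. indicator {a..t} s * ennreal (k s * (t - s) powr (\<beta> - 1)) \<partial>lborel)"
    by (rule nn_integral_cmult) measurable
  finally show ?thesis .
qed

lemma duhamel_potential_const_le:
  assumes C: "C \<ge> 0" "\<And>t x. \<lbrakk>0 < t; t \<le> T; x \<noteq> 0\<rbrakk> \<Longrightarrow>
        (\<integral>\<^sup>+ y. ennreal (heat_kernel t (x - y) * (V y / W y)) \<partial>lborel) \<le> ennreal (C * t powr (\<beta> - 1) / W x)"
    and q: "\<And>s y. \<lbrakk>a < s; s < t; y \<noteq> 0\<rbrakk> \<Longrightarrow> q s y \<le> ennreal (k * (V y / W y))"
    and k: "k \<ge> 0" and t: "a \<le> t" "t - a \<le> T" and x: "x \<noteq> 0"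
  shows "duhamel a q t x \<le> ennreal (C * k * ((t - a) powr \<beta> / \<beta>) / W x)"
proof -
  have "duhamel a q t x
    \<le> ennreal (C / W x) * (\<integral>\<^sup>+ s. indicator {a..t} s * ennreal (k * (t - s) powr (\<beta> - 1)) \<partial>lborel)"
  proof (rule duhamel_potential_le[where T = T, OF C])
    show "AE s in lborel. a \<le> s \<and> s < t \<longrightarrow>
        (AE y in lborel. y \<noteq> 0 \<longrightarrow> q s y \<le> ennreal (k * (V y / W y)))"
      by (rule eventually_mono[OF AE_lborel_singleton[of a]], intro impI AE_I2 q) auto
  qed (use k t x in auto)
  also have "(\<integral>\<^sup>+ s. indicator {a..t} s * ennreal (k * (t - s) powr (\<beta> - 1)) \<partial>lborel)
      = (\<integral>\<^sup>+ s. ennreal k * (indicator {a..t} s * ennreal ((t - s) powr (\<beta> - 1))) \<partial>lborel)"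
    using k by (intro nn_integral_cong) (simp add: ennreal_mult' mult.left_commute)
  also have "\<dots> = ennreal k * ennreal ((t - a) powr \<beta> / \<beta>)"
    using beta_pos t by (subst nn_integral_cmult) (auto simp: nn_integral_powr_time)
  also have "ennreal (C / W x) * \<dots> = ennreal (C * k * ((t - a) powr \<beta> / \<beta>) / W x)"
    using C k beta_pos W_pos[OF x] by (simp add: ennreal_mult' [symmetric] mult_ac)
  finally show ?thesis .
qed

lemma duhamel_N_finite:
  assumes t: "t > 0" and w: "\<And>s y. \<lbrakk>0 \<le> s; s \<le> t; y \<noteq> 0\<rbrakk> \<Longrightarrow> \<bar>w s y\<bar> * W y \<le> Q" and x: "x \<noteq> 0"
  shows "duhamel 0 (\<lambda>s y. ennreal (N (w s y) y)) t x < \<top>"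
proof -
  obtain L where L: "L \<ge> 0" "\<And>y u v. \<lbrakk>y \<noteq> 0; \<bar>u\<bar> * W y \<le> Q; \<bar>v\<bar> * W y \<le> Q\<rbrakk> \<Longrightarrow>
        \<bar>N u y - N v y\<bar> \<le> L * V y * \<bar>u - v\<bar>"
    using N_lipschitz_const[of Q] by blast
  obtain D where D: "D \<ge> 0" "\<And>s x. \<lbrakk>0 < s; s \<le> t; x \<noteq> 0\<rbrakk> \<Longrightarrow>
        (\<integral>\<^sup>+ y. ennreal (heat_kernel s (x - y) * (V y / W y)) \<partial>lborel) \<le> ennreal (D * s powr (\<beta> - 1) / W x)"
    using heat_V_const[OF t] by blast
  have "0 \<le> \<bar>w 0 x\<bar> * W x" using W_pos[OF x] by simp
  then have Q: "Q \<ge> 0" using w[of 0 x] t x by linarith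
  have "duhamel 0 (\<lambda>s y. ennreal (N (w s y) y)) t x \<le> ennreal (D * (L * Q) * ((t - 0) powr \<beta> / \<beta>) / W x)"
    using L w by (intro duhamel_potential_const_le[where T = t, OF D] ennreal_leI N_le_potential) (use Q t x in auto)
  also have "\<dots> < \<top>" by simp
  finally show ?thesis .
qed

text \<open>
  The free evolution of the datum, the only term that may change sign. At time \<open>0\<close> its value is \<open>0\<close>
  instead of \<open>\<phi>\<close>, which makes no difference inside time integrals.
\<close>

definition heat_phi :: "real \<Rightarrow> 'a \<Rightarrow> real" where
  "heat_phi t x = (LINT y|lborel. heat_kernel t (x - y) * \<phi> y)"

lemma heat_phi_measurable [measurable]: "case_prod heat_phi \<in> borel_measurable (borel \<Otimes>\<^sub>M borel)"
  unfolding heat_phi_def by measurable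

lemma heat_phi_abs_bound:
  obtains C where "C \<ge> 0" "\<And>t x. \<lbrakk>0 < t; t \<le> T; x \<noteq> 0\<rbrakk> \<Longrightarrow>
    (\<integral>\<^sup>+ y. ennreal (norm (heat_kernel t (x - y) * \<phi> y)) \<partial>lborel) \<le> ennreal (C / W x)"
proof -
  have T: "max T 1 > 0" by simp
  obtain C where C: "C \<ge> 0" "\<And>t x. \<lbrakk>0 < t; t \<le> max T 1; x \<noteq> 0\<rbrakk> \<Longrightarrow>
        (\<integral>\<^sup>+ y. ennreal (heat_kernel t (x - y) * (1 / W y)) \<partial>lborel) \<le> ennreal (C / W x)"
    using heat_W_const[OF T] by blast
  show thesis
  proof
    show "C * A0 \<ge> 0" using C A0_nonneg by simp
    fix t and x :: 'a assume t: "0 < t" "t \<le> T" and x: "x \<noteq> 0"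
    have "(\<integral>\<^sup>+ y. ennreal (heat_kernel t (x - y)) * ennreal \<bar>\<phi> y\<bar> \<partial>lborel) \<le> ennreal (C * A0 / W x)"
    proof (rule weighted_integral_le[where T = "max T 1", OF C])
      show "AE y in lborel. y \<noteq> 0 \<longrightarrow> ennreal \<bar>\<phi> y\<bar> \<le> ennreal (A0 / W y)"
        using phi_bound W_pos by (auto intro!: AE_I2 ennreal_leI simp: pos_le_divide_eq)
    qed (use A0_nonneg t x in auto)
    then show "(\<integral>\<^sup>+ y. ennreal (norm (heat_kernel t (x - y) * \<phi> y)) \<partial>lborel) \<le> ennreal (C * A0 / W x)"
      by (simp add: abs_mult ennreal_mult)
  qed
qed

lemma heat_phi_integrable:
  assumes "t \<ge> 0" "x \<noteq> 0"
  shows "integrable lborel (\<lambda>y. heat_kernel t (x - y) * \<phi> y)"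
proof (cases "t = 0")
  case False
  obtain C where "C \<ge> 0" "\<And>s x. \<lbrakk>0 < s; s \<le> t; x \<noteq> 0\<rbrakk> \<Longrightarrow>
    (\<integral>\<^sup>+ y. ennreal (norm (heat_kernel s (x - y) * \<phi> y)) \<partial>lborel) \<le> ennreal (C / W x)"
    using heat_phi_abs_bound[of t] by blast
  then have "(\<integral>\<^sup>+ y. ennreal (norm (heat_kernel t (x - y) * \<phi> y)) \<partial>lborel) \<le> ennreal (C / W x)"
    using assms False by simp
  also have "\<dots> < \<infinity>" by simp
  finally show ?thesis
    by (intro integrableI_bounded) auto
qed simp

lemma heat_phi_bound:
  obtains H where "H \<ge> 0" "\<And>t x. \<lbrakk>t \<in> {0..T}; x \<noteq> 0\<rbrakk> \<Longrightarrow> \<bar>heat_phi t x\<bar> * W x \<le> H"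
proof -
  obtain C where C: "C \<ge> 0" "\<And>t x. \<lbrakk>0 < t; t \<le> T; x \<noteq> 0\<rbrakk> \<Longrightarrow>
    (\<integral>\<^sup>+ y. ennreal (norm (heat_kernel t (x - y) * \<phi> y)) \<partial>lborel) \<le> ennreal (C / W x)"
    using heat_phi_abs_bound[of T] by blast
  show thesis
  proof
    fix t x assume t: "t \<in> {0..T}" and x: "x \<noteq> (0::'a)"
    show "\<bar>heat_phi t x\<bar> * W x \<le> C"
    proof (cases "t = 0")
      case True
      then show ?thesis using C by (simp add: heat_phi_def)
    next
      case False
      have int: "integrable lborel (\<lambda>y. heat_kernel t (x - y) * \<phi> y)"
        using t x by (intro heat_phi_integrable) auto
      have "ennreal \<bar>heat_phi t x\<bar> \<le> (\<integral>\<^sup>+ y. ennreal (norm (heat_kernel t (x - y) * \<phi> y)) \<partial>lborel)"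
        unfolding heat_phi_def using integral_norm_bound_ennreal[OF int] by simp
      also have "\<dots> \<le> ennreal (C / W x)"
        using C t x False by simp
      finally have "\<bar>heat_phi t x\<bar> \<le> C / W x"
        using C W_pos[OF x] by simp
      then show ?thesis
        using W_pos[OF x] by (simp add: pos_le_divide_eq)
    qed
  qed (fact C)
qed

text \<open>
  The Picard iterates of the source term, with values in the extended half-line, so that all of
  them are defined for all times. The truncation at height \<open>k\<close>
  keeps the argument of the nonlinearity finite and disappears in the limit.
\<close>

primrec picard :: "nat \<Rightarrow> real \<Rightarrow> 'a \<Rightarrow> ennreal" where
  "picard 0 t x = 0"
| "picard (Suc k) t x = duhamel 0 (\<lambda>s y. ennreal (N (heat_phi s y + enn2real (min (picard k s y) (of_nat k))) y)) t x"

text \<open>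
  The source belonging to an iterate, named so that measurability and monotonicity of iterates
  and sources can be proved together.
\<close>

definition picard_source :: "nat \<Rightarrow> real \<Rightarrow> 'a \<Rightarrow> ennreal" where
  "picard_source k s y = ennreal (N (heat_phi s y + enn2real (min (picard k s y) (of_nat k))) y)"

lemma picard_Suc: "picard (Suc k) t x = duhamel 0 (picard_source k) t x"
  by (simp add: picard_source_def [abs_def])

declare picard.simps(2) [simp del]

lemma picard_and_source_measurable:
  "case_prod (picard k) \<in> borel_measurable (borel \<Otimes>\<^sub>M borel) \<and> case_prod (picard_source k) \<in> borel_measurable (borel \<Otimes>\<^sub>M borel)"
proof (induction k)
  case 0
  show ?case unfolding picard_source_def picard.simps by measurable
next
  case (Suc k)
  then have [measurable]: "case_prod (picard_source k) \<in> borel_measurable (borel \<Otimes>\<^sub>M borel)" by simp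
  have [measurable]: "case_prod (picard (Suc k)) \<in> borel_measurable (borel \<Otimes>\<^sub>M borel)"
    unfolding picard_Suc by measurable
  have "case_prod (picard_source (Suc k)) \<in> borel_measurable (borel \<Otimes>\<^sub>M borel)"
    unfolding picard_source_def by measurable
  then show ?case by simp
qed

lemma picard_measurable [measurable]: "case_prod (picard k) \<in> borel_measurable (borel \<Otimes>\<^sub>M borel)"
  and picard_source_measurable [measurable]: "case_prod (picard_source k) \<in> borel_measurable (borel \<Otimes>\<^sub>M borel)"
  using picard_and_source_measurable by auto

lemma enn2real_min_mono:
  assumes "a \<le> b" "j \<le> k"
  shows "enn2real (min a (of_nat j)) \<le> enn2real (min b (of_nat k))"
  using assms by (intro enn2real_mono min.mono) (auto simp: min_less_iff_disj of_nat_less_top)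

lemma picard_le_Suc: "picard k t x \<le> picard (Suc k) t x"
proof (induction k arbitrary: t x)
  case (Suc k)
  show ?case
    unfolding picard_Suc
  proof (rule duhamel_mono)
    fix s y
    show "picard_source k s y \<le> picard_source (Suc k) s y"
      unfolding picard_source_def by (intro ennreal_leI N_mono add_left_mono enn2real_min_mono Suc.IH) auto
  qed
qed simp

lemma picard_mono: "j \<le> k \<Longrightarrow> picard j t x \<le> picard k t x"
  by (rule lift_Suc_mono_le[of "\<lambda>k. picard k t x"]) (rule picard_le_Suc)

lemma picard_source_mono: "j \<le> k \<Longrightarrow> picard_source j t x \<le> picard_source k t x"
  unfolding picard_source_def by (intro ennreal_leI N_mono add_left_mono enn2real_min_mono picard_mono) auto

text \<open>
  The integral term of the solution. It may be infinite; the solution lives as long as it is not.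
\<close>

definition source_part :: "real \<Rightarrow> 'a \<Rightarrow> ennreal" where
  "source_part t x = (SUP k. picard k t x)"

lemma source_part_measurable [measurable]: "case_prod source_part \<in> borel_measurable (borel \<Otimes>\<^sub>M borel)"
  unfolding source_part_def by measurable

lemma picard_le_source_part: "picard k t x \<le> source_part t x"
  unfolding source_part_def by (rule SUP_upper) simp

lemma source_part_le: "(\<And>k. picard k t x \<le> c) \<Longrightarrow> source_part t x \<le> c"
  unfolding source_part_def by (rule SUP_least)

lemma source_part_0: "source_part 0 x = 0"
proof -
  have "duhamel 0 q 0 x = 0" for q :: "real \<Rightarrow> 'a \<Rightarrow> ennreal"
  proof -
    have "(\<lambda>s. \<integral>\<^sup>+ y. indicator {0..0} s * (ennreal (heat_kernel (0 - s) (x - y)) * q s y) \<partial>lborel) = (\<lambda>s. 0)"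
      by (auto simp: fun_eq_iff indicator_def)
    then show ?thesis unfolding duhamel_def by simp
  qed
  then have "picard k 0 x = 0" for k by (cases k) (auto simp: picard_Suc)
  then show ?thesis by (simp add: source_part_def)
qed

lemma source_part_eq_duhamel_SUP: "source_part t x = duhamel 0 (\<lambda>s y. SUP k. picard_source k s y) t x"
proof -
  have "source_part t x = (SUP k. picard (Suc k) t x)"
  proof (rule antisym)
    show "source_part t x \<le> (SUP k. picard (Suc k) t x)"
      unfolding source_part_def by (rule SUP_mono) (use picard_le_Suc in blast)
    show "(SUP k. picard (Suc k) t x) \<le> source_part t x"
      by (rule SUP_least) (rule picard_le_source_part)
  qed
  also have "\<dots> = duhamel 0 (\<lambda>s y. SUP k. picard_source k s y) t x"
    unfolding picard_Suc by (rule duhamel_SUP [symmetric]) (auto intro: picard_source_mono)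
  finally show ?thesis .
qed

text \<open>
  Where the limit is finite, the truncation is eventually inactive, and \<open>N\<close> is continuous in its
  first argument.
\<close>

lemma SUP_picard_source:
  assumes "source_part s y < \<top>"
  shows "(SUP k. picard_source k s y) = ennreal (N (heat_phi s y + enn2real (source_part s y)) y)"
proof (rule LIMSEQ_unique)
  show "(\<lambda>k. picard_source k s y) \<longlonglongrightarrow> (SUP k. picard_source k s y)"
    by (rule LIMSEQ_SUP) (auto simp: incseq_def intro: picard_source_mono)
  have picard: "(\<lambda>k. picard k s y) \<longlonglongrightarrow> source_part s y"
    unfolding source_part_def by (rule LIMSEQ_SUP) (auto simp: incseq_def intro: picard_mono)
  obtain m :: nat where m: "source_part s y \<le> of_nat m"
    using ennreal_Ex_less_of_nat[of "source_part s y"] assms by (auto intro: less_imp_le)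
  have "\<forall>\<^sub>F k in sequentially. picard k s y = min (picard k s y) (of_nat k)"
    using eventually_ge_at_top[of m]
  proof eventually_elim
    fix k assume "m \<le> k"
    then have "picard k s y \<le> of_nat k"
      using picard_le_source_part[of k s y] m by (meson of_nat_mono order_trans)
    then show "picard k s y = min (picard k s y) (of_nat k)" by (simp add: min_def)
  qed
  then have "(\<lambda>k. min (picard k s y) (of_nat k)) \<longlonglongrightarrow> source_part s y"
    using picard by (rule Lim_transform_eventually[rotated])
  then have "(\<lambda>k. enn2real (min (picard k s y) (of_nat k))) \<longlonglongrightarrow> enn2real (source_part s y)"
    using assms by (intro tendsto_enn2real) (auto simp: less_top)
  then have "(\<lambda>k. heat_phi s y + enn2real (min (picard k s y) (of_nat k))) \<longlonglongrightarrow> heat_phi s y + enn2real (source_part s y)"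
    by (intro tendsto_add tendsto_const)
  moreover have "isCont (\<lambda>u. N u y) (heat_phi s y + enn2real (source_part s y))"
    using N_cont[of y] continuous_on_eq_continuous_at[of UNIV] by blast
  ultimately have "(\<lambda>k. N (heat_phi s y + enn2real (min (picard k s y) (of_nat k))) y) \<longlonglongrightarrow> N (heat_phi s y + enn2real (source_part s y)) y"
    by (rule isCont_tendsto_compose[rotated])
  then show "(\<lambda>k. picard_source k s y) \<longlonglongrightarrow> ennreal (N (heat_phi s y + enn2real (source_part s y)) y)"
    unfolding picard_source_def by (rule tendsto_ennrealI)
qed

definition bounded_upto :: "real \<Rightarrow> bool" where
  "bounded_upto T \<longleftrightarrow> (\<exists>M\<ge>0. \<forall>t\<in>{0..T}. \<forall>x. x \<noteq> 0 \<longrightarrow> source_part t x \<le> ennreal (M / W x))"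

text \<open>
  Monotone convergence turns the recursion of the iterates into the integral equation.
\<close>

lemma source_part_eq_duhamel:
  assumes "bounded_upto T" "t \<le> T"
  shows "source_part t x = duhamel 0 (\<lambda>s y. ennreal (N (heat_phi s y + enn2real (source_part s y)) y)) t x"
proof -
  have *: "(SUP k. picard_source k s y) = ennreal (N (heat_phi s y + enn2real (source_part s y)) y)" if "0 \<le> s" "s < t" "y \<noteq> 0" for s y
  proof (rule SUP_picard_source)
    obtain M where M: "\<forall>t\<in>{0..T}. \<forall>x. x \<noteq> 0 \<longrightarrow> source_part t x \<le> ennreal (M / W x)"
      using assms unfolding bounded_upto_def by blast
    have "source_part s y \<le> ennreal (M / W y)"
      using M assms(2) that by simp
    then show "source_part s y < \<top>" using ennreal_less_top le_less_trans by blast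
  qed
  have "source_part t x = duhamel 0 (\<lambda>s y. SUP k. picard_source k s y) t x"
    by (rule source_part_eq_duhamel_SUP)
  also have "\<dots> = duhamel 0 (\<lambda>s y. ennreal (N (heat_phi s y + enn2real (source_part s y)) y)) t x"
    by (rule antisym; rule duhamel_mono) (simp_all add: *)
  finally show ?thesis .
qed

text \<open>
  The time gained does not depend on the time \<open>t0\<close> of the restart. What the source has produced
  up to \<open>t0\<close> evolves like an initial datum of norm at most \<open>A\<close>, while the signed term
  \<open>heat_phi\<close> is bounded on bounded time intervals; so an induction over the Picard iterates keeps
  their norms below \<open>M\<close> for as long as the new source contributes at most \<open>1\<close>.
\<close>

lemma bounded_restart:
  assumes T0: "T0 > 0" and A: "A \<ge> 0"
  obtains \<tau> M where "\<tau> > 0" "M \<ge> 0"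
    "\<And>t0 t x. \<lbrakk>t0 \<in> {0..T0}; AE x in lborel. x \<noteq> 0 \<longrightarrow> source_part t0 x \<le> ennreal (A / W x);
        t0 < t; t \<le> t0 + \<tau>; x \<noteq> 0\<rbrakk> \<Longrightarrow> source_part t x \<le> ennreal (M / W x)"
proof -
  obtain H where H: "H \<ge> 0" "\<And>t x. \<lbrakk>t \<in> {0..T0 + 1}; x \<noteq> 0\<rbrakk> \<Longrightarrow> \<bar>heat_phi t x\<bar> * W x \<le> H"
    using heat_phi_bound[of "T0 + 1"] by blast
  obtain C where C: "C \<ge> 0" "\<And>t x. \<lbrakk>0 < t; t \<le> 1; x \<noteq> 0\<rbrakk> \<Longrightarrow>
        (\<integral>\<^sup>+ y. ennreal (heat_kernel t (x - y) * (1 / W y)) \<partial>lborel) \<le> ennreal (C / W x)"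
    using heat_W_const[OF zero_less_one] by blast
  obtain D where D: "D \<ge> 0" "\<And>t x. \<lbrakk>0 < t; t \<le> 1; x \<noteq> 0\<rbrakk> \<Longrightarrow>
        (\<integral>\<^sup>+ y. ennreal (heat_kernel t (x - y) * (V y / W y)) \<partial>lborel) \<le> ennreal (D * t powr (\<beta> - 1) / W x)"
    using heat_V_const[OF zero_less_one] by blast
  define M where "M = C * A + 1"
  define K where "K = H + M"
  have M: "M \<ge> 0" using C A by (simp add: M_def)
  have K: "K \<ge> 0" using H M by (simp add: K_def)
  obtain L where L: "L \<ge> 0" "\<And>y u v. \<lbrakk>y \<noteq> 0; \<bar>u\<bar> * W y \<le> K; \<bar>v\<bar> * W y \<le> K\<rbrakk> \<Longrightarrow>
        \<bar>N u y - N v y\<bar> \<le> L * V y * \<bar>u - v\<bar>"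
    using N_lipschitz_const[of K] by blast
  define E where "E = D * (L * K) / \<beta>"
  have E: "E \<ge> 0" using D L K beta_pos by (simp add: E_def)
  \<comment> \<open>so short that the new source contributes at most \<open>1\<close> to the weighted norm\<close>
  define \<tau> where "\<tau> = min 1 ((1 / (E + 1)) powr (1 / \<beta>))"
  have \<tau>: "\<tau> > 0" "\<tau> \<le> 1" using E by (auto simp: \<tau>_def)
  have \<tau>E: "E * \<sigma> powr \<beta> \<le> 1" if "0 \<le> \<sigma>" "\<sigma> \<le> \<tau>" for \<sigma>
  proof -
    have "\<sigma> powr \<beta> \<le> ((1 / (E + 1)) powr (1 / \<beta>)) powr \<beta>"
      using that beta_pos by (intro powr_mono2) (auto simp: \<tau>_def)
    also have "\<dots> = 1 / (E + 1)"
      using beta_pos E by (simp add: powr_powr)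
    finally have "E * \<sigma> powr \<beta> \<le> E * (1 / (E + 1))"
      using E by (intro mult_left_mono)
    also have "\<dots> \<le> 1" using E by simp
    finally show ?thesis .
  qed
  show thesis
  proof
    fix t0 t x
    assume t0: "t0 \<in> {0..T0}" and At0: "AE x in lborel. x \<noteq> 0 \<longrightarrow> source_part t0 x \<le> ennreal (A / W x)"
      and t: "t0 < t" "t \<le> t0 + \<tau>" and x: "x \<noteq> (0::'a)"
    have ind: "picard k t x \<le> ennreal (M / W x)" if "t0 < t" "t \<le> t0 + \<tau>" "x \<noteq> 0" for k t x
      using that
    proof (induction k arbitrary: t x)
      case (Suc k)
      note t = Suc.prems(1,2) and x = Suc.prems(3)
      have "picard (Suc k) t x \<le> (\<integral>\<^sup>+ z. ennreal (heat_kernel (t - t0) (x - z)) * duhamel 0 (picard_source k) t0 z \<partial>lborel)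
          + duhamel t0 (picard_source k) t x"
        unfolding picard_Suc using t0 t by (intro duhamel_restart_le) auto
      also have "\<dots> \<le> ennreal (C * A / W x) + ennreal (D * (L * K) * ((t - t0) powr \<beta> / \<beta>) / W x)"
      proof (rule add_mono)
        show "(\<integral>\<^sup>+ z. ennreal (heat_kernel (t - t0) (x - z)) * duhamel 0 (picard_source k) t0 z \<partial>lborel)
            \<le> ennreal (C * A / W x)"
        proof (rule weighted_integral_le[where T = 1, OF C])
          show "AE z in lborel. z \<noteq> 0 \<longrightarrow> duhamel 0 (picard_source k) t0 z \<le> ennreal (A / W z)"
            using At0
          proof (rule eventually_mono, intro impI)
            fix z assume "z \<noteq> 0 \<longrightarrow> source_part t0 z \<le> ennreal (A / W z)" "z \<noteq> 0"
            moreover have "duhamel 0 (picard_source k) t0 z \<le> source_part t0 z"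
              using picard_le_source_part[of "Suc k" t0 z] unfolding picard_Suc .
            ultimately show "duhamel 0 (picard_source k) t0 z \<le> ennreal (A / W z)" by auto
          qed
        qed (use A t \<tau> x in auto)
        show "duhamel t0 (picard_source k) t x \<le> ennreal (D * (L * K) * ((t - t0) powr \<beta> / \<beta>) / W x)"
        proof (rule duhamel_potential_const_le[where T = 1, OF D])
          fix s y assume s: "t0 < s" "s < t" and y: "y \<noteq> (0::'a)"
          define u where "u = enn2real (min (picard k s y) (of_nat k))"
          have u: "u \<ge> 0" by (simp add: u_def)
          have "u \<le> enn2real (ennreal (M / W y))"
            unfolding u_def using s t Suc.IH[of s y] y
            by (intro enn2real_mono) (auto intro: min.coboundedI1)
          then have "u * W y \<le> M"
            using M W_pos[OF y] by (simp add: pos_le_divide_eq)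
          moreover have "\<bar>heat_phi s y\<bar> * W y \<le> H"
            using s t t0 \<tau> y by (intro H) auto
          moreover have "\<bar>heat_phi s y + u\<bar> * W y \<le> (\<bar>heat_phi s y\<bar> + u) * W y"
            using W_pos[OF y] u by (intro mult_right_mono) auto
          ultimately have "\<bar>heat_phi s y + u\<bar> * W y \<le> K"
            by (simp add: K_def distrib_right)
          then show "picard_source k s y \<le> ennreal (L * K * (V y / W y))"
            unfolding picard_source_def u_def using L y by (intro ennreal_leI N_le_potential) auto
        qed (use L K t \<tau> x in auto)
      qed
      also have "\<dots> = ennreal ((C * A + E * (t - t0) powr \<beta>) / W x)"
      proof -
        have "D * (L * K) * ((t - t0) powr \<beta> / \<beta>) = E * (t - t0) powr \<beta>"
          by (simp add: E_def)
        then show ?thesis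
          using C A E W_pos[OF x] by (simp only: add_divide_distrib) (subst ennreal_plus, auto)
      qed
      also have "\<dots> \<le> ennreal (M / W x)"
        unfolding M_def using \<tau>E[of "t - t0"] t W_pos[OF x] by (intro ennreal_leI divide_right_mono) auto
      finally show ?case .
    qed (simp add: M)
    show "source_part t x \<le> ennreal (M / W x)"
      using ind[OF t x] by (rule source_part_le)
  qed (use \<tau> M in auto)
qed

section \<open>Maximal time, blow-up and uniqueness\<close>

lemma bounded_upto_mono: "bounded_upto T \<Longrightarrow> T' \<le> T \<Longrightarrow> bounded_upto T'"
  unfolding bounded_upto_def by (meson atLeastAtMost_iff order_trans)

definition Tmax :: ereal where
  "Tmax = Sup (ereal ` {T. bounded_upto T})"

lemma bounded_below_Tmax:
  assumes "ereal T < Tmax"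
  shows "bounded_upto T"
proof -
  obtain T' where "bounded_upto T'" "T < T'"
    using assms unfolding Tmax_def by (auto simp: less_Sup_iff)
  then show ?thesis by (auto intro: bounded_upto_mono)
qed

lemma bounded_upto_extend:
  assumes "bounded_upto t0" "t0 \<ge> 0" "M \<ge> 0"
    and "\<And>t x. \<lbrakk>t0 < t; t \<le> t0 + \<tau>; x \<noteq> 0\<rbrakk> \<Longrightarrow> source_part t x \<le> ennreal (M / W x)"
  shows "bounded_upto (t0 + \<tau>)"
proof -
  obtain M' where M': "M' \<ge> 0" "\<forall>t\<in>{0..t0}. \<forall>x. x \<noteq> 0 \<longrightarrow> source_part t x \<le> ennreal (M' / W x)"
    using assms unfolding bounded_upto_def by blast
  have "source_part t x \<le> ennreal (max M M' / W x)" if t: "t \<in> {0..t0 + \<tau>}" and x: "x \<noteq> 0" for t x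
  proof -
    have "source_part t x \<le> ennreal (M / W x) \<or> source_part t x \<le> ennreal (M' / W x)"
      using assms(4)[of t x] M' t x by force
    moreover have "ennreal (M / W x) \<le> ennreal (max M M' / W x)" "ennreal (M' / W x) \<le> ennreal (max M M' / W x)"
      using W_pos[OF x] by (auto intro!: ennreal_leI divide_right_mono)
    ultimately show ?thesis by (meson order_trans)
  qed
  moreover have "max M M' \<ge> 0" using assms by simp
  ultimately show ?thesis unfolding bounded_upto_def by blast
qed

lemma Tmax_pos: "Tmax > 0"
proof -
  obtain \<tau> M where \<tau>: "\<tau> > 0" "M \<ge> 0"
    "\<And>t0 t x. \<lbrakk>t0 \<in> {0..1}; AE x in lborel. x \<noteq> 0 \<longrightarrow> source_part t0 x \<le> ennreal (0 / W x);
        t0 < t; t \<le> t0 + \<tau>; x \<noteq> 0\<rbrakk> \<Longrightarrow> source_part t x \<le> ennreal (M / W x)"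
    using bounded_restart[of 1 0] zero_less_one order_refl by blast
  have "bounded_upto 0"
    unfolding bounded_upto_def by (auto simp: source_part_0)
  moreover have "source_part t x \<le> ennreal (M / W x)" if "0 < t" "t \<le> 0 + \<tau>" "x \<noteq> 0" for t x
    by (rule \<tau>(3)[of 0]) (use that in \<open>auto simp: source_part_0\<close>)
  ultimately have "bounded_upto (0 + \<tau>)"
    using \<tau>(2) by (intro bounded_upto_extend[of 0 M]) auto
  then have "ereal \<tau> \<le> Tmax"
    unfolding Tmax_def by (intro Sup_upper) auto
  then show ?thesis
    using \<tau>(1) by (metis ereal_less(2) less_le_trans)
qed

text \<open>
  The integral term cannot have norm at most \<open>A\<close> at a time close to a finite maximal time:
  restarting there would prolong boundedness by an amount independent of that time, hence beyond
  the maximal time.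
\<close>

lemma blow_up:
  assumes "Tmax = ereal S" "A \<ge> 0"
  obtains \<eta> where "\<eta> > 0" "\<eta> \<le> S"
    "\<And>t. \<lbrakk>S - \<eta> < t; t < S\<rbrakk> \<Longrightarrow> \<not> (AE x in lborel. x \<noteq> 0 \<longrightarrow> source_part t x \<le> ennreal (A / W x))"
proof -
  have S: "S > 0" using Tmax_pos assms(1) by simp
  obtain \<tau> M where \<tau>: "\<tau> > 0" "M \<ge> 0"
    "\<And>t0 t x. \<lbrakk>t0 \<in> {0..S}; AE x in lborel. x \<noteq> 0 \<longrightarrow> source_part t0 x \<le> ennreal (A / W x);
        t0 < t; t \<le> t0 + \<tau>; x \<noteq> 0\<rbrakk> \<Longrightarrow> source_part t x \<le> ennreal (M / W x)"
    using bounded_restart[OF S assms(2)] by blast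
  show thesis
  proof
    show "min \<tau> S > 0" "min \<tau> S \<le> S" using S \<tau> by auto
    fix t assume t: "S - min \<tau> S < t" "t < S"
    show "\<not> (AE x in lborel. x \<noteq> 0 \<longrightarrow> source_part t x \<le> ennreal (A / W x))"
    proof
      assume *: "AE x in lborel. x \<noteq> 0 \<longrightarrow> source_part t x \<le> ennreal (A / W x)"
      have "bounded_upto (t + \<tau>)"
        using bounded_below_Tmax[of t] t assms(1) \<tau>(2) \<tau>(3)[OF _ *]
        by (intro bounded_upto_extend[of t M]) auto
      then have "ereal (t + \<tau>) \<le> Tmax"
        unfolding Tmax_def by (intro Sup_upper) auto
      then show False using t assms(1) by auto
    qed
  qed
qed

text \<open>
  With \<open>2 * b = \<beta>\<close>, half of the integrable power of time is given up in exchange for the factor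
  \<open>\<mu> powr (- b)\<close>, which is small for large \<open>\<mu>\<close>.
\<close>

lemma exp_times_powr_le:
  fixes \<sigma> \<mu> b :: real
  assumes "\<sigma> \<ge> 0" "\<mu> > 0" "b > 0"
  shows "exp (- \<mu> * \<sigma>) * \<sigma> powr (2 * b - 1) \<le> b powr b * \<mu> powr (- b) * \<sigma> powr (b - 1)"
proof (cases "\<sigma> = 0")
  case False
  then have \<sigma>: "\<sigma> > 0" using assms by simp
  have "(\<mu> * \<sigma>) powr b * exp (- (\<mu> * \<sigma>)) \<le> b powr b"
    using assms by (intro powr_times_exp_minus_le) auto
  then have "((\<mu> * \<sigma>) powr b * exp (- (\<mu> * \<sigma>))) * (\<mu> powr (- b) * \<sigma> powr (b - 1))
      \<le> b powr b * (\<mu> powr (- b) * \<sigma> powr (b - 1))"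
    by (intro mult_right_mono) auto
  moreover have "(\<mu> * \<sigma>) powr b * \<mu> powr (- b) = \<sigma> powr b"
    using assms by (simp add: powr_mult powr_minus)
  moreover have "\<sigma> powr b * \<sigma> powr (b - 1) = \<sigma> powr (2 * b - 1)"
    by (simp add: powr_add [symmetric])
  ultimately show ?thesis
    by (metis (no_types, opaque_lifting) mult.assoc mult.commute mult_minus_left)
qed simp

text \<open>
  Over a long time interval the Duhamel operator is a contraction once the bounds may grow
  like \<open>exp (\<mu> * t)\<close>: the factor \<open>exp (- \<mu> * (t - s))\<close> gained inside the time integral makes its
  norm as small as desired. Hence the difference of two solutions is below \<open>(1/2) ^ k\<close> times a fixed
  bound, for every \<open>k\<close>.
\<close>

lemma solution_unique:
  fixes u v :: "real \<Rightarrow> 'a \<Rightarrow> real"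
  assumes [measurable]: "case_prod u \<in> borel_measurable (borel \<Otimes>\<^sub>M borel)"
      "case_prod v \<in> borel_measurable (borel \<Otimes>\<^sub>M borel)"
    and T: "T > 0" and R: "R \<ge> 0"
    and u: "\<And>t x. \<lbrakk>t \<in> {0..T}; x \<noteq> 0\<rbrakk> \<Longrightarrow> \<bar>u t x\<bar> * W x \<le> R"
    and v: "\<And>t x. \<lbrakk>t \<in> {0..T}; x \<noteq> 0\<rbrakk> \<Longrightarrow> \<bar>v t x\<bar> * W x \<le> R"
    and diff: "AE z in lborel \<Otimes>\<^sub>M lborel. fst z \<in> {0..T} \<longrightarrow>
      ennreal \<bar>u (fst z) (snd z) - v (fst z) (snd z)\<bar>
        \<le> duhamel 0 (\<lambda>s y. ennreal \<bar>N (u s y) y - N (v s y) y\<bar>) (fst z) (snd z)"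
  shows "AE z in lborel \<Otimes>\<^sub>M lborel. fst z \<in> {0..T} \<longrightarrow> snd z \<noteq> 0 \<longrightarrow> u (fst z) (snd z) = v (fst z) (snd z)"
proof -
  obtain L where L: "L \<ge> 0" "\<And>y u v. \<lbrakk>y \<noteq> 0; \<bar>u\<bar> * W y \<le> R; \<bar>v\<bar> * W y \<le> R\<rbrakk> \<Longrightarrow>
        \<bar>N u y - N v y\<bar> \<le> L * V y * \<bar>u - v\<bar>"
    using N_lipschitz_const[of R] by blast
  obtain D where D: "D \<ge> 0" "\<And>t x. \<lbrakk>0 < t; t \<le> T; x \<noteq> 0\<rbrakk> \<Longrightarrow>
        (\<integral>\<^sup>+ y. ennreal (heat_kernel t (x - y) * (V y / W y)) \<partial>lborel) \<le> ennreal (D * t powr (\<beta> - 1) / W x)"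
    using heat_V_const[OF T] by blast
  define b where "b = \<beta> / 2"
  have b: "b > 0" "2 * b = \<beta>" using beta_pos by (auto simp: b_def)
  define E where "E = D * L * (b powr b) * (T powr b / b)"
  have E: "E \<ge> 0" using D L b by (simp add: E_def)
  \<comment> \<open>so large that one application of the Duhamel operator halves the bound\<close>
  define \<mu> where "\<mu> = (2 * E + 1) powr (1 / b)"
  have \<mu>: "\<mu> > 0" "E * \<mu> powr (- b) \<le> 1 / 2"
  proof -
    show "\<mu> > 0" using E by (simp add: \<mu>_def)
    have "\<mu> powr (- b) = 1 / (2 * E + 1)"
      using E b by (simp add: \<mu>_def powr_powr powr_minus_divide)
    moreover have "E * (1 / (2 * E + 1)) \<le> 1 / 2"
      using E by (simp add: divide_simps)
    ultimately show "E * \<mu> powr (- b) \<le> 1 / 2" by (simp only:)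
  qed
  define B where "B k t = (1 / 2) ^ k * (2 * R * exp (\<mu> * t))" for k :: nat and t :: real
  have B: "B k t \<ge> 0" for k t using R by (simp add: B_def)
  have [measurable]: "B k \<in> borel_measurable borel" for k unfolding B_def by measurable
  have time: "(\<integral>\<^sup>+ s. indicator {0..t} s * ennreal (L * B k s * (t - s) powr (\<beta> - 1)) \<partial>lborel)
      \<le> ennreal (L * B k t * (b powr b * \<mu> powr (- b)) * (t powr b / b))" if t: "t \<in> {0..T}" for t k
  proof -
    have pt: "indicator {0..t} s * ennreal (L * B k s * (t - s) powr (\<beta> - 1))
        \<le> ennreal (L * B k t * (b powr b * \<mu> powr (- b))) * (indicator {0..t} s * ennreal ((t - s) powr (b - 1)))" for s
    proof (cases "s \<in> {0..t}")
      case True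
      have Bs: "B k s = B k t * exp (- \<mu> * (t - s))"
        by (simp add: B_def exp_add [symmetric] algebra_simps flip: exp_diff)
      have "L * B k s * (t - s) powr (\<beta> - 1) = (L * B k t) * (exp (- \<mu> * (t - s)) * (t - s) powr (2 * b - 1))"
        unfolding Bs b(2) by (simp only: mult_ac)
      also have "\<dots> \<le> (L * B k t) * (b powr b * \<mu> powr (- b) * (t - s) powr (b - 1))"
        using True \<mu> b L B by (intro mult_left_mono exp_times_powr_le) auto
      also have "\<dots> = L * B k t * (b powr b * \<mu> powr (- b)) * (t - s) powr (b - 1)"
        by (simp only: mult_ac)
      finally show ?thesis
        using True L B by (simp add: ennreal_mult [symmetric] ennreal_leI)
    qed simp
    have "(\<integral>\<^sup>+ s. indicator {0..t} s * ennreal (L * B k s * (t - s) powr (\<beta> - 1)) \<partial>lborel)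
        \<le> (\<integral>\<^sup>+ s. ennreal (L * B k t * (b powr b * \<mu> powr (- b))) * (indicator {0..t} s * ennreal ((t - s) powr (b - 1))) \<partial>lborel)"
      by (intro nn_integral_mono pt)
    also have "\<dots> = ennreal (L * B k t * (b powr b * \<mu> powr (- b))) * ennreal ((t - 0) powr b / b)"
      using t b by (subst nn_integral_cmult) (auto simp: nn_integral_powr_time)
    also have "\<dots> = ennreal (L * B k t * (b powr b * \<mu> powr (- b)) * (t powr b / b))"
      using L B b by (subst ennreal_mult) auto
    finally show ?thesis .
  qed
  have small: "D / w * (L * B k t * (b powr b * \<mu> powr (- b)) * (t powr b / b)) \<le> B (Suc k) t / w"
    if t: "t \<in> {0..T}" and w: "w > 0" for t k w
  proof -
    have "D * (L * B k t * (b powr b * \<mu> powr (- b)) * (t powr b / b))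
        \<le> D * (L * B k t * (b powr b * \<mu> powr (- b)) * (T powr b / b))"
      using t b D L B by (intro mult_left_mono divide_right_mono powr_mono2) auto
    also have "\<dots> = B k t * (E * \<mu> powr (- b))"
      by (simp add: E_def mult_ac)
    also have "\<dots> \<le> B k t * (1 / 2)"
      using \<mu> B by (intro mult_left_mono) auto
    also have "\<dots> = B (Suc k) t" by (simp add: B_def)
    finally show ?thesis
      unfolding times_divide_eq_left[of D] using w by (intro divide_right_mono) auto
  qed
  have claim: "AE z in lborel \<Otimes>\<^sub>M lborel. fst z \<in> {0..T} \<longrightarrow> snd z \<noteq> 0 \<longrightarrow>
      \<bar>u (fst z) (snd z) - v (fst z) (snd z)\<bar> \<le> B k (fst z) / W (snd z)" for k
  proof (induction k)
    case 0
    have "\<bar>u t x - v t x\<bar> \<le> B 0 t / W x" if t: "t \<in> {0..T}" and x: "x \<noteq> 0" for t x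
    proof -
      have "\<bar>u t x - v t x\<bar> * W x \<le> (\<bar>u t x\<bar> + \<bar>v t x\<bar>) * W x"
        using W_pos[OF x] by (intro mult_right_mono) auto
      also have "\<dots> \<le> 2 * R" using u[OF t x] v[OF t x] by (simp add: distrib_right)
      also have "\<dots> \<le> B 0 t"
        using t R \<mu> mult_left_mono[of 1 "exp (\<mu> * t)" "2 * R"] by (simp add: B_def)
      finally show ?thesis using W_pos[OF x] by (simp add: pos_le_divide_eq)
    qed
    then show ?case by auto
  next
    case (Suc k)
    have IH: "AE s in lborel. AE y in lborel. s \<in> {0..T} \<longrightarrow> y \<noteq> 0 \<longrightarrow> \<bar>u s y - v s y\<bar> \<le> B k s / W y"
      using lborel_pair.AE_pair[OF Suc.IH] by simp
    show ?case
      using diff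
    proof (rule eventually_mono, intro impI)
      fix z :: "real \<times> 'a"
      assume z: "fst z \<in> {0..T} \<longrightarrow>
        ennreal \<bar>u (fst z) (snd z) - v (fst z) (snd z)\<bar>
          \<le> duhamel 0 (\<lambda>s y. ennreal \<bar>N (u s y) y - N (v s y) y\<bar>) (fst z) (snd z)"
        "fst z \<in> {0..T}" "snd z \<noteq> 0"
      define t x where "t = fst z" and "x = snd z"
      have t: "t \<in> {0..T}" and x: "x \<noteq> 0" using z by (auto simp: t_def x_def)
      have "ennreal \<bar>u t x - v t x\<bar> \<le> duhamel 0 (\<lambda>s y. ennreal \<bar>N (u s y) y - N (v s y) y\<bar>) t x"
        using z by (simp add: t_def x_def)
      also have "\<dots> \<le> ennreal (D / W x) *
          (\<integral>\<^sup>+ s. indicator {0..t} s * ennreal (L * B k s * (t - s) powr (\<beta> - 1)) \<partial>lborel)"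
      proof (rule duhamel_potential_le[where T = T, OF D])
        show "AE s in lborel. 0 \<le> s \<and> s < t \<longrightarrow> (AE y in lborel. y \<noteq> 0 \<longrightarrow>
            ennreal \<bar>N (u s y) y - N (v s y) y\<bar> \<le> ennreal (L * B k s * (V y / W y)))"
          using IH
        proof (rule eventually_mono, intro impI)
          fix s
          assume s: "AE y in lborel. s \<in> {0..T} \<longrightarrow> y \<noteq> 0 \<longrightarrow> \<bar>u s y - v s y\<bar> \<le> B k s / W y" "0 \<le> s \<and> s < t"
          then have sT: "s \<in> {0..T}" using t by auto
          show "AE y in lborel. y \<noteq> 0 \<longrightarrow>
            ennreal \<bar>N (u s y) y - N (v s y) y\<bar> \<le> ennreal (L * B k s * (V y / W y))"
            using s(1)
          proof (rule eventually_mono, intro impI ennreal_leI)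
            fix y assume y: "s \<in> {0..T} \<longrightarrow> y \<noteq> 0 \<longrightarrow> \<bar>u s y - v s y\<bar> \<le> B k s / W y" "y \<noteq> 0"
            have "\<bar>N (u s y) y - N (v s y) y\<bar> \<le> L * V y * \<bar>u s y - v s y\<bar>"
              using y u[OF sT] v[OF sT] by (intro L) auto
            also have "\<dots> \<le> L * V y * (B k s / W y)"
              using y sT L V_nonneg by (intro mult_left_mono) auto
            finally show "\<bar>N (u s y) y - N (v s y) y\<bar> \<le> L * B k s * (V y / W y)"
              by (simp add: mult_ac)
          qed
        qed
      qed (use L B t x in auto)
      also have "\<dots> \<le> ennreal (D / W x) * ennreal (L * B k t * (b powr b * \<mu> powr (- b)) * (t powr b / b))"
        by (intro mult_left_mono time t) simp
      also have "\<dots> = ennreal (D / W x * (L * B k t * (b powr b * \<mu> powr (- b)) * (t powr b / b)))"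
        using D W_pos[OF x] L B b by (subst ennreal_mult) auto
      also have "\<dots> \<le> ennreal (B (Suc k) t / W x)"
        by (intro ennreal_leI small t W_pos x)
      finally show "\<bar>u (fst z) (snd z) - v (fst z) (snd z)\<bar> \<le> B (Suc k) (fst z) / W (snd z)"
        using B[of "Suc k" t] W_pos[OF x] by (simp add: t_def x_def)
    qed
  qed
  have "AE z in lborel \<Otimes>\<^sub>M lborel. \<forall>k. fst z \<in> {0..T} \<longrightarrow> snd z \<noteq> 0 \<longrightarrow>
      \<bar>u (fst z) (snd z) - v (fst z) (snd z)\<bar> \<le> B k (fst z) / W (snd z)"
    unfolding AE_all_countable using claim by blast
  then show ?thesis
  proof (rule eventually_mono, intro impI)
    fix z :: "real \<times> 'a"
    assume z: "\<forall>k. fst z \<in> {0..T} \<longrightarrow> snd z \<noteq> 0 \<longrightarrow>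
      \<bar>u (fst z) (snd z) - v (fst z) (snd z)\<bar> \<le> B k (fst z) / W (snd z)" "fst z \<in> {0..T}" "snd z \<noteq> 0"
    have "(\<lambda>k. B k (fst z) / W (snd z)) \<longlonglongrightarrow> 0 * (2 * R * exp (\<mu> * fst z)) / W (snd z)"
      unfolding B_def using W_pos[OF z(3)] by (intro tendsto_intros LIMSEQ_power_zero) auto
    then have "\<bar>u (fst z) (snd z) - v (fst z) (snd z)\<bar> \<le> 0"
      using z by (intro LIMSEQ_le_const) auto
    then show "u (fst z) (snd z) = v (fst z) (snd z)" by simp
  qed
qed

end

section \<open>The nonlinearity on balls of the weighted space\<close>

lemma lipschitz_on_abs_le:
  assumes "L-lipschitz_on S (g :: real \<Rightarrow> real)" "u \<in> S" "v \<in> S"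
  shows "\<bar>g u - g v\<bar> \<le> L * \<bar>u - v\<bar>"
  using lipschitz_onD[OF assms] by (simp add: dist_real_def)

lemma loc_lipschitz_continuous_on:
  assumes "loc_lipschitz S F"
  shows "continuous_on S F"
  unfolding continuous_on_eq_continuous_within
proof
  fix p assume p: "p \<in> S"
  then obtain e L where e: "e > 0" "L-lipschitz_on (cball p e \<inter> S) F"
    using assms unfolding loc_lipschitz_def by blast
  then have "continuous (at p within cball p e \<inter> S) F"
    using p lipschitz_on_continuous_on[of L "cball p e \<inter> S" F]
    by (auto simp: continuous_on_eq_continuous_within)
  moreover have "at p within cball p e \<inter> S = at p within S"
    using e by (intro at_within_nhd[of p "ball p e"]) auto
  ultimately show "continuous (at p within S) F"
    by (simp add: continuous_within)
qed

lemma cond_F0_mono: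
  assumes "cond_F0 f" "r > 0" "0 \<le> u" "u \<le> v"
  shows "f u r \<le> f v r"
proof (cases "u = 0")
  case True
  then show ?thesis
    using assms unfolding cond_F0_def by (cases "v = 0") (auto intro: less_imp_le)
next
  case False
  then show ?thesis
    using assms unfolding cond_F0_def by (auto elim!: allE[of _ r] intro: mono_onD)
qed

text \<open>
  Local Lipschitz continuity becomes uniform by compactness.
\<close>

lemma cond_F0_lipschitz_compact:
  assumes F0: "cond_F0 f" and r0: "0 < r0"
  obtains L where "L \<ge> 0"
    "\<And>r u v. \<lbrakk>r \<in> {r0..r1}; u \<in> {0..K}; v \<in> {0..K}\<rbrakk> \<Longrightarrow> \<bar>f u r - f v r\<bar> \<le> L * \<bar>u - v\<bar>"
proof -
  have ll: "loc_lipschitz ({0..} \<times> {0<..}) (\<lambda>(u, r). f u r)"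
    using F0 by (simp add: cond_F0_def)
  have "local_lipschitz {r0..r1} {0..K} (\<lambda>r u. f u r)"
  proof (rule local_lipschitzI)
    fix r u assume ru: "r \<in> {r0..r1}" "u \<in> {0..K}"
    then have "(u, r) \<in> {0..} \<times> {0<..}" using r0 by auto
    then obtain e L where e: "e > 0" "L-lipschitz_on (cball (u, r) e \<inter> ({0..} \<times> {0<..})) (\<lambda>(u, r). f u r)"
      using ll unfolding loc_lipschitz_def by blast
    have "L-lipschitz_on (cball u (e / 2) \<inter> {0..K}) (\<lambda>u. f u s)" if s: "s \<in> cball r (e / 2) \<inter> {r0..r1}" for s
    proof (rule lipschitz_onI)
      show "L \<ge> 0" using e(2) by (rule lipschitz_on_nonneg)
      have in_cball: "(a, s) \<in> cball (u, r) e \<inter> ({0..} \<times> {0<..})" if a: "a \<in> cball u (e / 2) \<inter> {0..K}" for a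
      proof -
        have "dist (u, r) (a, s) \<le> dist u a + dist r s"
          by (simp add: dist_Pair_Pair sqrt_sum_squares_le_sum)
        then show ?thesis using a s r0 by auto
      qed
      fix a b assume "a \<in> cball u (e / 2) \<inter> {0..K}" "b \<in> cball u (e / 2) \<inter> {0..K}"
      from lipschitz_onD[OF e(2) in_cball[OF this(1)] in_cball[OF this(2)]]
      show "dist (f a s) (f b s) \<le> L * dist a b"
        by (simp add: dist_Pair_Pair)
    qed
    then show "\<exists>d>0. \<exists>L. \<forall>s\<in>cball r d \<inter> {r0..r1}. L-lipschitz_on (cball u d \<inter> {0..K}) (\<lambda>u. f u s)"
      using e(1) by (intro exI[of _ "e / 2"] conjI exI[of _ L] ballI) auto
  qed
  moreover have "continuous_on {r0..r1} (\<lambda>r. f u r)" if "u \<in> {0..K}" for u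
  proof -
    have "continuous_on {r0..r1} ((\<lambda>(u, r). f u r) \<circ> (\<lambda>r. (u, r)))"
      using that r0
      by (intro continuous_on_compose continuous_intros
          continuous_on_subset[OF loc_lipschitz_continuous_on[OF ll]]) auto
    then show ?thesis by (simp add: o_def)
  qed
  ultimately obtain L where L: "\<And>r. r \<in> {r0..r1} \<Longrightarrow> L-lipschitz_on {0..K} (\<lambda>u. f u r)"
    using local_lipschitz_compact_implies_lipschitz[where X = "{0..K}" and T = "{r0..r1}"
        and f = "\<lambda>r u. f u r"]
    by (auto intro: compact_Icc)
  show thesis
  proof
    show "\<bar>f u r - f v r\<bar> \<le> max L 0 * \<bar>u - v\<bar>" if "r \<in> {r0..r1}" "u \<in> {0..K}" "v \<in> {0..K}" for r u v
    proof -
      have "\<bar>f u r - f v r\<bar> \<le> L * \<bar>u - v\<bar>"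
        using lipschitz_on_abs_le[OF L] that by blast
      also have "\<dots> \<le> max L 0 * \<bar>u - v\<bar>" by (intro mult_right_mono) auto
      finally show ?thesis .
    qed
  qed simp
qed

text \<open>
  In the variable \<open>y = u * r powr m\<close> the nonlinearity is \<open>g_fun\<close>, whose \<open>y\<close>-derivative is at most
  \<open>D * y powr \<delta>\<close>. For \<open>u\<close> below \<open>K * r powr (- \<nu>)\<close> with \<open>\<nu> < m\<close>, the variable \<open>y\<close> is a positive
  power of \<open>r\<close>, so the Lipschitz constant in \<open>u\<close> improves on the scaling-critical \<open>r powr (- 2)\<close>.
\<close>

lemma cond_Fu_lipschitz_near:
  assumes F0: "cond_F0 f" and Fu: "cond_Fu n f lu \<delta>" and \<delta>: "\<delta> > 0"
  obtains D where "D > 0"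
    "\<And>K \<nu> r u v. \<lbrakk>K > 0; 0 < r; r \<le> 1; K * r powr (m_exp lu - \<nu>) \<le> 1;
        u \<in> {0..K * r powr (- \<nu>)}; v \<in> {0..K * r powr (- \<nu>)}\<rbrakk>
      \<Longrightarrow> \<bar>f u r - f v r\<bar> \<le> D * K powr \<delta> * r powr ((m_exp lu - \<nu>) * \<delta> - 2) * \<bar>u - v\<bar>"
proof -
  define m where "m = m_exp lu"
  obtain D where D: "D > 0"
    "\<And>y s. \<lbrakk>y \<in> {0..1}; s \<le> 0\<rbrakk> \<Longrightarrow> \<exists>d. ((\<lambda>y. g_fun f lu y s) has_real_derivative d) (at y within {0..}) \<and>
        d \<le> D * \<bar>y\<bar> powr \<delta>"
    using Fu unfolding cond_Fu_def by blast
  show thesis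
  proof
    fix K \<nu> r u v :: real
    assume K: "K > 0" and r: "0 < r" "r \<le> 1" and small: "K * r powr (m_exp lu - \<nu>) \<le> 1"
      and uv: "u \<in> {0..K * r powr (- \<nu>)}" "v \<in> {0..K * r powr (- \<nu>)}"
    let ?C = "D * K powr \<delta> * r powr ((m_exp lu - \<nu>) * \<delta> - 2)"
    have ordered: "f v r - f u r \<le> ?C * (v - u)" if uv: "0 \<le> u" "u < v" "v \<le> K * r powr (- \<nu>)" for u v
    proof -
      define s where "s = ln r"
      have s: "s \<le> 0" using r by (simp add: s_def)
      have g: "g_fun f lu (w * r powr m) s = f w r * r powr (m + 2)" for w
      proof -
        have "exp (- m * s) = r powr (- m)" "exp ((m + 2) * s) = r powr (m + 2)" "exp s = r"
          using r by (simp_all add: s_def powr_def)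
        moreover have "r powr m * r powr (- m) = 1"
          using r by (simp add: powr_add [symmetric])
        ultimately show ?thesis
          unfolding g_fun_def m_def [symmetric] by (simp add: mult.assoc)
      qed
      define a b where "a = u * r powr m" and "b = v * r powr m"
      have ab: "0 \<le> a" "a < b" using uv r by (auto simp: a_def b_def)
      have bK: "b \<le> K * r powr (m - \<nu>)"
      proof -
        have "b \<le> K * r powr (- \<nu>) * r powr m"
          unfolding b_def using uv by (intro mult_right_mono) auto
        also have "\<dots> = K * r powr (m - \<nu>)"
          by (simp add: mult.assoc powr_add [symmetric])
        finally show ?thesis .
      qed
      then have b1: "b \<le> 1" using small by (simp add: m_def)
      obtain d where d: "\<And>y. y \<in> {0..1} \<Longrightarrow>
          ((\<lambda>y. g_fun f lu y s) has_real_derivative d y) (at y within {0..}) \<and> d y \<le> D * \<bar>y\<bar> powr \<delta>"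
        using D(2)[OF _ s] by metis
      have "\<exists>y\<in>{a<..<b}. g_fun f lu b s - g_fun f lu a s = d y * (b - a)"
      proof (rule mvt_simple[OF ab(2)])
        fix y assume "a \<le> y" "y \<le> b"
        then show "((\<lambda>y. g_fun f lu y s) has_derivative (*) (d y)) (at y within {a..b})"
          using d[of y] ab b1 unfolding has_field_derivative_def [symmetric]
          by (auto intro: DERIV_subset)
      qed
      then obtain y where y: "y \<in> {a<..<b}" "g_fun f lu b s - g_fun f lu a s = d y * (b - a)"
        by blast
      have "d y \<le> D * (K * r powr (m - \<nu>)) powr \<delta>"
      proof -
        have "d y \<le> D * \<bar>y\<bar> powr \<delta>" using d[of y] y ab b1 by auto
        also have "\<dots> \<le> D * (K * r powr (m - \<nu>)) powr \<delta>"
          using y ab bK D \<delta> by (intro mult_left_mono powr_mono2) auto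
        finally show ?thesis .
      qed
      moreover have "(f v r - f u r) * r powr (m + 2) = d y * (b - a)"
        using y(2) unfolding a_def b_def g by (simp add: algebra_simps)
      ultimately have "(f v r - f u r) * r powr (m + 2) \<le> D * (K * r powr (m - \<nu>)) powr \<delta> * (b - a)"
        using ab by (simp add: mult_right_mono)
      moreover have "(K * r powr (m - \<nu>)) powr \<delta> = K powr \<delta> * r powr ((m - \<nu>) * \<delta>)"
        using K r by (simp add: powr_mult powr_powr)
      moreover have "b - a = r powr m * (v - u)"
        by (simp add: a_def b_def algebra_simps)
      ultimately have "(f v r - f u r) * r powr (m + 2) \<le>
          D * (K powr \<delta> * r powr ((m - \<nu>) * \<delta>)) * (r powr m * (v - u))"
        by (simp only:)
      then have "(f v r - f u r) * r powr (m + 2) * r powr (- (m + 2)) \<le>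
          D * (K powr \<delta> * r powr ((m - \<nu>) * \<delta>)) * (r powr m * (v - u)) * r powr (- (m + 2))"
        by (intro mult_right_mono) auto
      moreover have "r powr (m + 2) * r powr (- (m + 2)) = 1"
        using r by (simp add: powr_add [symmetric])
      moreover have "r powr ((m - \<nu>) * \<delta>) * r powr m * r powr (- (m + 2)) = r powr ((m - \<nu>) * \<delta> - 2)"
        by (simp add: powr_add [symmetric])
      ultimately show ?thesis
        unfolding m_def [symmetric] by (simp add: mult_ac)
    qed
    have abs: "\<bar>f v r - f u r\<bar> \<le> ?C * (v - u)" if uv: "0 \<le> u" "u < v" "v \<le> K * r powr (- \<nu>)" for u v
      using ordered[OF uv] cond_F0_mono[OF F0 r(1), of u v] uv by simp
    show "\<bar>f u r - f v r\<bar> \<le> ?C * \<bar>u - v\<bar>"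
      using abs[of u v] abs[of v u] uv by (cases u v rule: linorder_cases) (auto simp: abs_minus_commute)
  qed (fact D(1))
qed

text \<open>
  The bound carries the factor \<open>r powr l\<close>, while admissible values of \<open>u\<close> are of order
  \<open>r powr (- (l / \<delta>))\<close>; in \<open>u powr \<delta>\<close> the two powers cancel. This is what the exponent of the weight
  at infinity is made for.
\<close>

lemma cond_Fs_lipschitz_far:
  assumes Fs: "cond_Fs f l \<delta>" and l: "l > 0" and K: "K > 0"
  obtains R L where "R \<ge> 1" "L \<ge> 0"
    "\<And>r u v. \<lbrakk>r \<ge> R; u \<in> {0..K * r powr (- (l / \<delta>))}; v \<in> {0..K * r powr (- (l / \<delta>))}\<rbrakk>
      \<Longrightarrow> \<bar>f u r - f v r\<bar> \<le> L * \<bar>u - v\<bar>"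
proof -
  have \<delta>: "\<delta> > 0" using Fs by (simp add: cond_Fs_def)
  obtain C \<epsilon> where C: "C > 0" and \<epsilon>: "\<epsilon> > 0" and lip:
    "\<And>r u h. \<lbrakk>r \<ge> 1; u \<in> {0..1}; h \<in> {0..\<epsilon>}\<rbrakk> \<Longrightarrow> \<bar>f u r - f (u + h) r\<bar> \<le> C * h * (u + h) powr \<delta> * r powr l"
    using Fs unfolding cond_Fs_def by blast
  define b where "b = l / \<delta>"
  have b: "b > 0" using l \<delta> by (simp add: b_def)
  \<comment> \<open>beyond \<open>R\<close> the admissible values are so small that a single increment suffices\<close>
  define e where "e = min 1 \<epsilon>"
  have e: "e > 0" using \<epsilon> by (simp add: e_def)
  define R where "R = max 1 ((K / e) powr (1 / b))"
  have small: "K * r powr (- b) \<le> e" if "r \<ge> R" for r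
  proof -
    have "K / e = ((K / e) powr (1 / b)) powr b"
      using b K e by (simp add: powr_powr)
    also have "\<dots> \<le> r powr b"
      using that b by (intro powr_mono2) (auto simp: R_def)
    finally show ?thesis
      using e that by (simp add: powr_minus_divide divide_simps R_def mult.commute)
  qed
  show thesis
  proof
    show "R \<ge> 1" by (simp add: R_def)
    show "C * K powr \<delta> \<ge> 0" using C by simp
    fix r u v
    assume r: "r \<ge> R" and uv: "u \<in> {0..K * r powr (- (l / \<delta>))}" "v \<in> {0..K * r powr (- (l / \<delta>))}"
    have r1: "r \<ge> 1" using r by (simp add: R_def)
    have ordered: "\<bar>f u r - f v r\<bar> \<le> C * K powr \<delta> * (v - u)"
      if uv: "0 \<le> u" "u \<le> v" "v \<le> K * r powr (- b)" for u v
    proof -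
      have "v \<le> e" using uv small[OF r] by simp
      then have "\<bar>f u r - f (u + (v - u)) r\<bar> \<le> C * (v - u) * (u + (v - u)) powr \<delta> * r powr l"
        using uv r1 by (intro lip) (auto simp: e_def)
      then have "\<bar>f u r - f v r\<bar> \<le> C * (v - u) * (v powr \<delta> * r powr l)" by (simp add: mult.assoc)
      also have "\<dots> \<le> C * (v - u) * (K powr \<delta>)"
      proof (intro mult_left_mono)
        have "v powr \<delta> \<le> (K * r powr (- b)) powr \<delta>"
          using uv \<delta> by (intro powr_mono2) auto
        also have "\<dots> = K powr \<delta> * r powr (- l)"
          using K \<delta> r1 by (simp add: powr_mult powr_powr b_def)
        finally have "v powr \<delta> * r powr l \<le> K powr \<delta> * r powr (- l) * r powr l"
          by (intro mult_right_mono) auto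
        then show "v powr \<delta> * r powr l \<le> K powr \<delta>"
          using r1 by (simp add: mult.assoc powr_add [symmetric])
      qed (use C uv in auto)
      finally show ?thesis by (simp add: mult_ac)
    qed
    show "\<bar>f u r - f v r\<bar> \<le> C * K powr \<delta> * \<bar>u - v\<bar>"
      using ordered[of u v] ordered[of v u] uv
      by (cases u v rule: le_cases) (auto simp: abs_minus_commute b_def)
  qed
qed

definition radial_weight :: "real \<Rightarrow> real \<Rightarrow> real \<Rightarrow> real" where
  "radial_weight \<nu> b r = (if r \<le> 1 then r powr \<nu> else r powr b)"

text \<open>
  The dependence on the radius of the Lipschitz constant in \<open>nonlinearity_lipschitz_weighted\<close>.
\<close>

definition radial_potential :: "real \<Rightarrow> real \<Rightarrow> real" where
  "radial_potential \<gamma> r = (if r \<le> 1 then r powr (\<gamma> - 2) else 1)"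

text \<open>
  The hypotheses at the origin and at infinity meet on a compact range of radii, where local
  Lipschitz continuity is enough.
\<close>

lemma nonlinearity_lipschitz_weighted:
  assumes F0: "cond_F0 f" and Fu: "cond_Fu n f lu \<delta>" and Fs: "cond_Fs f l \<delta>"
    and far: "l = 0 \<longrightarrow> unif_lipschitz_far f"
    and \<nu>: "0 \<le> \<nu>" "\<nu> < m_exp lu" and \<gamma>: "\<gamma> \<le> (m_exp lu - \<nu>) * \<delta>" "\<gamma> \<le> 2"
  shows "\<exists>L\<ge>0. \<forall>r u v. 0 < r \<and> 0 \<le> u \<and> 0 \<le> v \<and>
      u * radial_weight \<nu> (l / \<delta>) r \<le> K \<and> v * radial_weight \<nu> (l / \<delta>) r \<le> K \<longrightarrow>
      \<bar>f u r - f v r\<bar> \<le> L * radial_potential \<gamma> r * \<bar>u - v\<bar>"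
proof -
  have \<delta>: "\<delta> > 0" and l: "l \<ge> 0" using Fs by (auto simp: cond_Fs_def)
  define k where "k = max K 1"
  define \<kappa> where "\<kappa> = m_exp lu - \<nu>"
  have k: "k \<ge> 1" "K \<le> k" and \<kappa>: "\<kappa> > 0" using \<nu> by (auto simp: k_def \<kappa>_def)
  \<comment> \<open>below \<open>r0\<close> the scaled variable stays in \<open>[0, 1]\<close>, where its derivative bound is available\<close>
  define r0 where "r0 = k powr (- (1 / \<kappa>))"
  have r0: "0 < r0" "r0 \<le> 1"
    using k \<kappa> by (auto simp: r0_def powr_minus_divide ge_one_powr_ge_zero)
  have near_small: "k * r powr \<kappa> \<le> 1" if "0 < r" "r \<le> r0" for r
  proof -
    have "r powr \<kappa> \<le> r0 powr \<kappa>" using that \<kappa> by (intro powr_mono2) auto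
    also have "\<dots> = 1 / k" using k \<kappa> by (simp only: r0_def powr_powr) (simp add: powr_minus_divide)
    finally show ?thesis using k by (simp add: field_simps)
  qed
  obtain D where D: "D > 0" "\<And>r u v. \<lbrakk>0 < r; r \<le> 1; k * r powr \<kappa> \<le> 1;
        u \<in> {0..k * r powr (- \<nu>)}; v \<in> {0..k * r powr (- \<nu>)}\<rbrakk>
      \<Longrightarrow> \<bar>f u r - f v r\<bar> \<le> D * k powr \<delta> * r powr (\<kappa> * \<delta> - 2) * \<bar>u - v\<bar>"
  proof -
    obtain D where D: "D > 0"
      "\<And>K \<nu> r u v. \<lbrakk>K > 0; 0 < r; r \<le> 1; K * r powr (m_exp lu - \<nu>) \<le> 1;
        u \<in> {0..K * r powr (- \<nu>)}; v \<in> {0..K * r powr (- \<nu>)}\<rbrakk>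
      \<Longrightarrow> \<bar>f u r - f v r\<bar> \<le> D * K powr \<delta> * r powr ((m_exp lu - \<nu>) * \<delta> - 2) * \<bar>u - v\<bar>"
      using cond_Fu_lipschitz_near[OF F0 Fu \<delta>] by blast
    show thesis
      by (rule that[OF D(1)], unfold \<kappa>_def, rule D(2)) (use k in auto)
  qed
  obtain R LR where R: "R \<ge> 1" and LR: "LR \<ge> 0"
    "\<And>r u v. \<lbrakk>r > R; u \<in> {0..k * r powr (- (l / \<delta>))}; v \<in> {0..k * r powr (- (l / \<delta>))}\<rbrakk>
      \<Longrightarrow> \<bar>f u r - f v r\<bar> \<le> LR * \<bar>u - v\<bar>"
  proof (cases "l = 0")
    case True
    then have "\<exists>L. \<forall>r\<ge>1. L-lipschitz_on {0..k} (\<lambda>u. f u r)"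
      using far k unfolding unif_lipschitz_far_def by auto
    then obtain L where L: "\<And>r. r \<ge> 1 \<Longrightarrow> L-lipschitz_on {0..k} (\<lambda>u. f u r)" by blast
    show thesis
    proof (rule that[of 1 L])
      show "L \<ge> 0" using lipschitz_on_nonneg[OF L[of 1]] by simp
      show "\<bar>f u r - f v r\<bar> \<le> L * \<bar>u - v\<bar>"
        if "r > 1" "u \<in> {0..k * r powr (- (l / \<delta>))}" "v \<in> {0..k * r powr (- (l / \<delta>))}" for r u v
        using that True by (intro lipschitz_on_abs_le[OF L]) auto
    qed simp
  next
    case False
    then have "l > 0" "k > 0" using l k by auto
    then obtain R L where R: "R \<ge> 1" "L \<ge> 0"
      "\<And>r u v. \<lbrakk>r \<ge> R; u \<in> {0..k * r powr (- (l / \<delta>))}; v \<in> {0..k * r powr (- (l / \<delta>))}\<rbrakk>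
        \<Longrightarrow> \<bar>f u r - f v r\<bar> \<le> L * \<bar>u - v\<bar>"
      using cond_Fs_lipschitz_far[OF Fs] by blast
    show thesis
      by (rule that[OF R(1,2)], rule R(3)) auto
  qed
  define M where "M = k * r0 powr (- \<nu>)"
  obtain LM where LM: "LM \<ge> 0"
    "\<And>r u v. \<lbrakk>r \<in> {r0..R}; u \<in> {0..M}; v \<in> {0..M}\<rbrakk> \<Longrightarrow> \<bar>f u r - f v r\<bar> \<le> LM * \<bar>u - v\<bar>"
    using cond_F0_lipschitz_compact[OF F0 r0(1), of R M] by blast
  define L where "L = D * k powr \<delta> + LM + LR"
  have Lge: "D * k powr \<delta> \<le> L" "LM \<le> L" "LR \<le> L" "L \<ge> 0" using D LM LR by (auto simp: L_def)
  have pot: "radial_potential \<gamma> r \<ge> 1" if "r > 0" for r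
    using that \<gamma> powr_mono2'[of "\<gamma> - 2" r 1] by (auto simp: radial_potential_def)
  have bound: "\<bar>f u r - f v r\<bar> \<le> L * radial_potential \<gamma> r * \<bar>u - v\<bar>"
    if r: "0 < r" and uv: "0 \<le> u" "0 \<le> v" "u * radial_weight \<nu> (l / \<delta>) r \<le> K" "v * radial_weight \<nu> (l / \<delta>) r \<le> K"
    for r u v
  proof -
    have range1: "w \<le> k * r powr (- \<nu>)" if "w * radial_weight \<nu> (l / \<delta>) r \<le> K" "r \<le> 1" for w
    proof -
      have "w * r powr \<nu> \<le> k" using that k by (simp add: radial_weight_def)
      then show ?thesis using r by (simp add: powr_minus_divide pos_le_divide_eq)
    qed
    have range2: "w \<le> k * r powr (- (l / \<delta>))" if "w * radial_weight \<nu> (l / \<delta>) r \<le> K" "r > 1" for w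
    proof -
      have "w * r powr (l / \<delta>) \<le> k" using that k by (simp add: radial_weight_def)
      then show ?thesis using r by (simp add: powr_minus_divide pos_le_divide_eq)
    qed
    have const: "\<bar>f u r - f v r\<bar> \<le> L * radial_potential \<gamma> r * \<bar>u - v\<bar>"
      if "\<bar>f u r - f v r\<bar> \<le> c * \<bar>u - v\<bar>" "c \<le> L" for c
    proof -
      have "c \<le> L * radial_potential \<gamma> r"
        using that pot[OF r] Lge mult_left_mono[of 1 "radial_potential \<gamma> r" L] by simp
      then show ?thesis
        using that(1) mult_right_mono[of c "L * radial_potential \<gamma> r" "\<bar>u - v\<bar>"] by simp
    qed
    consider "r \<le> r0" | "r0 < r" "r \<le> R" | "R < r" by linarith
    then show ?thesis
    proof cases
      case 1
      have "\<bar>f u r - f v r\<bar> \<le> D * k powr \<delta> * r powr (\<kappa> * \<delta> - 2) * \<bar>u - v\<bar>"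
        using 1 r r0 uv range1 near_small by (intro D) auto
      also have "\<dots> \<le> L * radial_potential \<gamma> r * \<bar>u - v\<bar>"
      proof (intro mult_right_mono mult_mono Lge)
        show "r powr (\<kappa> * \<delta> - 2) \<le> radial_potential \<gamma> r"
          using 1 r r0 \<gamma> by (simp add: radial_potential_def \<kappa>_def powr_mono')
      qed auto
      finally show ?thesis .
    next
      case 2
      have "w \<le> M" if "w * radial_weight \<nu> (l / \<delta>) r \<le> K" for w
      proof (cases "r \<le> 1")
        case True
        then have "w \<le> k * r powr (- \<nu>)" using range1 that by simp
        also have "\<dots> \<le> M"
          unfolding M_def using 2 k r0 \<nu> by (intro mult_left_mono powr_mono2') auto
        finally show ?thesis .
      next
        case False
        then have "w \<le> k * r powr (- (l / \<delta>))" using range2 that by simp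
        also have "\<dots> \<le> k * 1"
          using False k l \<delta> powr_mono2'[of "- (l / \<delta>)" 1 r] by (intro mult_left_mono) auto
        also have "\<dots> \<le> M"
          unfolding M_def using k r0 \<nu> powr_mono2'[of "- \<nu>" r0 1] by (intro mult_left_mono) auto
        finally show ?thesis .
      qed
      then show ?thesis using 2 uv by (intro const[of LM] LM Lge) auto
    next
      case 3
      then show ?thesis using uv range2 R by (intro const[of LR] LR Lge) auto
    qed
  qed
  show ?thesis using bound Lge(4) by blast
qed

section \<open>The weighted space and the potential\<close>

lemma weight_eq_radial: "weight \<nu> l \<delta> x = radial_weight \<nu> (l / \<delta>) (norm x)"
  by (simp add: weight_def radial_weight_def)

lemma radial_weight_pos: "r > 0 \<Longrightarrow> radial_weight \<nu> b r > 0"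
  by (simp add: radial_weight_def)

lemma radial_weight_measurable [measurable]: "radial_weight \<nu> b \<in> borel_measurable borel"
  unfolding radial_weight_def by measurable

lemma radial_potential_measurable [measurable]: "radial_potential \<gamma> \<in> borel_measurable borel"
  unfolding radial_potential_def by measurable

lemma radial_potential_nonneg [simp]: "radial_potential \<gamma> r \<ge> 0"
  by (simp add: radial_potential_def)

text \<open>
  Up to constants, the reciprocal of the weight is \<open>(1 + r) powr (- b) * (1 + r powr (- \<nu>))\<close>, the
  form for which the heat integrals have been estimated; the potential adds \<open>2 - \<gamma>\<close> to the order of
  the singularity at the origin.
\<close>

lemma radial_potential_over_weight_le:
  assumes r: "r > 0" and b: "b \<ge> 0"
  shows "radial_potential \<gamma> r / radial_weight \<nu> b r
    \<le> 2 powr b * ((1 + r) powr (- b) * (1 + r powr (- (\<nu> + 2 - \<gamma>))))"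
proof (cases "r \<le> 1")
  case True
  have "radial_potential \<gamma> r / radial_weight \<nu> b r = r powr (- (\<nu> + 2 - \<gamma>))"
    using True r by (simp add: radial_potential_def radial_weight_def powr_diff [symmetric])
      (simp add: algebra_simps)
  also have "\<dots> \<le> 1 * (1 + r powr (- (\<nu> + 2 - \<gamma>)))" by simp
  also have "\<dots> \<le> (2 powr b * (1 + r) powr (- b)) * (1 + r powr (- (\<nu> + 2 - \<gamma>)))"
  proof (intro mult_right_mono)
    have "(1 + r) powr b \<le> 2 powr b"
      using True r b by (intro powr_mono2) auto
    then show "1 \<le> 2 powr b * (1 + r) powr (- b)"
      using r by (simp add: powr_minus_divide)
  qed (simp add: add_nonneg_nonneg)
  finally show ?thesis by (simp add: mult.assoc)
next
  case False
  have "radial_potential \<gamma> r / radial_weight \<nu> b r = r powr (- b)"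
    using False by (simp add: radial_potential_def radial_weight_def powr_minus_divide)
  also have "\<dots> \<le> 2 powr b * (1 + r) powr (- b)"
  proof -
    have "(1 + r) powr b \<le> (2 * r) powr b"
      using False b by (intro powr_mono2) auto
    also have "\<dots> = 2 powr b * r powr b" using r by (simp add: powr_mult)
    finally show ?thesis
      using r by (simp add: powr_minus_divide divide_simps)
  qed
  also have "\<dots> \<le> 2 powr b * (1 + r) powr (- b) * (1 + r powr (- (\<nu> + 2 - \<gamma>)))"
    using mult_left_mono[of 1 "1 + r powr (- (\<nu> + 2 - \<gamma>))" "2 powr b * (1 + r) powr (- b)"] by simp
  finally show ?thesis by (simp add: mult.assoc)
qed

lemma le_inverse_radial_weight:
  assumes r: "r > 0" and b: "b \<ge> 0" and \<nu>: "\<nu> \<ge> 0"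
  shows "(1 + r) powr (- b) * (1 + r powr (- \<nu>)) \<le> 2 / radial_weight \<nu> b r"
proof (cases "r \<le> 1")
  case True
  have "(1 + r) powr (- b) * (1 + r powr (- \<nu>)) \<le> 1 * (r powr (- \<nu>) + r powr (- \<nu>))"
  proof (intro mult_mono add_mono)
    show "(1 + r) powr (- b) \<le> 1"
      using r b by (simp add: powr_minus_divide ge_one_powr_ge_zero)
    show "1 \<le> r powr (- \<nu>)"
      using r True \<nu> powr_mono2'[of "- \<nu>" r 1] by simp
  qed auto
  then show ?thesis
    using True by (simp add: radial_weight_def powr_minus_divide)
next
  case False
  have "(1 + r) powr (- b) * (1 + r powr (- \<nu>)) \<le> r powr (- b) * (1 + 1)"
  proof (intro mult_mono add_mono)
    show "(1 + r) powr (- b) \<le> r powr (- b)"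
      using r b by (intro powr_mono2') auto
    show "r powr (- \<nu>) \<le> 1"
      using False \<nu> powr_mono2'[of "- \<nu>" 1 r] by simp
  qed auto
  then show ?thesis
    using False by (simp add: radial_weight_def powr_minus_divide)
qed

text \<open>
  The loss \<open>2 - \<gamma>\<close> in the order of the singularity is paid for with half as many powers of time.
\<close>

lemma heat_integral_potential_le:
  assumes b: "b \<ge> 0" and \<nu>: "\<nu> \<ge> 0" and \<gamma>: "\<gamma> \<le> 2" "\<nu> + 2 - \<gamma> < real DIM('a::euclidean_space)" and T: "T > 0"
  shows "\<exists>C\<ge>0. \<forall>t (x::'a). 0 < t \<and> t \<le> T \<and> x \<noteq> 0 \<longrightarrow>
    (\<integral>\<^sup>+ y. ennreal (heat_kernel t (x - y) * (radial_potential \<gamma> (norm y) / radial_weight \<nu> b (norm y))) \<partial>lborel)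
      \<le> ennreal (C * t powr (\<gamma> / 2 - 1) / radial_weight \<nu> b (norm x))"
proof -
  define p where "p = \<nu> + 2 - \<gamma>"
  obtain C where C: "C > 0"
    "\<And>t (x::'a). \<lbrakk>0 < t; t \<le> T; x \<noteq> 0\<rbrakk> \<Longrightarrow>
      (\<integral>\<^sup>+ y. ennreal (heat_kernel t (x - y) * ((1 + norm y) powr (- b) * (1 + norm y powr (- p)))) \<partial>lborel)
        \<le> ennreal (C * t powr (- ((p - \<nu>) / 2)) * ((1 + norm x) powr (- b) * (1 + norm x powr (- \<nu>))))"
    using heat_integral_weight_le[of \<nu> p b T] assms unfolding p_def by auto
  have "(\<integral>\<^sup>+ y. ennreal (heat_kernel t (x - y) * (radial_potential \<gamma> (norm y) / radial_weight \<nu> b (norm y))) \<partial>lborel)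
      \<le> ennreal (2 powr b * C * 2 * t powr (\<gamma> / 2 - 1) / radial_weight \<nu> b (norm x))"
    if t: "0 < t" "t \<le> T" and x: "x \<noteq> 0" for t and x :: 'a
  proof -
    let ?w = "radial_weight \<nu> b (norm x)"
    have w: "?w > 0" using x by (intro radial_weight_pos) simp
    have "(\<integral>\<^sup>+ y. ennreal (heat_kernel t (x - y) * (radial_potential \<gamma> (norm y) / radial_weight \<nu> b (norm y))) \<partial>lborel)
        \<le> (\<integral>\<^sup>+ y. ennreal (2 powr b) *
            ennreal (heat_kernel t (x - y) * ((1 + norm y) powr (- b) * (1 + norm y powr (- p)))) \<partial>lborel)"
    proof (rule nn_integral_mono_AE, rule eventually_mono[OF AE_lborel_singleton[of "0::'a"]])
      fix y :: 'a assume "y \<noteq> 0"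
      then have "heat_kernel t (x - y) * (radial_potential \<gamma> (norm y) / radial_weight \<nu> b (norm y))
          \<le> heat_kernel t (x - y) * (2 powr b * ((1 + norm y) powr (- b) * (1 + norm y powr (- p))))"
        unfolding p_def using b by (intro mult_left_mono radial_potential_over_weight_le) auto
      then show "ennreal (heat_kernel t (x - y) * (radial_potential \<gamma> (norm y) / radial_weight \<nu> b (norm y)))
          \<le> ennreal (2 powr b) * ennreal (heat_kernel t (x - y) * ((1 + norm y) powr (- b) * (1 + norm y powr (- p))))"
        by (subst ennreal_mult' [symmetric]) (auto intro!: ennreal_leI simp: mult_ac)
    qed
    also have "\<dots> = ennreal (2 powr b) *
        (\<integral>\<^sup>+ y. ennreal (heat_kernel t (x - y) * ((1 + norm y) powr (- b) * (1 + norm y powr (- p)))) \<partial>lborel)"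
      by (rule nn_integral_cmult) measurable
    also have "\<dots> \<le> ennreal (2 powr b) * ennreal (C * t powr (- ((p - \<nu>) / 2)) * (2 / ?w))"
    proof (intro mult_left_mono order_trans[OF C(2)[OF t x]] ennreal_leI)
      show "(1 + norm x) powr (- b) * (1 + norm x powr (- \<nu>)) \<le> 2 / ?w"
        using x b \<nu> by (intro le_inverse_radial_weight) auto
    qed (use C in auto)
    also have "\<dots> = ennreal (2 powr b * (C * t powr (- ((p - \<nu>) / 2)) * (2 / ?w)))"
      by (subst ennreal_mult') auto
    also have "- ((p - \<nu>) / 2) = \<gamma> / 2 - 1" by (simp add: p_def field_simps)
    also have "2 powr b * (C * t powr (\<gamma> / 2 - 1) * (2 / ?w)) = 2 powr b * C * 2 * t powr (\<gamma> / 2 - 1) / ?w"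
      by simp
    finally show ?thesis .
  qed
  then show ?thesis
    using C(1) by (intro exI[of _ "2 powr b * C * 2"]) auto
qed

text \<open>
  At \<open>y = 0\<close>, where \<open>f\<close> is unconstrained, the value is set to \<open>0\<close> to make the map Borel.
\<close>

definition source :: "(real \<Rightarrow> real \<Rightarrow> real) \<Rightarrow> real \<Rightarrow> 'a::euclidean_space \<Rightarrow> real" where
  "source f u y = (if y = 0 then 0 else f_ext f u (norm y))"

lemma source_measurable:
  assumes "cond_F0 f"
  shows "case_prod (source f) \<in> borel_measurable (borel \<Otimes>\<^sub>M (borel :: 'a::euclidean_space measure))"
proof -
  let ?A = "{z::real \<times> 'a. snd z \<noteq> 0}"
  have "continuous_on ?A ((\<lambda>(u, r). f u r) \<circ> (\<lambda>z. (max (fst z) 0, norm (snd z))))"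
    using assms unfolding cond_F0_def
    by (intro continuous_on_compose continuous_intros
        continuous_on_subset[OF loc_lipschitz_continuous_on[of "{0..} \<times> {0<..}"]]) auto
  moreover have "?A \<in> sets borel"
    by (intro borel_open open_Collect_neq continuous_intros)
  ultimately have "(\<lambda>z. indicator ?A z *\<^sub>R ((\<lambda>(u, r). f u r) \<circ> (\<lambda>z. (max (fst z) 0, norm (snd z)))) z)
      \<in> borel_measurable borel"
    by (rule borel_measurable_continuous_on_indicator[rotated])
  also have "(\<lambda>z. indicator ?A z *\<^sub>R ((\<lambda>(u, r). f u r) \<circ> (\<lambda>z. (max (fst z) 0, norm (snd z)))) z)
      = case_prod (source f)"
    by (auto simp: fun_eq_iff source_def f_ext_def indicator_def)
  finally show ?thesis by (simp add: borel_prod)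
qed

lemma source_continuous:
  assumes "cond_F0 f"
  shows "continuous_on UNIV (\<lambda>u. source f u (y::'a::euclidean_space))"
proof (cases "y = 0")
  case False
  have "continuous_on UNIV ((\<lambda>(u, r). f u r) \<circ> (\<lambda>u. (max u 0, norm y)))"
    using assms False unfolding cond_F0_def
    by (intro continuous_on_compose continuous_intros
        continuous_on_subset[OF loc_lipschitz_continuous_on[of "{0..} \<times> {0<..}"]]) auto
  then show ?thesis using False by (simp add: source_def f_ext_def o_def)
qed (simp add: source_def)

text \<open>
  The critical exponent \<open>two_lower_star n\<close> is the one for which \<open>m_exp\<close> equals \<open>n - 2\<close>.
\<close>

lemma m_exp_less_dim:
  assumes "n > 2" "lu > two_lower_star n"
  shows "m_exp lu < real n - 2"
proof -
  have n: "real n - 2 > 0" using assms by simp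
  have "two_lower_star n = 2 + 2 / (real n - 2)"
    using n by (simp add: two_lower_star_def field_simps)
  then have l: "lu - 2 > 2 / (real n - 2)" using assms by simp
  moreover have "2 / (real n - 2) > 0" using n by simp
  ultimately have pos: "lu - 2 > 0" by linarith
  then show "m_exp lu < real n - 2"
    using l n pos by (simp add: m_exp_def field_simps)
qed

lemma weighted_heat_problem_intro:
  fixes f :: "real \<Rightarrow> real \<Rightarrow> real" and lu \<delta> l \<nu> :: real and \<phi> :: "'a::euclidean_space \<Rightarrow> real"
  assumes dim: "DIM('a) > 2" and F0: "cond_F0 f" and Fu: "cond_Fu DIM('a) f lu \<delta>" and Fs: "cond_Fs f l \<delta>"
    and far: "l = 0 \<longrightarrow> unif_lipschitz_far f" and \<nu>: "0 \<le> \<nu>" "\<nu> < m_exp lu"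
    and \<phi>: "\<phi> \<in> borel_measurable borel" "A0 \<ge> 0" "\<And>y. \<bar>\<phi> y\<bar> * weight \<nu> l \<delta> y \<le> A0"
    and \<gamma>: "\<gamma> = min 1 ((m_exp lu - \<nu>) * \<delta>)"
  shows "weighted_heat_problem (source f) (weight \<nu> l \<delta>) (\<lambda>y. radial_potential \<gamma> (norm y)) (\<gamma> / 2) \<phi> A0"
proof -
  have \<delta>: "\<delta> > 0" and l: "l \<ge> 0" using Fs by (auto simp: cond_Fs_def)
  have b: "l / \<delta> \<ge> 0" using l \<delta> by simp
  have \<gamma>_pos: "\<gamma> > 0" using \<delta> \<nu> by (simp add: \<gamma>)
  have \<gamma>_le: "\<gamma> \<le> (m_exp lu - \<nu>) * \<delta>" "\<gamma> \<le> 2" by (simp_all add: \<gamma>)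
  have "lu > two_lower_star DIM('a)" using Fu by (simp add: cond_Fu_def cond_Gu_def)
  then have m: "m_exp lu < real DIM('a) - 2" using m_exp_less_dim dim by blast
  have w: "weight \<nu> l \<delta> = (\<lambda>y::'a. radial_weight \<nu> (l / \<delta>) (norm y))"
    by (simp add: fun_eq_iff weight_eq_radial)
  show ?thesis
  proof
    show "case_prod (source f) \<in> borel_measurable (borel \<Otimes>\<^sub>M (borel :: 'a measure))"
      by (rule source_measurable[OF F0])
    show "source f u y \<le> source f v y" if "u \<le> v" for u v and y :: 'a
      using that cond_F0_mono[OF F0, of "norm y" "max u 0" "max v 0"]
      by (auto simp: source_def f_ext_def)
    show "source f u y = 0" if "u \<le> 0" for u and y :: 'a
      using that F0 by (simp add: source_def f_ext_def max_def cond_F0_def)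
    show "continuous_on UNIV (\<lambda>u. source f u y)" for y :: 'a
      by (rule source_continuous[OF F0])
    show "\<exists>L\<ge>0. \<forall>(y::'a) u v. y \<noteq> 0 \<and> \<bar>u\<bar> * weight \<nu> l \<delta> y \<le> K \<and> \<bar>v\<bar> * weight \<nu> l \<delta> y \<le> K \<longrightarrow>
        \<bar>source f u y - source f v y\<bar> \<le> L * radial_potential \<gamma> (norm y) * \<bar>u - v\<bar>" for K
    proof -
      obtain L where L: "L \<ge> 0" "\<forall>r u v. 0 < r \<and> 0 \<le> u \<and> 0 \<le> v \<and>
          u * radial_weight \<nu> (l / \<delta>) r \<le> K \<and> v * radial_weight \<nu> (l / \<delta>) r \<le> K \<longrightarrow>
          \<bar>f u r - f v r\<bar> \<le> L * radial_potential \<gamma> r * \<bar>u - v\<bar>"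
        using nonlinearity_lipschitz_weighted[OF F0 Fu Fs far \<nu> \<gamma>_le, of K] by blast
      have "\<bar>source f u y - source f v y\<bar> \<le> L * radial_potential \<gamma> (norm y) * \<bar>u - v\<bar>"
        if y: "y \<noteq> 0" and uv: "\<bar>u\<bar> * weight \<nu> l \<delta> y \<le> K" "\<bar>v\<bar> * weight \<nu> l \<delta> y \<le> K" for y :: 'a and u v
      proof -
        have wp: "weight \<nu> l \<delta> y > 0" unfolding w using y by (simp add: radial_weight_pos)
        have "max c 0 * weight \<nu> l \<delta> y \<le> K" if "\<bar>c\<bar> * weight \<nu> l \<delta> y \<le> K" for c
          by (rule order_trans[OF mult_right_mono that]) (use wp in auto)
        from this[OF uv(1)] this[OF uv(2)]
        have "\<bar>f (max u 0) (norm y) - f (max v 0) (norm y)\<bar> \<le> L * radial_potential \<gamma> (norm y) * \<bar>max u 0 - max v 0\<bar>"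
          using L(2) y unfolding w by auto
        also have "\<dots> \<le> L * radial_potential \<gamma> (norm y) * \<bar>u - v\<bar>"
          using L(1) by (intro mult_left_mono) auto
        finally show ?thesis using y by (simp add: source_def f_ext_def)
      qed
      then show ?thesis using L(1) by blast
    qed
    show "weight \<nu> l \<delta> \<in> borel_measurable (borel :: 'a measure)"
      unfolding w by measurable
    show "weight \<nu> l \<delta> y > 0" if "y \<noteq> 0" for y :: 'a
      unfolding w using that by (simp add: radial_weight_pos)
    show "(\<lambda>y::'a. radial_potential \<gamma> (norm y)) \<in> borel_measurable borel"
      by measurable
    show "\<exists>C\<ge>0. \<forall>t (x::'a). 0 < t \<and> t \<le> T \<and> x \<noteq> 0 \<longrightarrow>
        (\<integral>\<^sup>+ y. ennreal (heat_kernel t (x - y) * (1 / weight \<nu> l \<delta> y)) \<partial>lborel)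
          \<le> ennreal (C / weight \<nu> l \<delta> x)" if T: "T > 0" for T
    proof -
      \<comment> \<open>\<open>\<gamma> = 2\<close> makes the potential constant away from the origin\<close>
      obtain C where C: "C \<ge> 0" "\<And>t (x::'a). \<lbrakk>0 < t; t \<le> T; x \<noteq> 0\<rbrakk> \<Longrightarrow>
          (\<integral>\<^sup>+ y. ennreal (heat_kernel t (x - y) * (radial_potential 2 (norm y) / weight \<nu> l \<delta> y)) \<partial>lborel)
            \<le> ennreal (C * t powr (2 / 2 - 1) / weight \<nu> l \<delta> x)"
        using heat_integral_potential_le[OF b \<nu>(1) order_refl _ T, where 'a = 'a] m \<nu> unfolding w by auto
      have "(\<integral>\<^sup>+ y. ennreal (heat_kernel t (x - y) * (1 / weight \<nu> l \<delta> y)) \<partial>lborel)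
          \<le> ennreal (C / weight \<nu> l \<delta> x)" if t: "0 < t" "t \<le> T" and x: "x \<noteq> 0" for t and x :: 'a
      proof -
        have "(\<integral>\<^sup>+ y. ennreal (heat_kernel t (x - y) * (1 / weight \<nu> l \<delta> y)) \<partial>lborel)
            = (\<integral>\<^sup>+ y. ennreal (heat_kernel t (x - y) * (radial_potential 2 (norm y) / weight \<nu> l \<delta> y)) \<partial>lborel)"
          by (intro nn_integral_cong_AE eventually_mono[OF AE_lborel_singleton[of "0::'a"]])
             (simp add: radial_potential_def)
        then show ?thesis using C(2)[OF t x] t by simp
      qed
      then show ?thesis using C(1) by blast
    qed
    show "\<exists>C\<ge>0. \<forall>t (x::'a). 0 < t \<and> t \<le> T \<and> x \<noteq> 0 \<longrightarrow>
        (\<integral>\<^sup>+ y. ennreal (heat_kernel t (x - y) * (radial_potential \<gamma> (norm y) / weight \<nu> l \<delta> y)) \<partial>lborel)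
          \<le> ennreal (C * t powr (\<gamma> / 2 - 1) / weight \<nu> l \<delta> x)" if T: "T > 0" for T
      unfolding w using m \<nu> \<gamma>_pos T b by (intro heat_integral_potential_le) (auto simp: \<gamma>)
  qed (use \<phi> \<gamma>_pos in auto)
qed

lemma lebesgue_measurable_AE_eq:
  fixes f g :: "'a::euclidean_space \<Rightarrow> real"
  assumes g: "g \<in> borel_measurable borel" and ae: "AE x in lborel. f x = g x"
  shows "f \<in> borel_measurable lebesgue"
proof (rule measurableI)
  fix A :: "real set" assume A: "A \<in> sets borel"
  have "g -` A \<in> sets lebesgue"
    using measurable_sets_borel[OF g A] by (metis in_borel_measurable_borel lborelD sets_completionI_sets)
  moreover have "AE x in lebesgue. x \<in> g -` A \<longleftrightarrow> x \<in> f -` A"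
    using ae by (intro AE_completion) (auto elim!: eventually_mono)
  ultimately show "f -` A \<inter> space lebesgue \<in> sets lebesgue"
    using completion.in_sets_AE[of "g -` A" "f -` A" lborel] by simp
qed simp

lemma lebesgue_integral_AE_eq:
  fixes f g :: "'a::euclidean_space \<Rightarrow> real"
  assumes g: "g \<in> borel_measurable borel" and ae: "AE x in lborel. f x = g x"
  shows "integral\<^sup>L lebesgue f = integral\<^sup>L lborel g" "integrable lebesgue f \<longleftrightarrow> integrable lborel g"
proof -
  have m: "f \<in> borel_measurable lebesgue" "g \<in> borel_measurable lebesgue" "g \<in> borel_measurable lborel"
    using lebesgue_measurable_AE_eq[OF g ae] g by (auto intro: measurable_completion)
  have "integral\<^sup>L lebesgue f = integral\<^sup>L lebesgue g"
    using m AE_completion[OF ae] by (intro integral_cong_AE) auto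
  then show "integral\<^sup>L lebesgue f = integral\<^sup>L lborel g"
    using m by (simp add: integral_completion)
  have "integrable lebesgue f \<longleftrightarrow> integrable lebesgue g"
    using m AE_completion[OF ae] by (intro integrable_cong_AE) auto
  then show "integrable lebesgue f \<longleftrightarrow> integrable lborel g"
    using m by (simp add: integrable_completion)
qed

section \<open>From Borel to Lebesgue measurable functions\<close>

lemma source_nonneg:
  assumes "cond_F0 f"
  shows "source f u y \<ge> 0"
  using cond_F0_mono[OF assms, of "norm y" 0 "max u 0"] assms
  by (auto simp: source_def f_ext_def cond_F0_def)

lemma AE_snd_nonzero: "AE z in lborel \<Otimes>\<^sub>M lborel. snd z \<noteq> (0::'a::euclidean_space)"
proof (rule lborel_pair.AE_pair_measure)
  show "{z \<in> space (lborel \<Otimes>\<^sub>M lborel). snd z \<noteq> (0::'a)} \<in> sets (lborel \<Otimes>\<^sub>M lborel)"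
    by measurable
qed (simp add: AE_lborel_singleton)

lemma AE_fst_nonzero: "AE z in lborel \<Otimes>\<^sub>M (lborel :: 'a::euclidean_space measure). fst z \<noteq> (0::real)"
proof (rule lborel_pair.AE_pair_measure)
  show "{z \<in> space (lborel \<Otimes>\<^sub>M (lborel :: 'a measure)). fst z \<noteq> (0::real)} \<in> sets (lborel \<Otimes>\<^sub>M lborel)"
    by measurable
qed (rule eventually_mono[OF AE_lborel_singleton[of "0::real"]], simp)

lemma AE_lebesgue_on_slab:
  fixes T :: real
  shows "(AE z in lebesgue_on ({0..T} \<times> (UNIV :: 'a::euclidean_space set)). P z)
    \<longleftrightarrow> (AE z in lborel \<Otimes>\<^sub>M lborel. fst z \<in> {0..T} \<longrightarrow> P z)"
proof -
  have "{0..T} \<times> (UNIV :: 'a set) \<in> sets borel"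
    by (intro borel_closed closed_Times) auto
  then have "{0..T} \<times> (UNIV :: 'a set) \<inter> space lebesgue \<in> sets lebesgue"
    by (auto intro: sets_completionI_sets)
  then have "(AE z in lebesgue_on ({0..T} \<times> (UNIV :: 'a set)). P z)
      \<longleftrightarrow> (AE z in lebesgue. z \<in> {0..T} \<times> UNIV \<longrightarrow> P z)"
    by (rule AE_restrict_space_iff)
  also have "\<dots> \<longleftrightarrow> (AE z in lborel. fst z \<in> {0..T} \<longrightarrow> P z)"
    unfolding AE_completion_iff by (simp add: mem_Times_iff)
  finally show ?thesis unfolding lborel_prod .
qed

text \<open>
  For a finite Duhamel integral, all Bochner integrals in \<open>F_op\<close> converge and agree with
  those in \<open>[0, \<infinity>]\<close>. Changing \<open>v\<close> on a null set of space-time changes almost every time slice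
  only on a null set of space, so \<open>F_op\<close> is unchanged at every point.
\<close>

lemma F_op_eq_duhamel:
  fixes v v' :: "real \<Rightarrow> 'a::euclidean_space \<Rightarrow> real"
  assumes F0: "cond_F0 f" and [measurable]: "case_prod v' \<in> borel_measurable (borel \<Otimes>\<^sub>M borel)"
    and ae: "AE z in lborel \<Otimes>\<^sub>M lborel. fst z \<in> {0..T} \<longrightarrow> v (fst z) (snd z) = v' (fst z) (snd z)"
    and t: "t \<le> T" and fin: "duhamel 0 (\<lambda>s y. ennreal (source f (v' s y) y)) t x < \<top>"
  shows "F_op f \<phi> v t x = heat_semigroup t \<phi> x + enn2real (duhamel 0 (\<lambda>s y. ennreal (source f (v' s y) y)) t x)"
    and "set_integrable lebesgue ({0..t} \<times> UNIV)
       (\<lambda>(s, y). heat_kernel (t - s) (x - y) * f_ext f (v s y) (norm y))"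
proof -
  note source_measurable[OF F0, measurable]
  define q where "q s y = source f (v' s y) y" for s and y :: 'a
  have [measurable]: "case_prod q \<in> borel_measurable (borel \<Otimes>\<^sub>M borel)"
    unfolding q_def by measurable
  have q0: "q s y \<ge> 0" for s y by (simp add: q_def source_nonneg[OF F0])
  define H where "H s = (\<integral>\<^sup>+ y. indicator {0..t} s * (ennreal (heat_kernel (t - s) (x - y)) * ennreal (q s y)) \<partial>lborel)" for s
  have [measurable]: "H \<in> borel_measurable borel" unfolding H_def by measurable
  have dH: "duhamel 0 (\<lambda>s y. ennreal (source f (v' s y) y)) t x = (\<integral>\<^sup>+ s. H s \<partial>lborel)"
    by (simp add: duhamel_def H_def q_def)
  have ae2: "AE s in lborel. AE y in lborel. s \<in> {0..T} \<longrightarrow> v s y = v' s y"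
    using lborel_pair.AE_pair[OF ae] by simp
  have inner: "AE s in lborel. indicator {0..t} s *\<^sub>R heat_semigroup (t - s) (\<lambda>y. f_ext f (v s y) (norm y)) x = enn2real (H s)"
    using ae2 AE_lborel_singleton[of t]
  proof eventually_elim
    fix s assume s: "AE y in lborel. s \<in> {0..T} \<longrightarrow> v s y = v' s y" "s \<noteq> t"
    show "indicator {0..t} s *\<^sub>R heat_semigroup (t - s) (\<lambda>y. f_ext f (v s y) (norm y)) x = enn2real (H s)"
    proof (cases "s \<in> {0..t}")
      case True
      have "heat_semigroup (t - s) (\<lambda>y. f_ext f (v s y) (norm y)) x
          = (LINT y|lebesgue. heat_kernel (t - s) (x - y) * f_ext f (v s y) (norm y))"
        using s by (simp add: heat_semigroup_def)
      also have "\<dots> = (LINT y|lborel. heat_kernel (t - s) (x - y) * q s y)"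
      proof (rule lebesgue_integral_AE_eq)
        show "AE y in lborel. heat_kernel (t - s) (x - y) * f_ext f (v s y) (norm y) = heat_kernel (t - s) (x - y) * q s y"
          using s(1) AE_lborel_singleton[of "0::'a"]
          by eventually_elim (use True t in \<open>auto simp: q_def source_def\<close>)
      qed measurable
      also have "\<dots> = enn2real (\<integral>\<^sup>+ y. ennreal (heat_kernel (t - s) (x - y) * q s y) \<partial>lborel)"
        using q0 by (intro integral_eq_nn_integral) auto
      also have "\<dots> = enn2real (H s)"
        using True q0 by (simp add: H_def ennreal_mult)
      finally show ?thesis using True by simp
    qed (simp add: H_def)
  qed
  have "(LINT s:{0..t}|lebesgue. heat_semigroup (t - s) (\<lambda>y. f_ext f (v s y) (norm y)) x)
      = (LINT s|lborel. enn2real (H s))"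
    unfolding set_lebesgue_integral_def using inner by (intro lebesgue_integral_AE_eq(1)) auto
  also have "\<dots> = enn2real (\<integral>\<^sup>+ s. ennreal (enn2real (H s)) \<partial>lborel)"
    by (intro integral_eq_nn_integral) auto
  also have "(\<integral>\<^sup>+ s. ennreal (enn2real (H s)) \<partial>lborel) = (\<integral>\<^sup>+ s. H s \<partial>lborel)"
  proof (rule nn_integral_cong_AE)
    have "AE s in lborel. H s \<noteq> \<infinity>"
      using fin unfolding dH by (intro nn_integral_PInf_AE) auto
    then show "AE s in lborel. ennreal (enn2real (H s)) = H s"
      by eventually_elim (simp add: less_top)
  qed
  finally show "F_op f \<phi> v t x = heat_semigroup t \<phi> x + enn2real (duhamel 0 (\<lambda>s y. ennreal (source f (v' s y) y)) t x)"
    unfolding F_op_def dH by simp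
  have slab: "{0..t} \<times> (UNIV :: 'a set) \<in> sets (borel \<Otimes>\<^sub>M borel)"
    by simp
  define k where "k z = indicator ({0..t} \<times> UNIV) z * (heat_kernel (t - fst z) (x - snd z) * q (fst z) (snd z))" for z
  have [measurable]: "k \<in> borel_measurable (borel \<Otimes>\<^sub>M borel)"
    unfolding k_def by (intro borel_measurable_times borel_measurable_indicator slab) measurable
  have "(\<integral>\<^sup>+ z. ennreal (norm (k z)) \<partial>(lborel \<Otimes>\<^sub>M lborel)) = (\<integral>\<^sup>+ s. \<integral>\<^sup>+ y. ennreal (norm (k (s, y))) \<partial>lborel \<partial>lborel)"
    by (subst lborel.nn_integral_fst) auto
  also have "\<dots> = (\<integral>\<^sup>+ s. H s \<partial>lborel)"
    unfolding H_def k_def using q0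
    by (intro nn_integral_cong) (auto simp: indicator_def ennreal_mult)
  finally have "integrable (lborel \<Otimes>\<^sub>M lborel) k"
    using fin unfolding dH by (intro integrableI_bounded) auto
  then have "integrable lborel k" by (simp add: lborel_prod)
  moreover have "AE z in lborel. indicator ({0..t} \<times> UNIV) z *\<^sub>R
      (case z of (s, y) \<Rightarrow> heat_kernel (t - s) (x - y) * f_ext f (v s y) (norm y)) = k z"
    unfolding lborel_prod [symmetric] using ae AE_snd_nonzero
    by eventually_elim (use t in \<open>auto simp: k_def q_def source_def indicator_def\<close>)
  moreover have "k \<in> borel_measurable borel"
    using \<open>k \<in> borel_measurable (borel \<Otimes>\<^sub>M borel)\<close> by (simp add: borel_prod)
  ultimately show "set_integrable lebesgue ({0..t} \<times> UNIV)
       (\<lambda>(s, y). heat_kernel (t - s) (x - y) * f_ext f (v s y) (norm y))"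
    unfolding set_integrable_def by (subst lebesgue_integral_AE_eq(2))
qed

lemma weight_measurable [measurable]: "weight \<nu> l \<delta> \<in> borel_measurable (borel :: 'a::euclidean_space measure)"
proof -
  have "weight \<nu> l \<delta> = (\<lambda>y::'a. radial_weight \<nu> (l / \<delta>) (norm y))"
    by (simp add: fun_eq_iff weight_eq_radial)
  then show ?thesis by simp
qed

lemma weight_nonneg [simp]: "weight \<nu> l \<delta> x \<ge> 0"
  by (simp add: weight_def)

lemma X_norm_leD:
  fixes \<psi> :: "'a::euclidean_space \<Rightarrow> real"
  assumes "X_norm \<nu> l \<delta> \<psi> \<le> ereal c"
  shows "AE x in lborel. \<bar>\<psi> x\<bar> * weight \<nu> l \<delta> x \<le> c"
proof -
  have "AE x in lebesgue. ereal \<bar>\<psi> x * weight \<nu> l \<delta> x\<bar> \<le> X_norm \<nu> l \<delta> \<psi>"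
    unfolding X_norm_def by (rule esssup_AE)
  then have "AE x in lborel. ereal \<bar>\<psi> x * weight \<nu> l \<delta> x\<bar> \<le> X_norm \<nu> l \<delta> \<psi>"
    unfolding AE_completion_iff .
  then show ?thesis
  proof eventually_elim
    fix x :: 'a assume "ereal \<bar>\<psi> x * weight \<nu> l \<delta> x\<bar> \<le> X_norm \<nu> l \<delta> \<psi>"
    then have "ereal \<bar>\<psi> x * weight \<nu> l \<delta> x\<bar> \<le> ereal c"
      using assms by (rule order_trans)
    then show "\<bar>\<psi> x\<bar> * weight \<nu> l \<delta> x \<le> c" by (simp add: abs_mult)
  qed
qed

lemma X_norm_leI:
  fixes \<psi> :: "'a::euclidean_space \<Rightarrow> real"
  assumes "\<psi> \<in> borel_measurable lebesgue" "AE x in lborel. \<bar>\<psi> x\<bar> * weight \<nu> l \<delta> x \<le> c"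
  shows "X_norm \<nu> l \<delta> \<psi> \<le> ereal c"
  unfolding X_norm_def
proof (rule esssup_I)
  have "weight \<nu> l \<delta> \<in> borel_measurable (lebesgue :: 'a measure)"
    by (intro measurable_completion) simp
  then show "(\<lambda>x. ereal \<bar>\<psi> x * weight \<nu> l \<delta> x\<bar>) \<in> borel_measurable lebesgue"
    using assms(1) by measurable
  show "AE x in lebesgue. ereal \<bar>\<psi> x * weight \<nu> l \<delta> x\<bar> \<le> ereal c"
    unfolding AE_completion_iff using assms(2) by eventually_elim (simp add: abs_mult)
qed

lemma X_space_borel_representative:
  fixes \<phi> :: "'a::euclidean_space \<Rightarrow> real"
  assumes "\<phi> \<in> X_space \<nu> l \<delta>"
  obtains \<phi>' A where "\<phi>' \<in> borel_measurable borel" "AE x in lborel. \<phi> x = \<phi>' x" "A \<ge> 0"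
    "\<And>x. \<bar>\<phi>' x\<bar> * weight \<nu> l \<delta> x \<le> A"
proof -
  have m: "\<phi> \<in> borel_measurable lebesgue" and "X_norm \<nu> l \<delta> \<phi> < \<infinity>"
    using assms by (auto simp: X_space_def)
  then obtain a where "X_norm \<nu> l \<delta> \<phi> \<le> ereal a"
    using less_PInf_Ex_of_nat[of "X_norm \<nu> l \<delta> \<phi>"] by (auto intro: less_imp_le)
  then have "X_norm \<nu> l \<delta> \<phi> \<le> ereal (max a 0)"
    by (rule order_trans) simp
  from X_norm_leD[OF this] have b: "AE x in lborel. \<bar>\<phi> x\<bar> * weight \<nu> l \<delta> x \<le> max a 0" .
  obtain g where g: "g \<in> borel_measurable lborel" "AE x in lborel. \<phi> x = g x"
    using completion_ex_borel_measurable_real[OF m] by blast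
  have [measurable]: "g \<in> borel_measurable borel" using g(1) by simp
  show thesis
  proof
    show "(\<lambda>x. if \<bar>g x\<bar> * weight \<nu> l \<delta> x \<le> max a 0 then g x else 0) \<in> borel_measurable borel"
      by measurable
    show "AE x in lborel. \<phi> x = (if \<bar>g x\<bar> * weight \<nu> l \<delta> x \<le> max a 0 then g x else 0)"
      using g(2) b by eventually_elim simp
    show "\<bar>if \<bar>g x\<bar> * weight \<nu> l \<delta> x \<le> max a 0 then g x else 0\<bar> * weight \<nu> l \<delta> x \<le> max a 0" for x
      by simp
  qed simp
qed

text \<open>
  Cutting off large values gives a representative that satisfies the norm bound at every point.
\<close>

lemma X_ball_borel_representative:
  fixes v :: "real \<Rightarrow> 'a::euclidean_space \<Rightarrow> real"
  assumes v: "v \<in> X_ball \<nu> l \<delta> T \<rho> \<phi>" and \<phi>: "AE x in lborel. \<bar>\<phi> x\<bar> * weight \<nu> l \<delta> x \<le> A"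
    and R: "\<rho> + A \<le> R" "R \<ge> 0"
  obtains v' where "case_prod v' \<in> borel_measurable (borel \<Otimes>\<^sub>M borel)"
    "AE z in lborel \<Otimes>\<^sub>M lborel. fst z \<in> {0..T} \<longrightarrow> v (fst z) (snd z) = v' (fst z) (snd z)"
    "\<And>t x. \<bar>v' t x\<bar> * weight \<nu> l \<delta> x \<le> R"
proof -
  let ?S = "{0..T} \<times> (UNIV :: 'a set)"
  have S: "?S \<in> sets lebesgue"
    by (intro sets_completionI_sets) (simp add: borel_closed closed_Times)
  have "case_prod v \<in> borel_measurable (lebesgue_on ?S)"
    using v by (simp add: X_ball_def)
  then have "(\<lambda>z. indicator ?S z *\<^sub>R case_prod v z) \<in> borel_measurable lebesgue"
    using S by (subst (asm) borel_measurable_restrict_space_iff) auto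
  then obtain g where g: "g \<in> borel_measurable lborel" "AE z in lborel. indicator ?S z *\<^sub>R case_prod v z = g z"
    using completion_ex_borel_measurable_real by blast
  have [measurable]: "g \<in> borel_measurable (borel \<Otimes>\<^sub>M borel)" using g(1) by (simp add: borel_prod)
  have vg: "AE z in lborel \<Otimes>\<^sub>M lborel. fst z \<in> {0..T} \<longrightarrow> v (fst z) (snd z) = g z"
    using g(2) unfolding lborel_prod [symmetric]
    by eventually_elim (auto simp: indicator_def mem_Times_iff case_prod_beta)
  have "AE t in lebesgue. t \<in> {0..T} \<longrightarrow> X_norm \<nu> l \<delta> (\<lambda>x. v t x - \<phi> x) \<le> ereal \<rho>"
    using v by (simp add: X_ball_def AE_restrict_space_iff)
  then have Xv: "AE t in lborel. t \<in> {0..T} \<longrightarrow> X_norm \<nu> l \<delta> (\<lambda>x. v t x - \<phi> x) \<le> ereal \<rho>"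
    unfolding AE_completion_iff .
  have bound: "AE z in lborel \<Otimes>\<^sub>M lborel. fst z \<in> {0..T} \<longrightarrow> \<bar>g z\<bar> * weight \<nu> l \<delta> (snd z) \<le> R"
  proof (rule lborel_pair.AE_pair_measure)
    show "{z \<in> space (lborel \<Otimes>\<^sub>M lborel). fst z \<in> {0..T} \<longrightarrow> \<bar>g z\<bar> * weight \<nu> l \<delta> (snd z) \<le> R}
        \<in> sets (lborel \<Otimes>\<^sub>M lborel)"
      by measurable
    show "AE t in lborel. AE x in lborel. fst (t, x) \<in> {0..T} \<longrightarrow> \<bar>g (t, x)\<bar> * weight \<nu> l \<delta> (snd (t, x)) \<le> R"
      using lborel_pair.AE_pair[OF vg] Xv
    proof eventually_elim
      fix t assume t: "AE x in lborel. fst (t, x) \<in> {0..T} \<longrightarrow> v (fst (t, x)) (snd (t, x)) = g (t, x)"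
        "t \<in> {0..T} \<longrightarrow> X_norm \<nu> l \<delta> (\<lambda>x. v t x - \<phi> x) \<le> ereal \<rho>"
      show "AE x in lborel. fst (t, x) \<in> {0..T} \<longrightarrow> \<bar>g (t, x)\<bar> * weight \<nu> l \<delta> (snd (t, x)) \<le> R"
      proof (cases "t \<in> {0..T}")
        case True
        with t have "AE x in lborel. \<bar>v t x - \<phi> x\<bar> * weight \<nu> l \<delta> x \<le> \<rho>" by (intro X_norm_leD) simp
        then show ?thesis
          using t(1) \<phi>
        proof eventually_elim
          fix x assume x: "\<bar>v t x - \<phi> x\<bar> * weight \<nu> l \<delta> x \<le> \<rho>"
            "fst (t, x) \<in> {0..T} \<longrightarrow> v (fst (t, x)) (snd (t, x)) = g (t, x)" "\<bar>\<phi> x\<bar> * weight \<nu> l \<delta> x \<le> A"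
          have "\<bar>v t x\<bar> * weight \<nu> l \<delta> x \<le> (\<bar>v t x - \<phi> x\<bar> + \<bar>\<phi> x\<bar>) * weight \<nu> l \<delta> x"
            by (intro mult_right_mono) auto
          also have "\<dots> \<le> R" using x R by (simp add: distrib_right)
          finally show "fst (t, x) \<in> {0..T} \<longrightarrow> \<bar>g (t, x)\<bar> * weight \<nu> l \<delta> (snd (t, x)) \<le> R"
            using x(2) True by simp
        qed
      next
        case False
        then show ?thesis by (intro AE_I2) auto
      qed
    qed
  qed
  show thesis
  proof
    show "case_prod (\<lambda>t x. if \<bar>g (t, x)\<bar> * weight \<nu> l \<delta> x \<le> R then g (t, x) else 0)
        \<in> borel_measurable (borel \<Otimes>\<^sub>M borel)"
      by measurable
    show "AE z in lborel \<Otimes>\<^sub>M lborel. fst z \<in> {0..T} \<longrightarrow> v (fst z) (snd z)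
        = (if \<bar>g (fst z, snd z)\<bar> * weight \<nu> l \<delta> (snd z) \<le> R then g (fst z, snd z) else 0)"
      using vg bound by eventually_elim auto
    show "\<bar>if \<bar>g (t, x)\<bar> * weight \<nu> l \<delta> x \<le> R then g (t, x) else 0\<bar> * weight \<nu> l \<delta> x \<le> R" for t x
      using R by simp
  qed
qed

section \<open>Maximal solutions\<close>

theorem lemma3p7:
  fixes f :: "real \<Rightarrow> real \<Rightarrow> real"
    and lu \<delta> l \<nu> :: real
    and \<phi> :: "'a::euclidean_space \<Rightarrow> real"
  assumes "DIM('a) > 2"
    and "cond_F0 f"
    and "cond_Fu DIM('a) f lu \<delta>"
    and "cond_Fs f l \<delta>"
    and "l = 0 \<longrightarrow> unif_lipschitz_far f"
    and "0 \<le> \<nu>" and "\<nu> < m_exp lu"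
    and "\<phi> \<in> X_space \<nu> l \<delta>"
  shows "\<exists>Tmax::ereal. 0 < Tmax \<and> (\<exists>u. maximal_solution f \<nu> l \<delta> \<phi> Tmax u)"
proof -
  let ?W = "weight \<nu> l \<delta> :: 'a \<Rightarrow> real"
  define \<gamma> where "\<gamma> = min 1 ((m_exp lu - \<nu>) * \<delta>)"
  obtain \<phi>' A where \<phi>'_borel [measurable]: "\<phi>' \<in> borel_measurable borel"
    and \<phi>': "AE x in lborel. \<phi> x = \<phi>' x" and A: "A \<ge> 0" "\<And>x. \<bar>\<phi>' x\<bar> * ?W x \<le> A"
    using X_space_borel_representative[OF assms(8)] by blast
  interpret P: weighted_heat_problem "source f" ?W "\<lambda>y. radial_potential \<gamma> (norm y)" "\<gamma> / 2" \<phi>' A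
    by (rule weighted_heat_problem_intro[OF assms(1-7) \<phi>'_borel A \<gamma>_def])
  define u where "u t x = heat_semigroup t \<phi> x + enn2real (P.source_part t x)" for t x
  \<comment> \<open>the Borel version of \<open>u\<close>, which differs from it only at time \<open>0\<close>\<close>
  define u' where "u' t x = P.heat_phi t x + enn2real (P.source_part t x)" for t x
  have u'_borel [measurable]: "case_prod u' \<in> borel_measurable (borel \<Otimes>\<^sub>M borel)"
    unfolding u'_def by measurable
  have \<phi>_kernel: "AE y in lborel. heat_kernel t (x - y) * \<phi> y = heat_kernel t (x - y) * \<phi>' y" for t and x :: 'a
    using \<phi>' by eventually_elim simp
  have uu': "u t x = u' t x" if "t \<noteq> 0" for t x
  proof -
    have "heat_semigroup t \<phi> x = P.heat_phi t x"
      unfolding heat_semigroup_def P.heat_phi_def using that \<phi>_kernel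
      by (simp, intro lebesgue_integral_AE_eq) auto
    then show ?thesis by (simp add: u_def u'_def)
  qed
  have u0: "u 0 = \<phi>"
    by (simp add: fun_eq_iff u_def P.source_part_0 heat_semigroup_def)
  have ae_uu': "AE z in lborel \<Otimes>\<^sub>M lborel. u (fst z) (snd z) = u' (fst z) (snd z)"
    using AE_fst_nonzero by eventually_elim (simp add: uu')
  have \<phi>_bound: "AE x in lborel. \<bar>\<phi> x\<bar> * ?W x \<le> A"
    using \<phi>' by eventually_elim (simp add: A)
  have AE_0: "AE x in lborel. x \<noteq> (0::'a)" by (rule AE_lborel_singleton)

  have bound: "\<exists>R\<ge>0. \<forall>t\<in>{0..T}. \<forall>x. x \<noteq> 0 \<longrightarrow> \<bar>u' t x\<bar> * ?W x \<le> R" if T: "ereal T < P.Tmax" for T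
  proof -
    obtain M where M: "M \<ge> 0" "\<forall>t\<in>{0..T}. \<forall>x. x \<noteq> 0 \<longrightarrow> P.source_part t x \<le> ennreal (M / ?W x)"
      using P.bounded_below_Tmax[OF T] unfolding P.bounded_upto_def by blast
    obtain H where H: "H \<ge> 0" "\<And>t x. \<lbrakk>t \<in> {0..T}; x \<noteq> 0\<rbrakk> \<Longrightarrow> \<bar>P.heat_phi t x\<bar> * ?W x \<le> H"
      using P.heat_phi_bound[of T] by blast
    have "\<bar>u' t x\<bar> * ?W x \<le> H + M" if t: "t \<in> {0..T}" and x: "x \<noteq> 0" for t x
    proof -
      have "enn2real (P.source_part t x) \<le> enn2real (ennreal (M / ?W x))"
        using M t x by (intro enn2real_mono) auto
      then have "enn2real (P.source_part t x) * ?W x \<le> M"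
        using M P.W_pos[OF x] by (simp add: pos_le_divide_eq)
      moreover have "\<bar>u' t x\<bar> * ?W x \<le> (\<bar>P.heat_phi t x\<bar> + enn2real (P.source_part t x)) * ?W x"
        unfolding u'_def by (intro mult_right_mono order_trans[OF abs_triangle_ineq]) auto
      ultimately show ?thesis using H(2)[OF t x] by (simp add: distrib_right)
    qed
    then show ?thesis using H(1) M(1) by (intro exI[of _ "H + M"]) auto
  qed

  have source_part_eq: "P.source_part t x = duhamel 0 (\<lambda>s y. ennreal (source f (u' s y) y)) t x" "P.source_part t x < \<top>"
    if t: "0 \<le> t" "ereal t < P.Tmax" and x: "x \<noteq> 0" for t x
  proof -
    have b: "P.bounded_upto t" using P.bounded_below_Tmax t by blast
    show "P.source_part t x = duhamel 0 (\<lambda>s y. ennreal (source f (u' s y) y)) t x"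
      using P.source_part_eq_duhamel[OF b order_refl] by (simp add: u'_def)
    obtain M where M: "\<forall>s\<in>{0..t}. \<forall>x. x \<noteq> 0 \<longrightarrow> P.source_part s x \<le> ennreal (M / ?W x)"
      using b unfolding P.bounded_upto_def by blast
    have "P.source_part t x \<le> ennreal (M / ?W x)"
      using M t x by simp
    then show "P.source_part t x < \<top>" by (rule le_less_trans) simp
  qed
  have equation: "F_op_defined f \<phi> u t x \<and> u t x = F_op f \<phi> u t x"
    if t: "0 \<le> t" "ereal t < P.Tmax" and x: "x \<noteq> 0" for t x
  proof -
    have ae: "AE z in lborel \<Otimes>\<^sub>M lborel. fst z \<in> {0..t} \<longrightarrow> u (fst z) (snd z) = u' (fst z) (snd z)"
      using ae_uu' by eventually_elim simp
    have "integrable lebesgue (\<lambda>y. heat_kernel t (x - y) * \<phi> y)"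
      using P.heat_phi_integrable[of t x] t x \<phi>_kernel by (subst lebesgue_integral_AE_eq(2)) auto
    moreover have "u t x = heat_semigroup t \<phi> x + enn2real (P.source_part t x)"
      by (simp add: u_def)
    ultimately show ?thesis
      using F_op_eq_duhamel(1)[OF assms(2) u'_borel ae order_refl, where x = x and \<phi> = \<phi>]
        F_op_eq_duhamel(2)[OF assms(2) u'_borel ae order_refl, where x = x] source_part_eq[OF t x]
      by (simp add: F_op_defined_def)
  qed

  have u_X: "u t \<in> borel_measurable lebesgue" "AE x in lborel. \<bar>u t x\<bar> * ?W x \<le> max R A"
    if t: "0 \<le> t" and R: "\<forall>x. x \<noteq> 0 \<longrightarrow> \<bar>u' t x\<bar> * ?W x \<le> R" for t R
  proof -
    show "u t \<in> borel_measurable lebesgue"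
    proof (cases "t = 0")
      case True
      then show ?thesis using assms(8) by (simp add: u0 X_space_def)
    next
      case False
      then show ?thesis by (intro lebesgue_measurable_AE_eq[of "u' t"]) (simp_all add: uu')
    qed
    show "AE x in lborel. \<bar>u t x\<bar> * ?W x \<le> max R A"
    proof (cases "t = 0")
      case True
      show ?thesis using \<phi>_bound by eventually_elim (simp add: True u0)
    next
      case False
      show ?thesis using AE_0 by eventually_elim (use R False in \<open>auto simp: uu' max.coboundedI1\<close>)
    qed
  qed

  have "maximal_solution f \<nu> l \<delta> \<phi> P.Tmax u"
    unfolding maximal_solution_def
  proof (intro conjI allI impI)
    fix t :: real assume t: "0 \<le> t" "ereal t < P.Tmax"
    obtain R where "\<forall>s\<in>{0..t}. \<forall>x. x \<noteq> 0 \<longrightarrow> \<bar>u' s x\<bar> * ?W x \<le> R"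
      using bound[OF t(2)] by blast
    then have R: "\<forall>x. x \<noteq> 0 \<longrightarrow> \<bar>u' t x\<bar> * ?W x \<le> R"
      using t(1) by simp
    have "X_norm \<nu> l \<delta> (u t) \<le> ereal (max R A)"
      using u_X[OF t(1) R] by (intro X_norm_leI)
    also have "\<dots> < \<infinity>" by (simp only: less_ereal.simps)
    finally show "u t \<in> X_space \<nu> l \<delta>"
      using u_X(1)[OF t(1) R] by (simp add: X_space_def)
    show "AE x in lebesgue. F_op_defined f \<phi> u t x \<and> u t x = F_op f \<phi> u t x"
      unfolding AE_completion_iff using AE_0 by eventually_elim (rule equation[OF t])
  next
    fix T :: real assume T: "T > 0" "ereal T < P.Tmax"
    have below: "ereal t < P.Tmax" if "t \<le> T" for t
      using that T(2) by (meson ereal_less_eq(3) le_less_trans)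
    obtain R where R: "R \<ge> 0" "\<And>t x. \<lbrakk>t \<in> {0..T}; x \<noteq> 0\<rbrakk> \<Longrightarrow> \<bar>u' t x\<bar> * ?W x \<le> R"
      using bound[OF T(2)] by blast
    \<comment> \<open>the sum of both norms bounds the distance from the datum; adding \<open>1\<close> makes it positive\<close>
    define \<rho> where "\<rho> = max R A + A + 1"
    have \<rho>: "\<rho> > 0" using A(1) by (simp add: \<rho>_def)
    have u_ball: "u \<in> X_ball \<nu> l \<delta> T \<rho> \<phi>"
      unfolding X_ball_def
    proof (intro CollectI conjI)
      have "case_prod u \<in> borel_measurable lebesgue"
      proof (rule lebesgue_measurable_AE_eq)
        show "case_prod u' \<in> borel_measurable borel"
          using u'_borel by (simp add: borel_prod)
        show "AE z in lborel. case_prod u z = case_prod u' z"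
          unfolding lborel_prod [symmetric] using ae_uu' by eventually_elim (simp add: case_prod_beta)
      qed
      then show "(\<lambda>(t, x). u t x) \<in> borel_measurable (lebesgue_on ({0..T} \<times> UNIV))"
        by (rule measurable_restrict_space1)
      have "X_norm \<nu> l \<delta> (\<lambda>x. u t x - \<phi> x) \<le> ereal \<rho>" if t: "t \<in> {0..T}" for t
      proof (rule X_norm_leI)
        have t0: "0 \<le> t" using t by simp
        have Rt: "\<forall>x. x \<noteq> 0 \<longrightarrow> \<bar>u' t x\<bar> * ?W x \<le> R" using R(2)[OF t] by blast
        show "(\<lambda>x. u t x - \<phi> x) \<in> borel_measurable lebesgue"
          using u_X(1)[OF t0 Rt] assms(8) by (intro borel_measurable_diff) (auto simp: X_space_def)
        show "AE x in lborel. \<bar>u t x - \<phi> x\<bar> * ?W x \<le> \<rho>"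
          using u_X(2)[OF t0 Rt] \<phi>_bound
        proof eventually_elim
          fix x assume x: "\<bar>u t x\<bar> * ?W x \<le> max R A" "\<bar>\<phi> x\<bar> * ?W x \<le> A"
          have "\<bar>u t x - \<phi> x\<bar> * ?W x \<le> (\<bar>u t x\<bar> + \<bar>\<phi> x\<bar>) * ?W x"
            by (intro mult_right_mono) auto
          then show "\<bar>u t x - \<phi> x\<bar> * ?W x \<le> \<rho>" using x by (simp add: \<rho>_def distrib_right)
        qed
      qed
      then show "AE t in lebesgue_on {0..T}. X_norm \<nu> l \<delta> (\<lambda>x. u t x - \<phi> x) \<le> ereal \<rho>"
        by (simp add: AE_restrict_space_iff)
    qed
    have u_fixed: "fixed_point f \<phi> T u"
      unfolding fixed_point_def AE_lebesgue_on_slab using AE_snd_nonzero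
    proof eventually_elim
      fix z :: "real \<times> 'a" assume "snd z \<noteq> 0"
      then show "fst z \<in> {0..T} \<longrightarrow> (case z of (t, x) \<Rightarrow> F_op_defined f \<phi> u t x \<and> u t x = F_op f \<phi> u t x)"
        using equation[of "fst z" "snd z"] below[of "fst z"] by (auto simp: case_prod_beta)
    qed
    have "AE (t, x) in lebesgue_on ({0..T} \<times> UNIV). v t x = u t x"
      if v: "v \<in> X_ball \<nu> l \<delta> T \<rho> \<phi>" and v_fixed: "fixed_point f \<phi> T v" for v
    proof -
      define Q where "Q = max R (\<rho> + A)"
      have Q: "R \<le> Q" "\<rho> + A \<le> Q" "Q \<ge> 0" using R(1) by (auto simp: Q_def)
      obtain v' where v'_borel [measurable]: "case_prod v' \<in> borel_measurable (borel \<Otimes>\<^sub>M borel)"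
        and vv': "AE z in lborel \<Otimes>\<^sub>M lborel. fst z \<in> {0..T} \<longrightarrow> v (fst z) (snd z) = v' (fst z) (snd z)"
        and v'_bound: "\<And>t x. \<bar>v' t x\<bar> * ?W x \<le> Q"
        using X_ball_borel_representative[OF v \<phi>_bound Q(2,3)] by blast
      define D where "D t x = duhamel 0 (\<lambda>s y. ennreal (source f (v' s y) y)) t x" for t x
      define E where "E t x = duhamel 0 (\<lambda>s y. ennreal \<bar>source f (u' s y) y - source f (v' s y) y\<bar>) t x" for t x
      have source_borel [measurable]: "case_prod (source f) \<in> borel_measurable (borel \<Otimes>\<^sub>M (borel :: 'a measure))"
        by (rule source_measurable[OF assms(2)])
      have diff: "ennreal \<bar>u' t x - v t x\<bar> \<le> E t x"
        if t: "t \<in> {0..T}" "t \<noteq> 0" and x: "x \<noteq> 0" and vt: "v t x = F_op f \<phi> v t x" for t x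
      proof -
        have D_fin: "D t x < \<top>"
          unfolding D_def using t x v'_bound by (intro P.duhamel_N_finite[of t v' Q]) auto
        have vD: "v t x = heat_semigroup t \<phi> x + enn2real (D t x)"
          unfolding vt D_def using t D_fin unfolding D_def
          by (intro F_op_eq_duhamel(1)[OF assms(2) v'_borel vv']) auto
        have uU: "u' t x = heat_semigroup t \<phi> x + enn2real (P.source_part t x)"
          using t by (simp add: uu' [symmetric] u_def)
        have source_part: "P.source_part t x = duhamel 0 (\<lambda>s y. ennreal (source f (u' s y) y)) t x" "P.source_part t x < \<top>"
          using source_part_eq[of t x] below[of t] t x by auto
        have "P.source_part t x \<le> duhamel 0 (\<lambda>s y. ennreal (source f (v' s y) y) + ennreal \<bar>source f (u' s y) y - source f (v' s y) y\<bar>) t x"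
          unfolding source_part(1) by (intro duhamel_mono) (auto simp: ennreal_plus [symmetric] simp del: ennreal_plus intro!: ennreal_leI)
        also have "\<dots> = D t x + E t x"
          unfolding D_def E_def by (rule duhamel_add) measurable
        finally have 1: "P.source_part t x \<le> D t x + E t x" .
        have "D t x \<le> duhamel 0 (\<lambda>s y. ennreal (source f (u' s y) y) + ennreal \<bar>source f (u' s y) y - source f (v' s y) y\<bar>) t x"
          unfolding D_def by (intro duhamel_mono) (auto simp: ennreal_plus [symmetric] simp del: ennreal_plus intro!: ennreal_leI)
        also have "\<dots> = P.source_part t x + E t x"
          unfolding source_part(1) E_def by (rule duhamel_add) measurable
        finally have 2: "D t x \<le> P.source_part t x + E t x" .
        show ?thesis
        proof (cases "E t x")
          case (real e)
          have "enn2real (P.source_part t x) \<le> enn2real (D t x) + e" "enn2real (D t x) \<le> enn2real (P.source_part t x) + e"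
            using 1 2 source_part(2) D_fin real by (cases "P.source_part t x"; cases "D t x"; auto simp: ennreal_plus [symmetric] simp del: ennreal_plus)+
          then show ?thesis
            using real unfolding vD uU by (auto intro!: ennreal_leI)
        qed simp
      qed
      have "AE z in lborel \<Otimes>\<^sub>M lborel. fst z \<in> {0..T} \<longrightarrow>
          (case z of (t, x) \<Rightarrow> F_op_defined f \<phi> v t x \<and> v t x = F_op f \<phi> v t x)"
        using v_fixed unfolding fixed_point_def AE_lebesgue_on_slab .
      then have "AE z in lborel \<Otimes>\<^sub>M lborel. fst z \<in> {0..T} \<longrightarrow>
          ennreal \<bar>u' (fst z) (snd z) - v' (fst z) (snd z)\<bar> \<le> E (fst z) (snd z)"
        using vv' AE_snd_nonzero AE_fst_nonzero
      proof eventually_elim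
        fix z :: "real \<times> 'a"
        assume "fst z \<in> {0..T} \<longrightarrow> (case z of (t, x) \<Rightarrow> F_op_defined f \<phi> v t x \<and> v t x = F_op f \<phi> v t x)"
          "fst z \<in> {0..T} \<longrightarrow> v (fst z) (snd z) = v' (fst z) (snd z)" "snd z \<noteq> 0" "fst z \<noteq> 0"
        then show "fst z \<in> {0..T} \<longrightarrow>
          ennreal \<bar>u' (fst z) (snd z) - v' (fst z) (snd z)\<bar> \<le> E (fst z) (snd z)"
          using diff[of "fst z" "snd z"] by (auto simp: case_prod_beta)
      qed
      then have "AE z in lborel \<Otimes>\<^sub>M lborel. fst z \<in> {0..T} \<longrightarrow> snd z \<noteq> 0 \<longrightarrow>
          u' (fst z) (snd z) = v' (fst z) (snd z)"
        unfolding E_def using R(2) Q v'_bound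
        by (intro P.solution_unique[OF u'_borel v'_borel T(1) Q(3)]) (auto intro: order_trans)
      then show ?thesis
        unfolding AE_lebesgue_on_slab using vv' ae_uu' AE_snd_nonzero
        by eventually_elim (auto simp: case_prod_beta)
    qed
    with \<rho> u_ball u_fixed
    show "\<exists>\<rho>>0. u \<in> X_ball \<nu> l \<delta> T \<rho> \<phi> \<and> fixed_point f \<phi> T u \<and>
           (\<forall>v \<in> X_ball \<nu> l \<delta> T \<rho> \<phi>. fixed_point f \<phi> T v \<longrightarrow>
              (AE (t, x) in lebesgue_on ({0..T} \<times> UNIV). v t x = u t x))"
      by blast
  next
    assume "P.Tmax < \<infinity>"
    then obtain S where S: "P.Tmax = ereal S"
      using P.Tmax_pos by (cases P.Tmax) auto
    obtain H where H: "H \<ge> 0" "\<And>t x. \<lbrakk>t \<in> {0..S}; x \<noteq> 0\<rbrakk> \<Longrightarrow> \<bar>P.heat_phi t x\<bar> * ?W x \<le> H"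
      using P.heat_phi_bound[of S] by blast
    have "\<forall>\<^sub>F t in at_left S. ereal r < X_norm \<nu> l \<delta> (u t)" for r
    proof -
      have r: "\<bar>r\<bar> + H \<ge> 0" using H by simp
      obtain \<eta> where \<eta>: "\<eta> > 0" "\<eta> \<le> S" "\<And>t. \<lbrakk>S - \<eta> < t; t < S\<rbrakk> \<Longrightarrow>
          \<not> (AE x in lborel. x \<noteq> 0 \<longrightarrow> P.source_part t x \<le> ennreal ((\<bar>r\<bar> + H) / ?W x))"
        using P.blow_up[OF S r] by blast
      have "ereal r < X_norm \<nu> l \<delta> (u t)" if t: "S - \<eta> < t" "t < S" for t
      proof (rule ccontr)
        assume "\<not> ereal r < X_norm \<nu> l \<delta> (u t)"
        then have "X_norm \<nu> l \<delta> (u t) \<le> ereal r" by simp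
        from X_norm_leD[OF this]
        have "AE x in lborel. x \<noteq> 0 \<longrightarrow> P.source_part t x \<le> ennreal ((\<bar>r\<bar> + H) / ?W x)"
        proof (eventually_elim, intro impI)
          fix x :: 'a assume x: "\<bar>u t x\<bar> * ?W x \<le> r" "x \<noteq> 0"
          have t0: "t > 0" using t \<eta> by simp
          have "P.source_part t x < \<top>"
            using source_part_eq(2)[of t x] t t0 x S by simp
          have "enn2real (P.source_part t x) * ?W x \<le> (\<bar>u t x\<bar> + \<bar>P.heat_phi t x\<bar>) * ?W x"
            using uu'[of t x] t0 unfolding u'_def by (intro mult_right_mono) auto
          also have "\<dots> \<le> \<bar>r\<bar> + H"
            using x H(2)[of t x] t t0 by (simp add: distrib_right)
          finally have "enn2real (P.source_part t x) \<le> (\<bar>r\<bar> + H) / ?W x"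
            using P.W_pos[OF x(2)] by (simp add: pos_le_divide_eq)
          then have "ennreal (enn2real (P.source_part t x)) \<le> ennreal ((\<bar>r\<bar> + H) / ?W x)"
            by (rule ennreal_leI)
          then show "P.source_part t x \<le> ennreal ((\<bar>r\<bar> + H) / ?W x)"
            using \<open>P.source_part t x < \<top>\<close> by simp
        qed
        then show False using \<eta>(3)[OF t] by blast
      qed
      then show ?thesis
        using \<eta>(1) by (subst eventually_at_left[of "S - \<eta>"]) (auto intro!: exI[of _ "S - \<eta>"])
    qed
    then show "((\<lambda>t. X_norm \<nu> l \<delta> (u t)) \<longlongrightarrow> \<infinity>) (at_left (real_of_ereal P.Tmax))"
      unfolding S by (simp add: tendsto_PInfty)
  qed
  then show ?thesis using P.Tmax_pos by blast
qed

end
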